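(* Let $r \geq 2$ and $s \geq 1$ be integers, let $k$ be a field whose characteristic does not divide $2r$, and let $\bar k$ be an algebraically closed field containing $k$. Let $c_0, c_1, c_2 \in k$ and $c_{i,j} \in k$ for $1 \le i \le r-1$, $1 \le j \le s$. Let $\mathcal{X}_{r,s} \subset \mathbb{P}^{s+2}_{\bar k}$ be the algebraic curve, defined over $k$, given in homogeneous coordinates $x, y_1, \dots, y_s, w, z$ by the $s+1$ equations $$zw = c_0x^2 + c_1xw + c_2w^2,$$ $$y_j^r = h_j(z,w) := z^r + c_{1,j}z^{r-1}w + \cdots + c_{r-1,j}zw^{r-1} + w^r, \qquad j = 1, \dots, s.$$ Assume that $\mathcal{X}_{r,s}$ is smooth and that $c_0 \neq 0$. Then the genus of $\mathcal{X}_{r,s}$ is $$g(\mathcal{X}_{r,s}) = 1 + r^s\bigl(s(r-1) - 1\bigr).$$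
   Context: A field of characteristic $0$ counts as having characteristic not dividing $2r$. The genus $g(\mathcal{X}_{r,s})$ is the usual genus of the smooth projective curve $\mathcal{X}_{r,s}$ over $\bar k$. *)

theory Defs
  imports
    "HOL-Library.Poly_Mapping"
    "HOL-Library.Function_Algebras"
    "HOL-Computational_Algebra.Computational_Algebra"
begin

text \<open>
  Classical (variety) language over an algebraically closed field \<open>'a\<close>.  Points of the
  projective space \<open>P^n\<close> are handled through their homogeneous coordinate vectors, i.e. nonzero
  functions \<open>nat \<Rightarrow> 'a\<close> that vanish beyond index \<open>n\<close>.
\<close>

subsection \<open>Polynomials in the indeterminates \<open>X 0, X 1, ...\<close>\<close>

type_synonym 'a mpoly = "(nat \<Rightarrow>\<^sub>0 nat) \<Rightarrow>\<^sub>0 'a"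

definition Var :: "nat \<Rightarrow> 'a::comm_ring_1 mpoly" where
  "Var i = Poly_Mapping.single (Poly_Mapping.single i 1) 1"

definition Const :: "'a::comm_ring_1 \<Rightarrow> 'a mpoly" where
  "Const a = Poly_Mapping.single 0 a"

definition eval_monom :: "(nat \<Rightarrow>\<^sub>0 nat) \<Rightarrow> (nat \<Rightarrow> 'a::comm_ring_1) \<Rightarrow> 'a" where
  "eval_monom m p = (\<Prod>i\<in>Poly_Mapping.keys m. p i ^ Poly_Mapping.lookup m i)"

definition poly_eval :: "'a::comm_ring_1 mpoly \<Rightarrow> (nat \<Rightarrow> 'a) \<Rightarrow> 'a" where
  "poly_eval F p = (\<Sum>m\<in>Poly_Mapping.keys F. Poly_Mapping.lookup F m * eval_monom m p)"

lemma eval_monom_superset: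
  assumes "finite S" "Poly_Mapping.keys m \<subseteq> S"
  shows "eval_monom m p = (\<Prod>i\<in>S. p i ^ Poly_Mapping.lookup m i)"
  unfolding eval_monom_def using assms
  by (intro prod.mono_neutral_left) (auto simp: in_keys_iff)

lemma eval_monom_add: "eval_monom (m + m') p = eval_monom m p * eval_monom m' p"
proof -
  let ?S = "Poly_Mapping.keys m \<union> Poly_Mapping.keys m'"
  have "Poly_Mapping.keys (m + m') \<subseteq> ?S" by (rule Poly_Mapping.keys_add)
  then show ?thesis
    by (simp add: eval_monom_superset[of ?S] lookup_add power_add prod.distrib)
qed

lemma poly_eval_superset:
  assumes "finite S" "Poly_Mapping.keys F \<subseteq> S"
  shows "poly_eval F p = (\<Sum>m\<in>S. Poly_Mapping.lookup F m * eval_monom m p)"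
  unfolding poly_eval_def using assms
  by (intro sum.mono_neutral_left) (auto simp: in_keys_iff)

lemma poly_eval_single [simp]:
  "poly_eval (Poly_Mapping.single m a) p = a * eval_monom m p"
  by (cases "a = 0") (simp_all add: poly_eval_def)

lemma poly_eval_0 [simp]: "poly_eval 0 p = 0"
  by (simp add: poly_eval_def)

lemma poly_eval_add [simp]: "poly_eval (F + G) p = poly_eval F p + poly_eval G p"
proof -
  let ?S = "Poly_Mapping.keys F \<union> Poly_Mapping.keys G"
  have "Poly_Mapping.keys (F + G) \<subseteq> ?S" by (rule Poly_Mapping.keys_add)
  then show ?thesis
    by (simp add: poly_eval_superset[of ?S] lookup_add distrib_right sum.distrib)
qed

lemma poly_eval_sum [simp]: "poly_eval (\<Sum>i\<in>I. F i) p = (\<Sum>i\<in>I. poly_eval (F i) p)"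
  by (induction I rule: infinite_finite_induct) auto

lemma mpoly_eq_sum_single:
  "F = (\<Sum>m\<in>Poly_Mapping.keys F. Poly_Mapping.single m (Poly_Mapping.lookup F m))"
  by (rule poly_mapping_eqI)
    (auto simp: lookup_sum lookup_single when_def in_keys_iff sum.delta')

lemma poly_eval_mult [simp]: "poly_eval (F * G) p = poly_eval F p * poly_eval G p"
proof -
  have "F * G = (\<Sum>m\<in>Poly_Mapping.keys F. \<Sum>m'\<in>Poly_Mapping.keys G.
      Poly_Mapping.single (m + m') (Poly_Mapping.lookup F m * Poly_Mapping.lookup G m'))"
    by (subst mpoly_eq_sum_single[of F], subst mpoly_eq_sum_single[of G])
      (simp add: sum_product mult_single)
  then show ?thesis
    by (simp add: poly_eval_def[of F] poly_eval_def[of G] eval_monom_add sum_product mult_ac)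
qed

lemma poly_eval_uminus [simp]: "poly_eval (- F) p = - poly_eval F p"
  using poly_eval_add[of F "- F" p] by (simp add: minus_unique[symmetric] del: poly_eval_add)

lemma poly_eval_diff [simp]: "poly_eval (F - G) p = poly_eval F p - poly_eval G p"
  using poly_eval_add[of F "- G" p] by simp

lemma poly_eval_Var [simp]: "poly_eval (Var i) p = p i"
  by (simp add: Var_def eval_monom_def)

lemma poly_eval_Const [simp]: "poly_eval (Const a) p = a"
  by (simp add: Const_def eval_monom_def)

lemma poly_eval_1 [simp]: "poly_eval 1 p = 1"
  using poly_eval_Const[of 1 p] by (simp add: Const_def del: poly_eval_Const)

lemma poly_eval_power [simp]: "poly_eval (F ^ k) p = poly_eval F p ^ k"
  by (induction k) auto

text \<open>Where \<open>X i\<close> does not occur in \<open>m\<close>, the truncated exponent is harmless: the coefficient is \<open>0\<close>.\<close>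

definition partial :: "nat \<Rightarrow> 'a::comm_ring_1 mpoly \<Rightarrow> 'a mpoly" where
  "partial i F = (\<Sum>m\<in>Poly_Mapping.keys F.
     Poly_Mapping.single (m - Poly_Mapping.single i 1)
       (of_nat (Poly_Mapping.lookup m i) * Poly_Mapping.lookup F m))"

text \<open>The homogeneous polynomials of degree \<open>d\<close> in \<open>X 0, ..., X n\<close>, together with \<open>0\<close>.\<close>

definition homogeneous :: "nat \<Rightarrow> nat \<Rightarrow> 'a::comm_ring_1 mpoly set" where
  "homogeneous n d = {F. \<forall>m\<in>Poly_Mapping.keys F.
     Poly_Mapping.keys m \<subseteq> {..n} \<and> (\<Sum>i\<in>Poly_Mapping.keys m. Poly_Mapping.lookup m i) = d}"

text \<open>\<open>differential n F p v\<close> is \<open>dF\<close> at \<open>p\<close>, applied to the vector \<open>v\<close>.\<close>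

definition differential ::
    "nat \<Rightarrow> 'a::comm_ring_1 mpoly \<Rightarrow> (nat \<Rightarrow> 'a) \<Rightarrow> (nat \<Rightarrow> 'a) \<Rightarrow> 'a" where
  "differential n F p v = (\<Sum>i\<le>n. poly_eval (partial i F) p * v i)"

subsection \<open>Projective zero sets, smoothness, tangent spaces\<close>

definition coord_space :: "nat \<Rightarrow> (nat \<Rightarrow> 'a::comm_ring_1) set" where
  "coord_space n = {v. \<forall>i>n. v i = 0}"

definition proj_zeros :: "nat \<Rightarrow> 'a::comm_ring_1 mpoly list \<Rightarrow> (nat \<Rightarrow> 'a) set" where
  "proj_zeros n Fs = {p \<in> coord_space n. p \<noteq> (\<lambda>_. 0) \<and> (\<forall>F\<in>set Fs. poly_eval F p = 0)}"

definition gradient :: "nat \<Rightarrow> 'a::comm_ring_1 mpoly \<Rightarrow> (nat \<Rightarrow> 'a) \<Rightarrow> (nat \<Rightarrow> 'a)" where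
  "gradient n F p = (\<lambda>i. if i \<le> n then poly_eval (partial i F) p else 0)"

definition vec_scale :: "'a::field \<Rightarrow> (nat \<Rightarrow> 'a) \<Rightarrow> (nat \<Rightarrow> 'a)" where
  "vec_scale a v = (\<lambda>i. a * v i)"

interpretation vec: vector_space vec_scale
  by unfold_locales (auto simp: vec_scale_def fun_eq_iff algebra_simps)

definition jacobian_rank :: "nat \<Rightarrow> 'a::field mpoly list \<Rightarrow> (nat \<Rightarrow> 'a) \<Rightarrow> nat" where
  "jacobian_rank n Fs p = vec.dim {gradient n F p | F. F \<in> set Fs}"

text \<open>
  Jacobian criterion: the closed subscheme of \<open>P^n\<close> cut out by the \<open>m\<close> homogeneous polynomials
  \<open>Fs\<close> is smooth of dimension \<open>n - m\<close> iff the Jacobian matrix has rank \<open>m\<close> at every point of it.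
  We only use \<open>m = n - 1\<close>, the case of a curve.
\<close>

definition smooth_curve :: "nat \<Rightarrow> 'a::field mpoly list \<Rightarrow> bool" where
  "smooth_curve n Fs \<longleftrightarrow> length Fs + 1 = n \<and>
     (\<forall>p\<in>proj_zeros n Fs. jacobian_rank n Fs p = length Fs)"

text \<open>
  The tangent space of the affine cone at \<open>p\<close>.  The tangent space of the projective variety at
  the point represented by \<open>p\<close> is its quotient by the line spanned by \<open>p\<close>.
\<close>

definition tangent :: "nat \<Rightarrow> 'a::comm_ring_1 mpoly list \<Rightarrow> (nat \<Rightarrow> 'a) \<Rightarrow> (nat \<Rightarrow> 'a) set" where
  "tangent n Fs p = {v \<in> coord_space n. \<forall>F\<in>set Fs. differential n F p v = 0}"

subsection \<open>Regular differential forms and the genus\<close>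

definition zariski_open :: "nat \<Rightarrow> 'a::comm_ring_1 mpoly list \<Rightarrow> (nat \<Rightarrow> 'a) set \<Rightarrow> bool" where
  "zariski_open n Fs U \<longleftrightarrow>
     (\<exists>Gs \<subseteq> (\<Union>d. homogeneous n d). U = {p \<in> proj_zeros n Fs. \<exists>G\<in>Gs. poly_eval G p \<noteq> 0})"

text \<open>A pair \<open>(A, B)\<close> stands for the rational function \<open>A / B\<close> on \<open>P^n\<close>.\<close>

definition regular_frac :: "nat \<Rightarrow> (nat \<Rightarrow> 'a::field) set \<Rightarrow> 'a mpoly \<times> 'a mpoly \<Rightarrow> bool" where
  "regular_frac n U = (\<lambda>(A, B).
     (\<exists>d. A \<in> homogeneous n d \<and> B \<in> homogeneous n d) \<and> (\<forall>q\<in>U. poly_eval B q \<noteq> 0))"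

definition frac_value :: "'a::field mpoly \<times> 'a mpoly \<Rightarrow> (nat \<Rightarrow> 'a) \<Rightarrow> 'a" where
  "frac_value = (\<lambda>(A, B) q. poly_eval A q / poly_eval B q)"

definition frac_differential ::
    "nat \<Rightarrow> 'a::field mpoly \<times> 'a mpoly \<Rightarrow> (nat \<Rightarrow> 'a) \<Rightarrow> (nat \<Rightarrow> 'a) \<Rightarrow> 'a" where
  "frac_differential n = (\<lambda>(A, B) q v.
     (differential n A q v * poly_eval B q - poly_eval A q * differential n B q v) / (poly_eval B q)\<^sup>2)"

text \<open>
  A regular differential form on a projective variety assigns to each point a linear form on the
  tangent space and is, near each point, of the shape \<open>\<Sum> f dg\<close> with regular functions \<open>f, g\<close>.
  Since \<open>f, g\<close> are quotients of homogeneous polynomials of equal degree, \<open>\<Sum> f dg\<close> vanishes at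
  \<open>p\<close> on the vector \<open>p\<close> and takes the same value at \<open>(p, v)\<close> and \<open>(a p, a v)\<close>; so forms on the
  variety are the same as functions \<open>\<omega> p v\<close> on its cone that are locally of this shape.  Values
  outside the cone and its tangent spaces are set to \<open>0\<close>, so that each form is counted once.
\<close>

definition regular_forms ::
    "nat \<Rightarrow> 'a::field mpoly list \<Rightarrow> ((nat \<Rightarrow> 'a) \<Rightarrow> (nat \<Rightarrow> 'a) \<Rightarrow> 'a) set" where
  "regular_forms n Fs = {\<omega>.
     (\<forall>p v. p \<notin> proj_zeros n Fs \<or> v \<notin> tangent n Fs p \<longrightarrow> \<omega> p v = 0) \<and>
     (\<forall>p\<in>proj_zeros n Fs. \<exists>U fgs. zariski_open n Fs U \<and> p \<in> U \<and>
        (\<forall>(f, g)\<in>set fgs. regular_frac n U f \<and> regular_frac n U g) \<and>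
        (\<forall>q\<in>U. \<forall>v\<in>tangent n Fs q.
           \<omega> q v = (\<Sum>(f, g)\<leftarrow>fgs. frac_value f q * frac_differential n g q v)))}"

definition form_scale ::
    "'a::field \<Rightarrow> ((nat \<Rightarrow> 'a) \<Rightarrow> (nat \<Rightarrow> 'a) \<Rightarrow> 'a) \<Rightarrow> ((nat \<Rightarrow> 'a) \<Rightarrow> (nat \<Rightarrow> 'a) \<Rightarrow> 'a)" where
  "form_scale a \<omega> = (\<lambda>p v. a * \<omega> p v)"

interpretation form: vector_space form_scale
  by unfold_locales (auto simp: form_scale_def fun_eq_iff algebra_simps)

text \<open>
  The genus of a smooth projective curve: the dimension of its space of global regular
  differential forms.  (The library's \<open>dim\<close> is \<open>0\<close> on an infinite-dimensional space, so a
  positive value also says that the space is finite-dimensional.)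
\<close>

definition genus :: "nat \<Rightarrow> 'a::field mpoly list \<Rightarrow> nat" where
  "genus n Fs = form.dim (regular_forms n Fs)"

subsection \<open>The curves\<close>

definition field_embedding :: "('k::field \<Rightarrow> 'a::field) \<Rightarrow> bool" where
  "field_embedding \<iota> \<longleftrightarrow> \<iota> 1 = 1 \<and>
     (\<forall>a b. \<iota> (a + b) = \<iota> a + \<iota> b) \<and> (\<forall>a b. \<iota> (a * b) = \<iota> a * \<iota> b)"

text \<open>
  The coordinates \<open>x, y_1, ..., y_s, w, z\<close> of \<open>P^(s+2)\<close> are, in this order,
  \<open>X 0, X 1, ..., X s, X (s+1), X (s+2)\<close>.
\<close>

definition conic_eq ::
    "('k::field \<Rightarrow> 'a::field) \<Rightarrow> nat \<Rightarrow> 'k \<Rightarrow> 'k \<Rightarrow> 'k \<Rightarrow> 'a mpoly" where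
  "conic_eq \<iota> s c0 c1 c2 = (let x = Var 0; w = Var (s + 1); z = Var (s + 2) in
     z * w - (Const (\<iota> c0) * x\<^sup>2 + Const (\<iota> c1) * x * w + Const (\<iota> c2) * w\<^sup>2))"

definition h_poly ::
    "('k::field \<Rightarrow> 'a::field) \<Rightarrow> nat \<Rightarrow> nat \<Rightarrow> (nat \<Rightarrow> nat \<Rightarrow> 'k) \<Rightarrow> nat \<Rightarrow> 'a mpoly" where
  "h_poly \<iota> r s c j = (let w = Var (s + 1); z = Var (s + 2) in
     z ^ r + (\<Sum>i=1..r-1. Const (\<iota> (c i j)) * z ^ (r - i) * w ^ i) + w ^ r)"

definition curve_eqs ::
    "('k::field \<Rightarrow> 'a::field) \<Rightarrow> nat \<Rightarrow> nat \<Rightarrow> 'k \<Rightarrow> 'k \<Rightarrow> 'k \<Rightarrow> (nat \<Rightarrow> nat \<Rightarrow> 'k) \<Rightarrow> 'a mpoly list" where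
  "curve_eqs \<iota> r s c0 c1 c2 c =
     conic_eq \<iota> s c0 c1 c2 # map (\<lambda>j. Var j ^ r - h_poly \<iota> r s c j) [1..<s+1]"

lemma proj_zeros_curve_eqs:
  "p \<in> proj_zeros (s + 2) (curve_eqs \<iota> r s c0 c1 c2 c) \<longleftrightarrow>
     p \<in> coord_space (s + 2) \<and> p \<noteq> (\<lambda>_. 0) \<and>
     (let x = p 0; w = p (s + 1); z = p (s + 2) in
        z * w = \<iota> c0 * x\<^sup>2 + \<iota> c1 * x * w + \<iota> c2 * w\<^sup>2 \<and>
        (\<forall>j\<in>{1..s}. p j ^ r =
           z ^ r + (\<Sum>i=1..r-1. \<iota> (c i j) * z ^ (r - i) * w ^ i) + w ^ r))"
  by (auto simp: proj_zeros_def curve_eqs_def conic_eq_def h_poly_def Let_def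
      atLeastLessThanSuc_atLeastAtMost)

end

theory Submission
  imports Defs
begin

text \<open>
  By adjunction the regular forms are the homogeneous polynomials of degree \<open>N = s(r - 1) - 1\<close>
  restricted to the curve, times a canonical form \<open>coeff_of\<close> that compares a tangent plane with
  the minors of the Jacobian matrix.  Conversely, the conic is parametrised by \<open>t = x/w\<close> and by
  \<open>1/t\<close>, and over each of these two affine lines the curve is the cyclic cover \<open>y_j^r = H_j(t)\<close>.
  A regular form gives a function on this cover that is locally a fraction; taking norms under
  the group of tuples of \<open>r\<close>-th roots of unity shows that it is a polynomial
  \<open>\<Sum> g_a(t) y^a\<close> with all exponents \<open>a_j < r\<close>.  Comparing the two charts gives
  \<open>2 |a| + deg g_a \<le> 2 N\<close>.  So the genus is the number of pairs \<open>(a, i)\<close> with \<open>0 \<le> a_j < r\<close> and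
  \<open>2 |a| + i \<le> 2 N\<close>, which the symmetry \<open>a_j \<mapsto> r - 1 - a_j\<close> evaluates.
\<close>

subsection \<open>Homogeneous polynomials\<close>

text \<open>A regular form is given only through local expressions, so membership of a function in
  the coordinate ring of the cover must be proved. The group of tuples of \<open>r\<close>-th roots
  of unity does this: its order \<open>r ^ s\<close> is invertible, and averaging, Fourier
  extraction and norms turn questions about the cover into questions about polynomials in
  \<open>t\<close>. Smoothness serves to make the canonical form well defined. Over
  \<open>w \<noteq> 0\<close> it keeps the zeros of different \<open>y_j\<close> apart and makes the
  minor \<open>E j p * K j p\<close> nonzero at a zero of \<open>y_j\<close>. At
  \<open>w = 0\<close> the assumption on \<open>c_0\<close> leaves one point of the conic, over
  which no \<open>y_j\<close> vanishes. Each chart carries a tangent field \<open>V\<close> on which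
  the canonical form is constant, so that a regular form is the same as one function on the cover.
  The factors 2 in \<open>2 |a| + deg g_a \<le> 2 N\<close> have a common origin: passing from
  \<open>t\<close> to \<open>u = 1/t\<close> rescales the homogeneous coordinates by
  \<open>w = u\<^sup>2\<close>, which divides each \<open>y_j\<close> by \<open>u\<^sup>2\<close>
  and multiplies the form by \<open>u ^ (2 * N)\<close> up to sign.\<close>

definition monom_deg :: "(nat \<Rightarrow>\<^sub>0 nat) \<Rightarrow> nat" where
  "monom_deg m = (\<Sum>i\<in>Poly_Mapping.keys m. Poly_Mapping.lookup m i)"

lemma monom_deg_superset:
  assumes "finite S" "Poly_Mapping.keys m \<subseteq> S"
  shows "monom_deg m = (\<Sum>i\<in>S. Poly_Mapping.lookup m i)"
  unfolding monom_deg_def using assms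
  by (intro sum.mono_neutral_left) (auto simp: in_keys_iff)

lemma monom_deg_add: "monom_deg (m + m') = monom_deg m + monom_deg m'"
proof -
  let ?S = "Poly_Mapping.keys m \<union> Poly_Mapping.keys m'"
  have "Poly_Mapping.keys (m + m') \<subseteq> ?S" by (rule Poly_Mapping.keys_add)
  then show ?thesis
    by (simp add: monom_deg_superset[of ?S] lookup_add sum.distrib)
qed

lemma monom_deg_single [simp]: "monom_deg (Poly_Mapping.single i k) = k"
  by (simp add: monom_deg_def)

lemma eval_monom_single [simp]: "eval_monom (Poly_Mapping.single i k) p = p i ^ k"
  by (simp add: eval_monom_def)

lemma minus_single_add:
  assumes "Poly_Mapping.lookup m i > 0"
  shows "m = (m - Poly_Mapping.single i (1::nat)) + Poly_Mapping.single i 1"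
  using assms by (intro poly_mapping_eqI) (auto simp: lookup_add lookup_minus lookup_single when_def)

lemma homogeneous_iff:
  "F \<in> homogeneous n d \<longleftrightarrow>
     (\<forall>m\<in>Poly_Mapping.keys F. Poly_Mapping.keys m \<subseteq> {..n} \<and> monom_deg m = d)"
  by (simp add: homogeneous_def monom_deg_def)

lemma eval_monom_scale: "eval_monom m (\<lambda>i. c * p i) = c ^ monom_deg m * eval_monom m p"
  by (simp add: eval_monom_def monom_deg_def power_mult_distrib prod.distrib power_sum)

lemma poly_eval_scale:
  assumes "F \<in> homogeneous n d"
  shows "poly_eval F (\<lambda>i. c * p i) = c ^ d * poly_eval F p"
  using assms
  by (auto simp: poly_eval_def eval_monom_scale homogeneous_iff sum_distrib_left mult_ac intro!: sum.cong)

lemma homogeneous_zero [simp]: "0 \<in> homogeneous n d"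
  by (simp add: homogeneous_def)

lemma homogeneous_add:
  "F \<in> homogeneous n d \<Longrightarrow> G \<in> homogeneous n d \<Longrightarrow> F + G \<in> homogeneous n d"
  using Poly_Mapping.keys_add[of F G] by (auto simp: homogeneous_iff)

lemma homogeneous_uminus: "F \<in> homogeneous n d \<Longrightarrow> - F \<in> homogeneous n d"
  by (simp add: homogeneous_iff in_keys_iff)

lemma homogeneous_diff:
  "F \<in> homogeneous n d \<Longrightarrow> G \<in> homogeneous n d \<Longrightarrow> F - G \<in> homogeneous n d"
  using homogeneous_add[of F n d "- G"] homogeneous_uminus by auto

lemma homogeneous_sum:
  "(\<And>i. i \<in> I \<Longrightarrow> F i \<in> homogeneous n d) \<Longrightarrow> (\<Sum>i\<in>I. F i) \<in> homogeneous n d"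
  by (induction I rule: infinite_finite_induct) (auto intro: homogeneous_add)

lemma homogeneous_single:
  "Poly_Mapping.keys m \<subseteq> {..n} \<Longrightarrow> Poly_Mapping.single m a \<in> homogeneous n (monom_deg m)"
  by (simp add: homogeneous_iff)

lemma homogeneous_mult:
  assumes "F \<in> homogeneous n d" "G \<in> homogeneous n e"
  shows "F * G \<in> homogeneous n (d + e)"
proof -
  have *: "F * G = (\<Sum>m\<in>Poly_Mapping.keys F. \<Sum>m'\<in>Poly_Mapping.keys G.
      Poly_Mapping.single (m + m') (Poly_Mapping.lookup F m * Poly_Mapping.lookup G m'))"
    by (subst mpoly_eq_sum_single[of F], subst mpoly_eq_sum_single[of G])
      (simp add: sum_product mult_single)
  show ?thesis unfolding *
  proof (intro homogeneous_sum)
    fix m m' assume "m \<in> Poly_Mapping.keys F" "m' \<in> Poly_Mapping.keys G"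
    then have "Poly_Mapping.keys m \<union> Poly_Mapping.keys m' \<subseteq> {..n}" "monom_deg (m + m') = d + e"
      using assms by (auto simp: homogeneous_iff monom_deg_add)
    then have "Poly_Mapping.keys (m + m') \<subseteq> {..n}" "monom_deg (m + m') = d + e"
      using Poly_Mapping.keys_add[of m m'] by blast+
    then show "Poly_Mapping.single (m + m') (Poly_Mapping.lookup F m * Poly_Mapping.lookup G m')
        \<in> homogeneous n (d + e)"
      using homogeneous_single by metis
  qed
qed

lemma homogeneous_Var: "i \<le> n \<Longrightarrow> Var i \<in> homogeneous n 1"
  unfolding Var_def using homogeneous_single[of "Poly_Mapping.single i 1" n] by simp

lemma homogeneous_Const: "Const a \<in> homogeneous n 0"
  unfolding Const_def using homogeneous_single[of 0 n a] by (simp add: monom_deg_def)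

lemma homogeneous_Const_Var: "i \<le> n \<Longrightarrow> Const a * Var i \<in> homogeneous n 1"
  using homogeneous_mult[OF homogeneous_Const homogeneous_Var, of i n a] by simp

lemma homogeneous_1: "1 \<in> homogeneous n 0"
  using homogeneous_Const[of 1 n] by (simp add: Const_def)

lemma homogeneous_power:
  assumes "F \<in> homogeneous n d" shows "F ^ k \<in> homogeneous n (k * d)"
  by (induction k) (auto intro: homogeneous_1 homogeneous_mult assms)

lemma homogeneous_prod:
  assumes "finite I" "\<And>i. i \<in> I \<Longrightarrow> F i \<in> homogeneous n (d i)"
  shows "(\<Prod>i\<in>I. F i) \<in> homogeneous n (\<Sum>i\<in>I. d i)"
  using assms by (induction I rule: finite_induct) (auto intro: homogeneous_1 homogeneous_mult)

lemma poly_eval_prod [simp]: "poly_eval (\<Prod>i\<in>I. F i) p = (\<Prod>i\<in>I. poly_eval (F i) p)"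
  by (induction I rule: infinite_finite_induct) auto

text \<open>A monomial without \<open>X i\<close> gets coefficient 0, so the truncated subtractions
  in its exponent and in \<open>d - 1\<close> do no harm.\<close>

lemma homogeneous_partial:
  assumes "F \<in> homogeneous n d"
  shows "partial i F \<in> homogeneous n (d - 1)"
  unfolding partial_def
proof (intro homogeneous_sum)
  fix m assume m: "m \<in> Poly_Mapping.keys F"
  show "Poly_Mapping.single (m - Poly_Mapping.single i 1)
       (of_nat (Poly_Mapping.lookup m i) * Poly_Mapping.lookup F m) \<in> homogeneous n (d - 1)"
  proof (cases "Poly_Mapping.lookup m i = 0")
    case False
    then have e: "m = (m - Poly_Mapping.single i 1) + Poly_Mapping.single i 1"
      by (intro minus_single_add) simp
    have "monom_deg m = monom_deg (m - Poly_Mapping.single i 1) + 1"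
      by (subst e) (simp only: monom_deg_add monom_deg_single)
    then have "monom_deg (m - Poly_Mapping.single i 1) = d - 1"
      using assms m by (simp add: homogeneous_iff)
    moreover have "Poly_Mapping.keys (m - Poly_Mapping.single i 1) \<subseteq> Poly_Mapping.keys m"
      by (auto simp: in_keys_iff lookup_minus)
    then have "Poly_Mapping.keys (m - Poly_Mapping.single i 1) \<subseteq> {..n}"
      using assms m unfolding homogeneous_iff by blast
    ultimately show ?thesis using homogeneous_single by metis
  qed simp
qed

subsection \<open>The differential of a polynomial\<close>

text \<open>The differential is linear in the polynomial; isolating it on monomials reduces Leibniz,
  homogeneity and Euler to exponent arithmetic.\<close>

definition monom_differential ::
    "nat \<Rightarrow> (nat \<Rightarrow>\<^sub>0 nat) \<Rightarrow> (nat \<Rightarrow> 'a::comm_ring_1) \<Rightarrow> (nat \<Rightarrow> 'a) \<Rightarrow> 'a" where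
  "monom_differential n m p v =
     (\<Sum>i\<le>n. of_nat (Poly_Mapping.lookup m i) * eval_monom (m - Poly_Mapping.single i 1) p * v i)"

lemma differential_eq_sum:
  "differential n F p v =
     (\<Sum>m\<in>Poly_Mapping.keys F. Poly_Mapping.lookup F m * monom_differential n m p v)"
proof -
  have "differential n F p v = (\<Sum>i\<le>n. \<Sum>m\<in>Poly_Mapping.keys F. Poly_Mapping.lookup F m *
      (of_nat (Poly_Mapping.lookup m i) * eval_monom (m - Poly_Mapping.single i 1) p * v i))"
    by (simp add: differential_def partial_def sum_distrib_right sum_distrib_left mult_ac)
  then show ?thesis
    by (subst (asm) sum.swap) (simp add: monom_differential_def sum_distrib_left)
qed

lemma differential_superset:
  assumes "finite S" "Poly_Mapping.keys F \<subseteq> S"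
  shows "differential n F p v = (\<Sum>m\<in>S. Poly_Mapping.lookup F m * monom_differential n m p v)"
  unfolding differential_eq_sum using assms
  by (intro sum.mono_neutral_left) (auto simp: in_keys_iff)

lemma differential_single:
  "differential n (Poly_Mapping.single m a) p v = a * monom_differential n m p v"
  by (cases "a = 0") (simp_all add: differential_eq_sum)

lemma differential_0 [simp]: "differential n 0 p v = 0"
  by (simp add: differential_eq_sum)

lemma differential_add [simp]:
  "differential n (F + G) p v = differential n F p v + differential n G p v"
proof -
  let ?S = "Poly_Mapping.keys F \<union> Poly_Mapping.keys G"
  have "Poly_Mapping.keys (F + G) \<subseteq> ?S" by (rule Poly_Mapping.keys_add)
  then show ?thesis
    by (simp add: differential_superset[of ?S] lookup_add distrib_right sum.distrib)
qed

lemma differential_sum [simp]: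
  "differential n (\<Sum>i\<in>I. F i) p v = (\<Sum>i\<in>I. differential n (F i) p v)"
  by (induction I rule: infinite_finite_induct) auto

lemma differential_uminus [simp]: "differential n (- F) p v = - differential n F p v"
  using differential_add[of n F "- F" p v] by (simp add: minus_unique[symmetric] del: differential_add)

lemma differential_diff [simp]:
  "differential n (F - G) p v = differential n F p v - differential n G p v"
  using differential_add[of n F "- G" p v] by simp

lemma monom_differential_add:
  "monom_differential n (m + m') p v =
     monom_differential n m p v * eval_monom m' p + eval_monom m p * monom_differential n m' p v"
proof -
  have 1: "of_nat (Poly_Mapping.lookup a i) * eval_monom (a + b - Poly_Mapping.single i 1) p =
     of_nat (Poly_Mapping.lookup a i) * eval_monom (a - Poly_Mapping.single i 1) p * eval_monom b p"
    for a b i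
  proof (cases "Poly_Mapping.lookup a i = 0")
    case False
    then have "a + b - Poly_Mapping.single i 1 = (a - Poly_Mapping.single i 1) + b"
      by (intro poly_mapping_eqI) (auto simp: lookup_add lookup_minus lookup_single when_def)
    then show ?thesis by (simp add: eval_monom_add mult_ac)
  qed simp
  have 2: "of_nat (Poly_Mapping.lookup (m + m') i) * eval_monom (m + m' - Poly_Mapping.single i 1) p =
     of_nat (Poly_Mapping.lookup m i) * eval_monom (m - Poly_Mapping.single i 1) p * eval_monom m' p +
     of_nat (Poly_Mapping.lookup m' i) * eval_monom (m' - Poly_Mapping.single i 1) p * eval_monom m p" for i
    using 1[of m i m'] 1[of m' i m] by (simp add: lookup_add distrib_right add.commute[of m' m])
  show ?thesis
    unfolding monom_differential_def 2
    by (simp add: distrib_right distrib_left sum.distrib sum_distrib_left sum_distrib_right mult_ac)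
qed

lemma differential_mult [simp]:
  "differential n (F * G) p v =
     differential n F p v * poly_eval G p + poly_eval F p * differential n G p v"
proof -
  have "F * G = (\<Sum>m\<in>Poly_Mapping.keys F. \<Sum>m'\<in>Poly_Mapping.keys G.
      Poly_Mapping.single (m + m') (Poly_Mapping.lookup F m * Poly_Mapping.lookup G m'))"
    by (subst mpoly_eq_sum_single[of F], subst mpoly_eq_sum_single[of G])
      (simp add: sum_product mult_single)
  then have "differential n (F * G) p v = (\<Sum>m\<in>Poly_Mapping.keys F. \<Sum>m'\<in>Poly_Mapping.keys G.
      Poly_Mapping.lookup F m * monom_differential n m p v * (Poly_Mapping.lookup G m' * eval_monom m' p) +
      Poly_Mapping.lookup F m * eval_monom m p * (Poly_Mapping.lookup G m' * monom_differential n m' p v))"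
    by (simp add: differential_single monom_differential_add algebra_simps)
  then show ?thesis
    by (simp only: poly_eval_def[of F] poly_eval_def[of G]
        differential_eq_sum[of n F] differential_eq_sum[of n G] sum_product sum.distrib)
qed

lemma differential_Const [simp]: "differential n (Const a) p v = 0"
  by (simp add: Const_def differential_single monom_differential_def)

lemma differential_1 [simp]: "differential n 1 p v = 0"
  using differential_Const[of n 1 p v] by (simp add: Const_def del: differential_Const)

lemma differential_Var [simp]: "differential n (Var i) p v = (if i \<le> n then v i else 0)"
proof -
  have "(\<Sum>j\<le>n. of_nat (Poly_Mapping.lookup (Poly_Mapping.single i (1::nat)) j) *
      eval_monom (Poly_Mapping.single i 1 - Poly_Mapping.single j 1) p * v j) =
    (\<Sum>j\<le>n. if i = j then v j else 0)"
    by (intro sum.cong refl) (auto simp: lookup_single when_def eval_monom_def)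
  then show ?thesis
    by (simp add: Var_def differential_single monom_differential_def)
qed

lemma differential_power [simp]:
  "differential n (F ^ k) p v = of_nat k * poly_eval F p ^ (k - 1) * differential n F p v"
proof (induction k)
  case (Suc k)
  then show ?case by (cases k) (simp_all add: algebra_simps)
qed simp

lemma differential_add_right:
  "differential n F p (\<lambda>i. v i + u i) = differential n F p v + differential n F p u"
  by (simp add: differential_def distrib_left sum.distrib)

lemma differential_scale_right:
  "differential n F p (\<lambda>i. c * v i) = c * differential n F p v"
  by (simp add: differential_def sum_distrib_left mult_ac)

lemma poly_eval_partial_unit:
  "i \<le> n \<Longrightarrow> poly_eval (partial i F) p = differential n F p (\<lambda>j. if j = i then 1 else 0)"
  by (simp add: differential_def if_distrib[where f = "\<lambda>x. _ * x"] cong: if_cong)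

text \<open>The partial derivatives are homogeneous of degree \<open>d - 1\<close>; the remaining
  factor \<open>c\<close> comes from scaling the tangent vector together with the point.\<close>

lemma differential_scale:
  assumes "F \<in> homogeneous n d"
  shows "differential n F (\<lambda>i. c * p i) (\<lambda>i. c * v i) = c ^ d * differential n F p v"
proof -
  have "of_nat (Poly_Mapping.lookup m i) * eval_monom (m - Poly_Mapping.single i 1) (\<lambda>i. c * p i) * (c * v i)
     = c ^ d * (of_nat (Poly_Mapping.lookup m i) * eval_monom (m - Poly_Mapping.single i 1) p * v i)"
    if "monom_deg m = d" for m i
  proof (cases "Poly_Mapping.lookup m i = 0")
    case False
    then have e: "m = (m - Poly_Mapping.single i 1) + Poly_Mapping.single i 1"
      by (intro minus_single_add) simp
    have "d = monom_deg (m - Poly_Mapping.single i 1) + 1"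
      unfolding that[symmetric] by (subst e) (simp only: monom_deg_add monom_deg_single)
    then show ?thesis by (simp add: eval_monom_scale mult_ac)
  qed simp
  then have "monom_differential n m (\<lambda>i. c * p i) (\<lambda>i. c * v i) = c ^ d * monom_differential n m p v"
    if "monom_deg m = d" for m
    using that by (simp add: monom_differential_def sum_distrib_left)
  then show ?thesis
    using assms by (auto simp: differential_eq_sum homogeneous_iff sum_distrib_left mult_ac intro!: sum.cong)
qed

lemma euler_homogeneous:
  assumes "F \<in> homogeneous n d"
  shows "differential n F p p = of_nat d * poly_eval F p"
proof -
  have *: "of_nat (Poly_Mapping.lookup m i) * eval_monom (m - Poly_Mapping.single i 1) p * p i
     = of_nat (Poly_Mapping.lookup m i) * eval_monom m p" for m i
  proof (cases "Poly_Mapping.lookup m i = 0")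
    case False
    then have e: "m = (m - Poly_Mapping.single i 1) + Poly_Mapping.single i 1"
      by (intro minus_single_add) simp
    have "eval_monom m p = eval_monom (m - Poly_Mapping.single i 1) p * p i"
      by (subst e) (simp only: eval_monom_add eval_monom_single power_one_right)
    then show ?thesis by (simp add: mult_ac)
  qed simp
  have "monom_differential n m p p = of_nat d * eval_monom m p"
    if "monom_deg m = d" "Poly_Mapping.keys m \<subseteq> {..n}" for m
    unfolding monom_differential_def * that(1)[symmetric] monom_deg_superset[OF _ that(2), simplified]
    by (simp add: sum_distrib_right)
  then show ?thesis
    using assms by (auto simp: differential_eq_sum poly_eval_def homogeneous_iff sum_distrib_left mult_ac
        intro!: sum.cong)
qed

subsection \<open>Roots of unity and cyclic covers of the affine line\<close>

text \<open>Euclid's argument: over a finite field the product of all \<open>X - x\<close>, plus 1,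
  would be a nonconstant polynomial without roots.\<close>

lemma infinite_UNIV_alg_closed: "infinite (UNIV :: 'a::alg_closed_field set)"
proof
  assume fin: "finite (UNIV :: 'a set)"
  define p :: "'a poly" where "p = (\<Prod>x\<in>UNIV. [:-x, 1:]) + 1"
  have "degree (\<Prod>x\<in>UNIV. [:-x, 1 :: 'a:]) = card (UNIV :: 'a set)"
    by (subst degree_prod_eq_sum_degree) auto
  then have "degree p = card (UNIV :: 'a set)"
    using fin by (simp add: p_def degree_add_eq_left card_gt_0_iff)
  then have "degree p > 0" using fin by (simp add: card_gt_0_iff)
  then obtain x where "poly p x = 0"
    using alg_closed_imp_poly_has_root by blast
  moreover have "poly p x = 1"
    using fin by (auto simp: p_def poly_prod prod_zero_iff)
  ultimately show False by simp
qed

text \<open>The polynomial \<open>X^r - 1\<close> is separable: its derivative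
  \<open>r X^(r-1)\<close> vanishes only at 0, which is not a root. Hence its \<open>r\<close>
  linear factors are distinct.\<close>

lemma card_roots_of_unity:
  assumes "of_nat r \<noteq> (0 :: 'a::alg_closed_field)"
  shows "card {z::'a. z ^ r = 1} = r"
proof -
  have r: "r > 0" using assms by (cases r) auto
  define p :: "'a poly" where "p = monom 1 r - 1"
  have deg: "degree p = r"
    unfolding p_def using r
    by (subst diff_conv_add_uminus, subst degree_add_eq_left) (auto simp: degree_monom_eq)
  have p0: "p \<noteq> 0" using deg r by auto
  obtain A where A: "size A = degree p" "p = smult (lead_coeff p) (\<Prod>x\<in>#A. [:-x, 1:])"
    using alg_closed_imp_factorization[OF p0] by blast
  have root: "poly p x = x ^ r - 1" for x by (simp add: p_def poly_monom)
  have "count A x \<le> 1" for x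
  proof (rule ccontr)
    assume "\<not> count A x \<le> 1"
    then have "replicate_mset 2 x \<subseteq># A"
      by (simp add: count_le_replicate_mset_subset_eq[symmetric])
    then obtain B where "A = replicate_mset 2 x + B" by (metis subset_mset.le_iff_add)
    then have "p = [:-x, 1:] * ([:-x, 1:] * smult (lead_coeff p) (\<Prod>x\<in>#B. [:-x, 1:]))"
      using A(2) by (simp add: numeral_2_eq_2 mult_ac)
    then obtain q where q: "p = [:-x, 1:] * ([:-x, 1:] * q)" by blast
    have "poly (pderiv p) x = 0" by (simp only: q pderiv_mult poly_add poly_mult) simp
    moreover have "poly (pderiv p) x = of_nat r * x ^ (r - 1)"
      by (simp add: p_def pderiv_diff pderiv_monom poly_monom)
    ultimately have "x = 0" using assms by simp
    moreover have "poly p x = 0" unfolding q by simp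
    ultimately show False using r root[of x] by (simp add: zero_power)
  qed
  moreover have "set_mset A = {z. z ^ r = 1}"
  proof -
    have "poly p x = 0 \<longleftrightarrow> x \<in># A" for x
      by (subst A(2)) (use p0 in \<open>auto simp: poly_prod_mset prod_mset_zero_iff\<close>)
    then show ?thesis by (auto simp: root)
  qed
  moreover have "size A = card (set_mset A)" if "\<forall>x. count A x \<le> 1"
  proof -
    have "size A = (\<Sum>x\<in>set_mset A. count A x)" by (rule size_multiset_overloaded_eq)
    also have "\<dots> = (\<Sum>x\<in>set_mset A. 1)"
      using that by (intro sum.cong refl le_antisym) auto
    finally show ?thesis by simp
  qed
  ultimately show ?thesis using A(1) deg by simp
qed

text \<open>Orthogonality of characters. If \<open>r\<close> does not divide \<open>k\<close>, some
  root of unity \<open>u\<close> has \<open>u ^ k \<noteq> 1\<close>, since otherwise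
  \<open>X^(k mod r) - 1\<close> would have \<open>r\<close> roots; multiplication by
  \<open>u\<close> permutes the summands and multiplies the sum by \<open>u ^ k\<close>.\<close>

lemma sum_roots_of_unity_power:
  assumes "of_nat r \<noteq> (0 :: 'a::alg_closed_field)"
  shows "(\<Sum>z | z ^ r = (1::'a). z ^ k) = (if r dvd k then of_nat r else 0)"
proof (cases "r dvd k")
  case True
  then obtain l where "k = r * l" by blast
  then have "(\<Sum>z | z ^ r = (1::'a). z ^ k) = (\<Sum>z | z ^ r = (1::'a). 1)"
    by (intro sum.cong) (auto simp: power_mult)
  then show ?thesis using True card_roots_of_unity[OF assms] by simp
next
  case False
  have r: "r > 0" using assms by (cases r) auto
  define i where "i = k mod r"
  have i: "0 < i" "i < r" using False r by (auto simp: i_def dvd_eq_mod_eq_0)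
  define p :: "'a poly" where "p = monom 1 i - 1"
  have deg: "degree p = i"
    unfolding p_def using i
    by (subst diff_conv_add_uminus, subst degree_add_eq_left) (auto simp: degree_monom_eq)
  have p0: "p \<noteq> 0" using deg i by auto
  have "\<not> {z::'a. z ^ r = 1} \<subseteq> {z. poly p z = 0}"
  proof
    assume "{z::'a. z ^ r = 1} \<subseteq> {z. poly p z = 0}"
    then have "r \<le> card {z. poly p z = 0}"
      using card_mono[OF poly_roots_finite[OF p0]] card_roots_of_unity[OF assms] by metis
    also have "\<dots> \<le> i" using card_poly_roots_bound[OF p0] deg by simp
    finally show False using i by simp
  qed
  then obtain u :: 'a where u: "u ^ r = 1" "u ^ i \<noteq> 1" by (auto simp: p_def poly_monom)
  have u0: "u \<noteq> 0" using u(1) r by (auto simp: power_0_left)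
  have "u ^ k = u ^ (r * (k div r) + i)" by (simp add: i_def)
  then have uk: "u ^ k \<noteq> 1" using u by (simp add: power_add power_mult)
  have "(\<Sum>z | z ^ r = (1::'a). z ^ k) = (\<Sum>z | z ^ r = (1::'a). (u * z) ^ k)"
    by (rule sum.reindex_bij_witness[of _ "\<lambda>z. u * z" "\<lambda>z. z / u"])
      (use u u0 in \<open>auto simp: power_mult_distrib power_divide\<close>)
  also have "\<dots> = u ^ k * (\<Sum>z | z ^ r = (1::'a). z ^ k)"
    by (simp add: power_mult_distrib sum_distrib_left)
  finally have "(1 - u ^ k) * (\<Sum>z | z ^ r = (1::'a). z ^ k) = 0" by (simp add: left_diff_distrib)
  then show ?thesis using uk False by simp
qed

lemma poly_eq_0_if_infinite_zeros:
  fixes p :: "'a::idom poly"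
  assumes "infinite S" "\<And>x. x \<in> S \<Longrightarrow> poly p x = 0"
  shows "p = 0"
  using assms poly_roots_finite[of p] by (metis (mono_tags, lifting) mem_Collect_eq rev_finite_subset subsetI)

section \<open>Monomials in the \<open>y_j\<close> and characters of the group of tuples of roots of
  unity\<close>

definition multi_pow :: "nat \<Rightarrow> (nat \<Rightarrow> nat) \<Rightarrow> (nat \<Rightarrow> 'a::comm_ring_1) \<Rightarrow> 'a" where
  "multi_pow s a y = (\<Prod>j\<in>{1..s}. y j ^ a j)"

text \<open>Extensional functions make the set finite, and make two vectors equal as soon as they
  agree on \<open>{1..s}\<close>.\<close>

definition exponents :: "nat \<Rightarrow> nat \<Rightarrow> (nat \<Rightarrow> nat) set" where
  "exponents r s = PiE {1..s} (\<lambda>_. {..<r})"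

text \<open>The deck group of the cover \<open>y_j^r = H_j(t)\<close>, acting by coordinatewise
  multiplication; it is simply transitive on a fibre where no \<open>y_j\<close> vanishes.\<close>

definition unit_group :: "nat \<Rightarrow> nat \<Rightarrow> (nat \<Rightarrow> 'a::field) set" where
  "unit_group r s = PiE {1..s} (\<lambda>_. {z. z ^ r = 1})"

lemma finite_exponents [simp]: "finite (exponents r s)"
  unfolding exponents_def by (intro finite_PiE) auto

lemma multi_pow_mult: "multi_pow s a (\<lambda>j. e j * y j) = multi_pow s a e * multi_pow s a y"
  by (simp add: multi_pow_def power_mult_distrib prod.distrib)

lemma multi_pow_add: "multi_pow s (\<lambda>j. a j + b j) y = multi_pow s a y * multi_pow s b y"
  by (simp add: multi_pow_def power_add prod.distrib)

lemma multi_pow_nz: "(\<And>j. j \<in> {1..s} \<Longrightarrow> y j \<noteq> 0) \<Longrightarrow> multi_pow s a y \<noteq> (0::'a::idom)"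
  by (simp add: multi_pow_def)

lemma multi_pow_cong: "(\<And>j. j \<in> {1..s} \<Longrightarrow> a j = b j \<and> y j = z j) \<Longrightarrow> multi_pow s a y = multi_pow s b z"
  unfolding multi_pow_def by (intro prod.cong) auto

lemma finite_unit_group [simp]:
  assumes "r > 0" shows "finite (unit_group r s :: (nat \<Rightarrow> 'a::field) set)"
proof -
  have "finite {z::'a. z ^ r = 1}"
  proof -
    have "{z::'a. z ^ r = 1} \<subseteq> {z. poly (monom 1 r - 1) z = 0}" by (auto simp: poly_monom)
    moreover have "monom 1 r - 1 \<noteq> (0 :: 'a poly)"
    proof
      assume "monom 1 r - 1 = (0 :: 'a poly)"
      then have "poly (monom 1 r - 1) (0::'a) = 0" by simp
      then show False using assms by (simp add: poly_monom power_0_left)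
    qed
    ultimately show ?thesis using poly_roots_finite finite_subset by blast
  qed
  then show ?thesis unfolding unit_group_def by (intro finite_PiE) auto
qed

text \<open>The sum over tuples factors into one sum over roots of unity for each
  coordinate.\<close>

lemma sum_unit_group:
  assumes "of_nat r \<noteq> (0 :: 'a::alg_closed_field)"
  shows "(\<Sum>e\<in>unit_group r s. multi_pow s k (e :: nat \<Rightarrow> 'a)) =
    (if \<forall>j\<in>{1..s}. r dvd k j then of_nat r ^ s else 0)"
proof -
  have r: "r > 0" using assms by (cases r) auto
  have fin: "finite {z::'a. z ^ r = 1}"
    using card_roots_of_unity[OF assms] r by (metis card.infinite less_numeral_extra(3))
  have "(\<Sum>e\<in>unit_group r s. multi_pow s k (e :: nat \<Rightarrow> 'a)) =
      (\<Prod>j\<in>{1..s}. \<Sum>z | z ^ r = (1::'a). z ^ k j)"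
    unfolding unit_group_def multi_pow_def using fin by (subst prod_sum_PiE) auto
  also have "\<dots> = (\<Prod>j\<in>{1..s}. if r dvd k j then of_nat r else 0)"
    by (simp only: sum_roots_of_unity_power[OF assms])
  also have "\<dots> = (if \<forall>j\<in>{1..s}. r dvd k j then of_nat r ^ s else 0)"
    by (auto intro!: prod_zero)
  finally show ?thesis .
qed

text \<open>Fourier inversion on the group of tuples of \<open>r\<close>-th roots of unity.\<close>

lemma unit_group_extract:
  fixes y :: "nat \<Rightarrow> 'a::alg_closed_field"
  assumes r: "of_nat r \<noteq> (0 :: 'a)" and b: "b \<in> exponents r s"
  shows "(\<Sum>e\<in>unit_group r s. multi_pow s (\<lambda>j. r - b j) e *
            (\<Sum>a\<in>exponents r s. c a * multi_pow s a (\<lambda>j. e j * y j)))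
         = of_nat r ^ s * (c b * multi_pow s b y)"
proof -
  \<comment> \<open>The natural number \<open>r - b j\<close> plays the role of the inverse exponent
    \<open>- b j\<close>. As \<open>(r - b j) + a j\<close> lies strictly between 0 and
    \<open>2 * r\<close>, it is divisible by \<open>r\<close> only when it equals
    \<open>r\<close>.\<close>
  have dvd: "(\<forall>j\<in>{1..s}. r dvd (r - b j) + a j) \<longleftrightarrow> a = b" if a: "a \<in> exponents r s" for a
  proof
    assume *: "\<forall>j\<in>{1..s}. r dvd (r - b j) + a j"
    have "a j = b j" if j: "j \<in> {1..s}" for j
    proof -
      have lt: "a j < r" "b j < r" using a b j by (auto simp: exponents_def)
      obtain l where l: "(r - b j) + a j = r * l" using * j by blast
      have "(r - b j) + a j < r * 2" "(r - b j) + a j > 0" using lt by auto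
      then have "l = 1" unfolding l by auto
      then show ?thesis using l lt by simp
    qed
    then show "a = b" using a b unfolding exponents_def by (metis PiE_ext)
  next
    assume "a = b"
    moreover have "r - b j + b j = r" if "j \<in> {1..s}" for j
    proof -
      have "b j < r" using b that by (auto simp: exponents_def)
      then show ?thesis by simp
    qed
    ultimately show "\<forall>j\<in>{1..s}. r dvd (r - b j) + a j" by simp
  qed
  have "(\<Sum>e\<in>unit_group r s. multi_pow s (\<lambda>j. r - b j) e *
            (\<Sum>a\<in>exponents r s. c a * multi_pow s a (\<lambda>j. e j * y j)))
     = (\<Sum>e\<in>unit_group r s. \<Sum>a\<in>exponents r s. c a * multi_pow s a y *
          multi_pow s (\<lambda>j. (r - b j) + a j) e)"
    by (simp add: multi_pow_mult multi_pow_add sum_distrib_left mult_ac)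
  also have "\<dots> = (\<Sum>a\<in>exponents r s. c a * multi_pow s a y *
      (\<Sum>e\<in>unit_group r s. multi_pow s (\<lambda>j. (r - b j) + a j) e))"
    by (subst sum.swap) (simp add: sum_distrib_left)
  also have "\<dots> = (\<Sum>a\<in>exponents r s. if a = b then c a * multi_pow s a y * of_nat r ^ s else 0)"
    by (intro sum.cong refl, subst sum_unit_group[OF r], subst dvd) auto
  also have "\<dots> = of_nat r ^ s * (c b * multi_pow s b y)"
    using b by simp
  finally show ?thesis .
qed

text \<open>The values on a single orbit determine each term by Fourier extraction, and the monomial
  can be cancelled because no \<open>y j\<close> is zero.\<close>

lemma unit_group_unique:
  fixes y :: "nat \<Rightarrow> 'a::alg_closed_field"
  assumes r: "of_nat r \<noteq> (0 :: 'a)" and b: "b \<in> exponents r s"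
    and eq: "\<And>e. e \<in> unit_group r s \<Longrightarrow>
      (\<Sum>a\<in>exponents r s. c a * multi_pow s a (\<lambda>j. e j * y j)) =
      (\<Sum>a\<in>exponents r s. d a * multi_pow s a (\<lambda>j. e j * y j))"
    and nz: "\<And>j. j \<in> {1..s} \<Longrightarrow> y j \<noteq> 0"
  shows "c b = d b"
proof -
  have "of_nat r ^ s * (c b * multi_pow s b y) = of_nat r ^ s * (d b * multi_pow s b y)"
    unfolding unit_group_extract[OF r b, symmetric] using eq by (intro sum.cong) auto
  then show ?thesis using r multi_pow_nz[of s y b] nz by simp
qed

section \<open>Polynomial functions on a cyclic cover of the affine line\<close>

locale cyclic_cover =
  fixes r s :: nat and H :: "nat \<Rightarrow> 'a::alg_closed_field poly"
  assumes of_nat_r: "of_nat r \<noteq> (0 :: 'a)"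
begin

definition above :: "'a \<Rightarrow> (nat \<Rightarrow> 'a) \<Rightarrow> bool" where
  "above t y \<longleftrightarrow> (\<forall>j\<in>{1..s}. y j ^ r = poly (H j) t)"

definition normal_form :: "((nat \<Rightarrow> nat) \<Rightarrow> 'a poly) \<Rightarrow> 'a \<Rightarrow> (nat \<Rightarrow> 'a) \<Rightarrow> 'a" where
  "normal_form g t y = (\<Sum>a\<in>exponents r s. poly (g a) t * multi_pow s a y)"

text \<open>The coordinate ring of the cover, seen as functions: a free module over the polynomials
  in \<open>t\<close> with the monomials of exponents below \<open>r\<close> as basis. Values away
  from the cover are left unconstrained.\<close>

definition polyfun :: "('a \<Rightarrow> (nat \<Rightarrow> 'a) \<Rightarrow> 'a) \<Rightarrow> bool" where
  "polyfun \<phi> \<longleftrightarrow> (\<exists>g. \<forall>t y. above t y \<longrightarrow> \<phi> t y = normal_form g t y)"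

lemma r_pos: "r > 0"
  using of_nat_r by (cases r) auto

lemma above_unit_group:
  "above t y \<Longrightarrow> e \<in> unit_group r s \<Longrightarrow> above t (\<lambda>j. e j * y j)"
  by (auto simp: above_def unit_group_def power_mult_distrib)

lemma exists_above: "\<exists>y. above t y"
proof -
  have "\<exists>y. y ^ r = poly (H j) t" for j using nth_root_exists[OF r_pos] .
  then show ?thesis unfolding above_def by metis
qed

lemma polyfun_cong:
  assumes "polyfun \<phi>" "\<And>t y. above t y \<Longrightarrow> \<psi> t y = \<phi> t y"
  shows "polyfun \<psi>"
  using assms unfolding polyfun_def by metis

lemma normal_form_cong:
  "(\<And>j. j \<in> {1..s} \<Longrightarrow> y j = z j) \<Longrightarrow> normal_form g t y = normal_form g t z"
  unfolding normal_form_def by (intro sum.cong refl arg_cong2[where f = "(*)"] multi_pow_cong) auto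

text \<open>Elements of \<open>unit_group\<close> carry junk values outside \<open>{1..s}\<close>,
  so a translated point is known only on \<open>{1..s}\<close>; polynomial functions do not see the
  difference.\<close>

lemma polyfun_restrict:
  assumes "polyfun \<phi>" "above t y" "\<And>j. j \<in> {1..s} \<Longrightarrow> z j = y j"
  shows "\<phi> t z = \<phi> t y"
proof -
  have "above t z" using assms by (simp add: above_def)
  then show ?thesis using assms normal_form_cong[of z y] by (auto simp: polyfun_def)
qed

lemma polyfun_add:
  assumes "polyfun \<phi>" "polyfun \<psi>" shows "polyfun (\<lambda>t y. \<phi> t y + \<psi> t y)"
proof -
  obtain g h where "\<And>t y. above t y \<Longrightarrow> \<phi> t y = normal_form g t y"
     "\<And>t y. above t y \<Longrightarrow> \<psi> t y = normal_form h t y"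
    using assms unfolding polyfun_def by blast
  then have "\<forall>t y. above t y \<longrightarrow> \<phi> t y + \<psi> t y = normal_form (\<lambda>a. g a + h a) t y"
    by (auto simp: normal_form_def distrib_right sum.distrib)
  then show ?thesis unfolding polyfun_def by blast
qed

lemma polyfun_0: "polyfun (\<lambda>t y. 0)"
  unfolding polyfun_def by (rule exI[of _ "\<lambda>_. 0"]) (auto simp: normal_form_def)

lemma polyfun_sum:
  "(\<And>i. i \<in> I \<Longrightarrow> polyfun (\<phi> i)) \<Longrightarrow> polyfun (\<lambda>t y. \<Sum>i\<in>I. \<phi> i t y)"
  by (induction I rule: infinite_finite_induct) (auto intro: polyfun_add polyfun_0)

text \<open>Division with remainder of each exponent by \<open>r\<close>, with \<open>y_j^r\<close>
  replaced by \<open>H_j\<close>, brings any monomial to normal form. Closure under products rests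
  on this.\<close>

lemma polyfun_multi_pow: "polyfun (\<lambda>t y. poly c t * multi_pow s k y)"
proof -
  define a where "a = restrict (\<lambda>j. k j mod r) {1..s}"
  define g where "g b = (if b = a then c * (\<Prod>j\<in>{1..s}. H j ^ (k j div r)) else 0)" for b
  have a: "a \<in> exponents r s" using r_pos by (auto simp: a_def exponents_def)
  have "poly c t * multi_pow s k y = normal_form g t y" if "above t y" for t y
  proof -
    have "multi_pow s k y = (\<Prod>j\<in>{1..s}. poly (H j) t ^ (k j div r) * y j ^ a j)"
      unfolding multi_pow_def
    proof (intro prod.cong refl)
      fix j assume j: "j \<in> {1..s}"
      have "y j ^ k j = y j ^ (r * (k j div r) + k j mod r)" by simp
      also have "\<dots> = (y j ^ r) ^ (k j div r) * y j ^ (k j mod r)"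
        by (simp only: power_add power_mult)
      finally show "y j ^ k j = poly (H j) t ^ (k j div r) * y j ^ a j"
        using that j by (simp add: above_def a_def)
    qed
    then have "poly c t * multi_pow s k y = poly (g a) t * multi_pow s a y"
      by (simp add: g_def multi_pow_def prod.distrib poly_prod poly_power)
    also have "\<dots> = (\<Sum>b\<in>exponents r s. if b = a then poly (g b) t * multi_pow s b y else 0)"
      using a by simp
    also have "\<dots> = normal_form g t y"
      unfolding normal_form_def by (intro sum.cong) (auto simp: g_def)
    finally show ?thesis .
  qed
  then show ?thesis unfolding polyfun_def by blast
qed

lemma polyfun_poly: "polyfun (\<lambda>t y. poly c t)"
  using polyfun_multi_pow[of c "\<lambda>_. 0"] by (simp add: multi_pow_def)

lemma polyfun_coord:
  assumes "j \<in> {1..s}" shows "polyfun (\<lambda>t y. y j)"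
proof -
  have "multi_pow s (\<lambda>i. if i = j then 1 else 0) y = y j" for y :: "nat \<Rightarrow> 'a"
  proof -
    have "multi_pow s (\<lambda>i. if i = j then 1 else 0) y = (\<Prod>i\<in>{1..s}. if i = j then y i else 1)"
      unfolding multi_pow_def by (intro prod.cong) auto
    then show ?thesis using assms by simp
  qed
  then show ?thesis using polyfun_multi_pow[of 1 "\<lambda>i. if i = j then 1 else 0"] by simp
qed

lemma polyfun_mult:
  assumes "polyfun \<phi>" "polyfun \<psi>" shows "polyfun (\<lambda>t y. \<phi> t y * \<psi> t y)"
proof -
  obtain g h where gh: "\<And>t y. above t y \<Longrightarrow> \<phi> t y = normal_form g t y"
     "\<And>t y. above t y \<Longrightarrow> \<psi> t y = normal_form h t y"
    using assms unfolding polyfun_def by blast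
  have "polyfun (\<lambda>t y. \<Sum>a\<in>exponents r s. \<Sum>b\<in>exponents r s.
      poly (g a * h b) t * multi_pow s (\<lambda>j. a j + b j) y)"
    by (intro polyfun_sum polyfun_multi_pow)
  then show ?thesis
    by (rule polyfun_cong) (simp add: gh normal_form_def sum_product multi_pow_add mult_ac)
qed

lemma polyfun_prod:
  "(\<And>i. i \<in> I \<Longrightarrow> polyfun (\<phi> i)) \<Longrightarrow> polyfun (\<lambda>t y. \<Prod>i\<in>I. \<phi> i t y)"
  using polyfun_poly[of 1]
  by (induction I rule: infinite_finite_induct) (auto intro: polyfun_mult)

lemma polyfun_power: "polyfun \<phi> \<Longrightarrow> polyfun (\<lambda>t y. \<phi> t y ^ k)"
  using polyfun_prod[of "{..<k}" "\<lambda>_. \<phi>"] by simp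

lemma polyfun_translate:
  assumes "polyfun \<phi>" "e \<in> unit_group r s"
  shows "polyfun (\<lambda>t y. \<phi> t (\<lambda>j. e j * y j))"
proof -
  obtain g where g: "\<And>t y. above t y \<Longrightarrow> \<phi> t y = normal_form g t y"
    using assms unfolding polyfun_def by blast
  have "polyfun (\<lambda>t y. \<Sum>a\<in>exponents r s. poly (smult (multi_pow s a e) (g a)) t * multi_pow s a y)"
    by (intro polyfun_sum polyfun_multi_pow)
  moreover have "\<phi> t (\<lambda>j. e j * y j) =
      (\<Sum>a\<in>exponents r s. poly (smult (multi_pow s a e) (g a)) t * multi_pow s a y)"
    if "above t y" for t y
    unfolding g[OF above_unit_group[OF that assms(2)]] normal_form_def multi_pow_mult
    by (simp add: mult_ac)
  ultimately show ?thesis by (rule polyfun_cong)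
qed

text \<open>Summing over the group extracts the term with exponent vector 0, whose coefficient is a
  polynomial in \<open>t\<close>; for an invariant function the sum is \<open>r ^ s\<close> times
  the function, and \<open>r ^ s\<close> is invertible.\<close>

lemma invariant_polyfun:
  assumes "polyfun \<phi>"
    and inv: "\<And>t y e. above t y \<Longrightarrow> e \<in> unit_group r s \<Longrightarrow> \<phi> t (\<lambda>j. e j * y j) = \<phi> t y"
  shows "\<exists>d. \<forall>t y. above t y \<longrightarrow> \<phi> t y = poly d t"
proof -
  obtain g where g: "\<And>t y. above t y \<Longrightarrow> \<phi> t y = normal_form g t y"
    using assms unfolding polyfun_def by blast
  define o' where "o' = restrict (\<lambda>_. 0::nat) {1..s}"
  have o': "o' \<in> exponents r s" using r_pos by (auto simp: o'_def exponents_def)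
  have "\<phi> t y = poly (g o') t" if ab: "above t y" for t y
  proof -
    \<comment> \<open>For \<open>b = 0\<close> the extracting character has exponents
      \<open>r - 0 = r\<close> and is trivial.\<close>
    have "multi_pow s (\<lambda>j. r - o' j) e = 1" if "e \<in> unit_group r s" for e :: "nat \<Rightarrow> 'a"
      using that by (auto simp: multi_pow_def o'_def unit_group_def intro!: prod.neutral)
    then have "(\<Sum>e\<in>unit_group r s. \<phi> t (\<lambda>j. e j * y j)) = of_nat r ^ s * (poly (g o') t * multi_pow s o' y)"
      unfolding unit_group_extract[OF of_nat_r o', symmetric, of "\<lambda>a. poly (g a) t" y]
      by (intro sum.cong refl) (simp add: g above_unit_group[OF ab] normal_form_def)
    moreover have "multi_pow s o' y = 1" by (simp add: multi_pow_def o'_def)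
    moreover have "(\<Sum>e\<in>unit_group r s. \<phi> t (\<lambda>j. e j * y j)) = of_nat (card (unit_group r s :: (nat \<Rightarrow> 'a) set)) * \<phi> t y"
      using inv[OF ab] by simp
    moreover have "card (unit_group r s :: (nat \<Rightarrow> 'a) set) = r ^ s"
      by (simp add: unit_group_def card_PiE card_roots_of_unity[OF of_nat_r])
    ultimately show ?thesis using of_nat_r by simp
  qed
  then show ?thesis by blast
qed

text \<open>The norm is invariant, hence a polynomial in \<open>t\<close>. The factor of the neutral
  element is the function itself, so the function divides its norm with a cofactor in the
  ring.\<close>

lemma polyfun_norm:
  assumes "polyfun \<phi>"
  shows "\<exists>d \<psi>. polyfun \<psi> \<and> (\<forall>t y. above t y \<longrightarrow>
     poly d t = (\<Prod>e\<in>unit_group r s. \<phi> t (\<lambda>j. e j * y j)) \<and> poly d t = \<phi> t y * \<psi> t y)"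
proof -
  define N where "N t y = (\<Prod>e\<in>unit_group r s. \<phi> t (\<lambda>j. e j * y j))" for t y
  have "polyfun N" unfolding N_def
    by (intro polyfun_prod polyfun_translate assms)
  moreover have "N t (\<lambda>j. u j * y j) = N t y" if ab: "above t y" and u: "u \<in> unit_group r s" for t y u
  proof -
    have u': "u j ^ r = 1" if "j \<in> {1..s}" for j using u that by (auto simp: unit_group_def)
    have u0: "u j \<noteq> 0" if "j \<in> {1..s}" for j
      using u'[OF that] r_pos by (auto simp: zero_power)
    have mem: "restrict g {1..s} \<in> unit_group r s \<longleftrightarrow> (\<forall>j\<in>{1..s}. g j ^ r = 1)" for g :: "nat \<Rightarrow> 'a"
      by (auto simp: unit_group_def)
    have eqI: "restrict g {1..s} = e" if "e \<in> unit_group r s" "\<And>j. j \<in> {1..s} \<Longrightarrow> g j = e j" for g e :: "nat \<Rightarrow> 'a"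
    proof (rule extensionalityI[where A = "{1..s}"])
      show "e \<in> extensional {1..s}" using that(1) by (simp add: unit_group_def PiE_iff)
    qed (use that in auto)
    have one: "e j ^ r = 1" if "e \<in> unit_group r s" "j \<in> {1..s}" for e :: "nat \<Rightarrow> 'a" and j
      using that by (auto simp: unit_group_def)
    show ?thesis unfolding N_def
    \<comment> \<open>Translation by \<open>u\<close> permutes the factors; the restrictions keep
      products and quotients extensional.\<close>
    proof (rule prod.reindex_bij_witness[of _ "\<lambda>e. restrict (\<lambda>j. e j / u j) {1..s}"
          "\<lambda>e. restrict (\<lambda>j. e j * u j) {1..s}"], goal_cases)
      case (1 e)
      then show ?case by (rule eqI) (simp add: u0)
    next
      case (2 e)
      then show ?case unfolding mem using u' one[OF 2] by (auto simp: power_mult_distrib)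
    next
      case (3 e)
      then show ?case by (rule eqI) (simp add: u0)
    next
      case (4 e)
      then show ?case unfolding mem using u' one[OF 4] by (auto simp: power_divide)
    next
      case (5 e)
      show ?case
        using above_unit_group[OF above_unit_group[OF ab u] 5]
        by (intro polyfun_restrict[OF assms]) auto
    qed
  qed
  ultimately obtain d where d: "\<And>t y. above t y \<Longrightarrow> N t y = poly d t"
    using invariant_polyfun by blast
  define one where "one = restrict (\<lambda>_. 1::'a) {1..s}"
  have one: "one \<in> unit_group r s" by (auto simp: one_def unit_group_def)
  define \<psi> where "\<psi> t y = (\<Prod>e\<in>unit_group r s - {one}. \<phi> t (\<lambda>j. e j * y j))" for t y
  have "polyfun \<psi>" unfolding \<psi>_def
    by (intro polyfun_prod polyfun_translate assms) auto
  moreover have "N t y = \<phi> t y * \<psi> t y" if "above t y" for t y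
  proof -
    have "N t y = \<phi> t (\<lambda>j. one j * y j) * \<psi> t y"
      unfolding N_def \<psi>_def using one r_pos by (subst prod.remove[of _ one]) auto
    moreover have "\<phi> t (\<lambda>j. one j * y j) = \<phi> t y"
      using that by (intro polyfun_restrict[OF assms]) (auto simp: one_def)
    ultimately show ?thesis by simp
  qed
  ultimately show ?thesis
    using d unfolding N_def by (intro exI[of _ d] exI[of _ \<psi>]) simp
qed

text \<open>
  The denominators of \<open>f\<close> form an ideal without common zeros; by the norm its trace on the
  polynomials in \<open>t\<close> has no zeros either, so it contains \<open>1\<close>.
\<close>

lemma polyfun_if_locally_fraction:
  assumes loc: "\<And>t y. above t y \<Longrightarrow> \<exists>b a. polyfun b \<and> polyfun a \<and> b t y \<noteq> 0 \<and>
      (\<forall>t' y'. above t' y' \<longrightarrow> b t' y' * f t' y' = a t' y')"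
  shows "polyfun f"
proof -
  define den where "den b \<longleftrightarrow> polyfun b \<and> (\<exists>a. polyfun a \<and>
      (\<forall>t y. above t y \<longrightarrow> b t y * f t y = a t y))" for b
  have den_add: "den (\<lambda>t y. b t y + c * b' t y)" if "den b" "den b'" for b b' c
  proof -
    note dens = that
    obtain a where a: "polyfun a" "\<And>t y. above t y \<Longrightarrow> b t y * f t y = a t y"
      using dens(1) unfolding den_def by blast
    obtain a' where a': "polyfun a'" "\<And>t y. above t y \<Longrightarrow> b' t y * f t y = a' t y"
      using dens(2) unfolding den_def by blast
    have comb: "polyfun (\<lambda>t y. u t y + c * u' t y)" if "polyfun u" "polyfun u'" for u u'
      using polyfun_add[OF that(1) polyfun_mult[OF polyfun_poly[of "[:c:]"] that(2)]] by simp
    have bb': "polyfun b" "polyfun b'" using dens by (simp_all add: den_def)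
    have "(b t y + c * b' t y) * f t y = a t y + c * a' t y" if "above t y" for t y
      by (simp add: distrib_right mult.assoc a(2)[OF that] a'(2)[OF that])
    then show ?thesis
      unfolding den_def using comb[OF a(1) a'(1)] comb[OF bb']
      by (intro conjI exI[of _ "\<lambda>t y. a t y + c * a' t y"]) simp_all
  qed
  \<comment> \<open>The trace on the polynomials in \<open>t\<close> of the ideal of denominators of
    \<open>f\<close>.\<close>
  define J where "J = {d. \<exists>a. polyfun a \<and> (\<forall>t y. above t y \<longrightarrow> poly d t * f t y = a t y)}"
  have J_comb: "d - q * d' \<in> J" if "d \<in> J" "d' \<in> J" for d d' q
  proof -
    note mem = that
    obtain a where a: "polyfun a" "\<And>t y. above t y \<Longrightarrow> poly d t * f t y = a t y"
      using mem(1) unfolding J_def by blast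
    obtain a' where a': "polyfun a'" "\<And>t y. above t y \<Longrightarrow> poly d' t * f t y = a' t y"
      using mem(2) unfolding J_def by blast
    have "poly (d - q * d') t * f t y = a t y + poly (- q) t * a' t y" if "above t y" for t y
      by (simp add: left_diff_distrib mult.assoc a(2)[OF that] a'(2)[OF that])
    then show ?thesis
      unfolding J_def using polyfun_add[OF a(1) polyfun_mult[OF polyfun_poly[of "- q"] a'(1)]]
      by (intro CollectI exI[of _ "\<lambda>t y. a t y + poly (- q) t * a' t y"]) simp
  qed
  have J_nz: "\<exists>d\<in>J. poly d t \<noteq> 0" for t
  proof -
    obtain y where y: "above t y" using exists_above by blast
    \<comment> \<open>The norm of a denominator is nonzero at \<open>t\<close> only if the
      denominator is nonzero on the whole orbit over \<open>t\<close>. Such a denominator is built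
      orbit point by orbit point, adding to the old one a multiple of one that works at the new
      point.\<close>
    have "\<exists>b. den b \<and> (\<forall>e\<in>S. b t (\<lambda>j. e j * y j) \<noteq> 0)" if "finite S" "S \<subseteq> unit_group r s" for S
      using that
    proof (induction S rule: finite_induct)
      case empty
      have "den (\<lambda>t y. 0)" unfolding den_def
        using polyfun_0 by (intro conjI exI[of _ "\<lambda>t y. 0"]) simp_all
      then show ?case by (intro exI[of _ "\<lambda>t y. 0"]) simp
    next
      case (insert u S)
      then obtain b where b: "den b" "\<And>e. e \<in> S \<Longrightarrow> b t (\<lambda>j. e j * y j) \<noteq> 0" by auto
      show ?case
      proof (cases "b t (\<lambda>j. u j * y j) = 0")
        case False
        then show ?thesis using b by auto
      next
        case True
        have "above t (\<lambda>j. u j * y j)" using insert.prems y above_unit_group by auto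
        from loc[OF this] obtain b' where b': "den b'" "b' t (\<lambda>j. u j * y j) \<noteq> 0"
          unfolding den_def by auto
        \<comment> \<open>Excluding 0 makes the new point good; excluding the finitely many ratios
          keeps the old points good. The field is infinite, so some \<open>c\<close>
          remains.\<close>
        define bad where "bad = insert 0 ((\<lambda>e. - b t (\<lambda>j. e j * y j) / b' t (\<lambda>j. e j * y j)) ` S)"
        have "finite bad" using insert by (simp add: bad_def)
        then obtain c where c: "c \<notin> bad"
          using infinite_UNIV_alg_closed ex_new_if_finite by blast
        have "b t (\<lambda>j. e j * y j) + c * b' t (\<lambda>j. e j * y j) \<noteq> 0" if e: "e \<in> insert u S" for e
        proof
          assume 0: "b t (\<lambda>j. e j * y j) + c * b' t (\<lambda>j. e j * y j) = 0"
          show False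
          proof (cases "e = u")
            case True
            then show False using 0 b' \<open>b t (\<lambda>j. u j * y j) = 0\<close> c by (auto simp: bad_def)
          next
            case False
            then have "e \<in> S" using e by simp
            have "b' t (\<lambda>j. e j * y j) \<noteq> 0" using 0 b(2)[OF \<open>e \<in> S\<close>] by auto
            then have "c = - b t (\<lambda>j. e j * y j) / b' t (\<lambda>j. e j * y j)"
              using add.inverse_unique[OF 0] by simp
            then show False using c \<open>e \<in> S\<close> by (auto simp: bad_def)
          qed
        qed
        then show ?thesis using den_add[OF b(1) b'(1)] by (intro exI[of _ "\<lambda>t y. b t y + c * b' t y"]) auto
      qed
    qed
    from this[of "unit_group r s"] obtain b where
      b: "den b" "\<And>e. e \<in> unit_group r s \<Longrightarrow> b t (\<lambda>j. e j * y j) \<noteq> 0"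
      using r_pos by auto
    have "polyfun b" using b(1) by (simp add: den_def)
    from polyfun_norm[OF this] obtain d \<psi> where d: "polyfun \<psi>"
        "\<forall>t y. above t y \<longrightarrow> poly d t = (\<Prod>e\<in>unit_group r s. b t (\<lambda>j. e j * y j)) \<and>
           poly d t = b t y * \<psi> t y"
      by (elim exE conjE)
    obtain a where a: "polyfun a" "\<And>t y. above t y \<Longrightarrow> b t y * f t y = a t y"
      using b(1) unfolding den_def by blast
    have "poly d t * f t y = \<psi> t y * a t y" if "above t y" for t y
    proof -
      have "poly d t = b t y * \<psi> t y" using that d(2) by blast
      then show ?thesis by (simp only: a(2)[OF that, symmetric] mult_ac)
    qed
    then have "d \<in> J" unfolding J_def using polyfun_mult[OF d(1) a(1)]
      by (intro CollectI exI[of _ "\<lambda>t y. \<psi> t y * a t y"]) simp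
    moreover have "poly d t \<noteq> 0" using d(2) y b(2) r_pos by simp
    ultimately show ?thesis by blast
  qed
  \<comment> \<open>A nonzero element of least degree divides all of \<open>J\<close> by division
    with remainder, so a root of it would be a common zero of \<open>J\<close>, contrary to
    \<open>J_nz\<close>.\<close>
  obtain d where d: "d \<in> J" "d \<noteq> 0" and min: "\<And>d'. d' \<in> J \<Longrightarrow> d' \<noteq> 0 \<Longrightarrow> degree d \<le> degree d'"
  proof -
    obtain d0 where "d0 \<in> J" "poly d0 0 \<noteq> 0" using J_nz[of 0] by blast
    then have "d0 \<in> J - {0}" by auto
    from ex_has_least_nat[of "\<lambda>d. d \<in> J - {0}", OF this, of degree] show ?thesis
      using that by blast
  qed
  have "degree d = 0"
  proof (rule ccontr)
    assume "degree d \<noteq> 0"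
    then obtain t where t: "poly d t = 0" using alg_closed_imp_poly_has_root by blast
    obtain d' where d': "d' \<in> J" "poly d' t \<noteq> 0" using J_nz by blast
    have "d' mod d = d' - (d' div d) * d" by (simp add: minus_div_mult_eq_mod)
    then have "d' mod d \<in> J" using J_comb[OF d'(1) d(1)] by simp
    moreover have "d' mod d \<noteq> 0"
    proof
      assume "d' mod d = 0"
      then have "poly d' t = poly (d' div d * d) t" by (simp add: minus_mod_eq_div_mult[symmetric])
      then show False using d'(2) t by simp
    qed
    ultimately show False using min[of "d' mod d"] degree_mod_less'[OF d(2), of d'] by linarith
  qed
  then obtain k where k: "d = [:k:]" "k \<noteq> 0" using d(2) by (metis degree_eq_zeroE pCons_0_0)
  obtain a where a: "polyfun a" "\<And>t y. above t y \<Longrightarrow> poly d t * f t y = a t y"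
    using d(1) unfolding J_def by blast
  show ?thesis
    using polyfun_mult[OF polyfun_poly[of "[:inverse k:]"] a(1)]
    by (rule polyfun_cong) (use k a(2) in \<open>simp add: field_simps\<close>)
qed

end

subsection \<open>Regular forms on projective varieties\<close>

text \<open>By the quotient rule the summand \<open>f dg\<close> has denominator
  \<open>f2 * g2 ^ 2\<close>; the product over the list clears all of them, and \<open>A i\<close>
  collects the coefficient of \<open>v i\<close>.\<close>

lemma frac_sum_clear_denominators:
  assumes "\<forall>(f, g)\<in>set fgs. regular_frac n U f \<and> regular_frac n U g"
  shows "\<exists>B A. (\<forall>q\<in>U. poly_eval B q \<noteq> 0) \<and>
    (\<forall>q\<in>U. \<forall>v. poly_eval B q * (\<Sum>(f, g)\<leftarrow>fgs. frac_value f q * frac_differential n g q v) =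
       (\<Sum>i\<le>n. poly_eval (A i) q * v i))"
  using assms
proof (induction fgs)
  case Nil
  show ?case by (intro exI[of _ 1] exI[of _ "\<lambda>_. 0"]) simp
next
  case (Cons fg fgs)
  obtain f1 f2 g1 g2 where fg: "fg = ((f1, f2), (g1, g2))" by (metis surj_pair)
  have nz: "poly_eval f2 q \<noteq> 0" "poly_eval g2 q \<noteq> 0" if "q \<in> U" for q
    using Cons.prems that by (auto simp: fg regular_frac_def)
  have prems: "\<forall>(f, g)\<in>set fgs. regular_frac n U f \<and> regular_frac n U g"
    using Cons.prems by simp
  obtain B A where BA: "\<And>q. q \<in> U \<Longrightarrow> poly_eval B q \<noteq> 0"
    "\<And>q v. q \<in> U \<Longrightarrow> poly_eval B q * (\<Sum>(f, g)\<leftarrow>fgs. frac_value f q * frac_differential n g q v) =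
       (\<Sum>i\<le>n. poly_eval (A i) q * v i)"
    using Cons.IH[OF prems] by blast
  define B' where "B' = f2 * g2 ^ 2 * B"
  define A' where "A' i = f2 * g2 ^ 2 * A i + B * f1 * (partial i g1 * g2 - g1 * partial i g2)" for i
  have "poly_eval B' q * (\<Sum>(f, g)\<leftarrow>fg # fgs. frac_value f q * frac_differential n g q v) =
       (\<Sum>i\<le>n. poly_eval (A' i) q * v i)" if q: "q \<in> U" for q v
  proof -
    let ?b = "poly_eval B q" and ?f1 = "poly_eval f1 q" and ?f2 = "poly_eval f2 q"
      and ?g1 = "poly_eval g1 q" and ?g2 = "poly_eval g2 q"
    let ?S = "\<Sum>(f, g)\<leftarrow>fgs. frac_value f q * frac_differential n g q v"
    have "poly_eval B' q * (\<Sum>(f, g)\<leftarrow>fg # fgs. frac_value f q * frac_differential n g q v) =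
       ?f2 * ?g2 ^ 2 * (?b * ?S) +
       ?b * ?f1 * (differential n g1 q v * ?g2 - ?g1 * differential n g2 q v)"
      using nz[OF q]
      by (simp add: B'_def fg frac_value_def frac_differential_def field_simps)
    also have "\<dots> = (\<Sum>i\<le>n. poly_eval (A' i) q * v i)"
      unfolding BA(2)[OF q] differential_def A'_def
      by (simp add: sum_distrib_left sum_distrib_right sum.distrib sum_subtractf algebra_simps)
    finally show ?thesis .
  qed
  moreover have "poly_eval B' q \<noteq> 0" if "q \<in> U" for q
    using nz[OF that] BA(1)[OF that] by (simp add: B'_def)
  ultimately show ?case by blast
qed

lemma regular_form_local:
  assumes "\<omega> \<in> regular_forms n Fs" "p \<in> proj_zeros n Fs"
  shows "\<exists>U fgs. zariski_open n Fs U \<and> p \<in> U \<and>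
        (\<forall>(f, g)\<in>set fgs. regular_frac n U f \<and> regular_frac n U g) \<and>
        (\<forall>q\<in>U. \<forall>v\<in>tangent n Fs q.
           \<omega> q v = (\<Sum>(f, g)\<leftarrow>fgs. frac_value f q * frac_differential n g q v))"
  using assms unfolding regular_forms_def by blast

lemma regular_frac_cases:
  assumes "regular_frac n U g"
  obtains A B d where "g = (A, B)" "A \<in> homogeneous n d" "B \<in> homogeneous n d"
  using assms unfolding regular_frac_def by (cases g) blast

text \<open>Multiplying further by a polynomial \<open>G\<close> that is nonzero at \<open>p\<close>
  and vanishes outside the neighbourhood makes the local identity hold on the whole variety, with
  both sides 0 where \<open>G\<close> vanishes.\<close>

lemma regular_form_clear_denominators:
  assumes "\<omega> \<in> regular_forms n Fs" "p \<in> proj_zeros n Fs"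
  shows "\<exists>B A. poly_eval B p \<noteq> 0 \<and> (\<forall>q\<in>proj_zeros n Fs. \<forall>v\<in>tangent n Fs q.
    poly_eval B q * \<omega> q v = (\<Sum>i\<le>n. poly_eval (A i) q * v i))"
proof -
  obtain U fgs where U: "zariski_open n Fs U" "p \<in> U"
    "\<forall>(f, g)\<in>set fgs. regular_frac n U f \<and> regular_frac n U g"
    "\<And>q v. q \<in> U \<Longrightarrow> v \<in> tangent n Fs q \<Longrightarrow>
      \<omega> q v = (\<Sum>(f, g)\<leftarrow>fgs. frac_value f q * frac_differential n g q v)"
    using regular_form_local[OF assms(1,2)] by blast
  obtain G where G: "poly_eval G p \<noteq> 0" "\<And>q. q \<in> proj_zeros n Fs \<Longrightarrow> poly_eval G q \<noteq> 0 \<Longrightarrow> q \<in> U"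
    using U(1,2) unfolding zariski_open_def by auto
  obtain B A where BA: "\<And>q. q \<in> U \<Longrightarrow> poly_eval B q \<noteq> 0"
    "\<And>q v. q \<in> U \<Longrightarrow> poly_eval B q * (\<Sum>(f, g)\<leftarrow>fgs. frac_value f q * frac_differential n g q v) =
       (\<Sum>i\<le>n. poly_eval (A i) q * v i)"
    using frac_sum_clear_denominators[OF U(3)] by blast
  have "poly_eval (G * B) q * \<omega> q v = (\<Sum>i\<le>n. poly_eval (G * A i) q * v i)"
    if "q \<in> proj_zeros n Fs" "v \<in> tangent n Fs q" for q v
  proof (cases "poly_eval G q = 0")
    case False
    then have q: "q \<in> U" using G(2) that by blast
    have "poly_eval (G * B) q * \<omega> q v = poly_eval G q * (poly_eval B q * \<omega> q v)"
      by simp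
    also have "\<dots> = (\<Sum>i\<le>n. poly_eval (G * A i) q * v i)"
      unfolding U(4)[OF q that(2)] BA(2)[OF q] by (simp add: sum_distrib_left mult_ac)
    finally show ?thesis .
  qed simp
  moreover have "poly_eval (G * B) p \<noteq> 0" using G(1) BA(1)[OF U(2)] by simp
  ultimately show ?thesis
    by (intro exI[of _ "G * B"] exI[of _ "\<lambda>i. G * A i"]) blast
qed

lemma tangent_lincomb:
  assumes "v \<in> tangent n Fs p" "u \<in> tangent n Fs p"
  shows "(\<lambda>i. a * v i + b * u i) \<in> tangent n Fs p"
  using assms
  by (auto simp: tangent_def coord_space_def differential_add_right[of n _ p "\<lambda>i. a * v i"]
      differential_scale_right)

text \<open>Linearity is not part of the definition of a form; it is read off from a local
  expression.\<close>

lemma regular_form_lincomb: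
  fixes Fs :: "'a::field mpoly list"
  assumes "\<omega> \<in> regular_forms n Fs" "p \<in> proj_zeros n Fs" "v \<in> tangent n Fs p" "u \<in> tangent n Fs p"
  shows "\<omega> p (\<lambda>i. a * v i + b * u i) = a * \<omega> p v + b * \<omega> p u"
proof -
  obtain B A where B: "poly_eval B p \<noteq> 0" and
    A: "\<And>v. v \<in> tangent n Fs p \<Longrightarrow> poly_eval B p * \<omega> p v = (\<Sum>i\<le>n. poly_eval (A i) p * v i)"
    using regular_form_clear_denominators[OF assms(1,2)] assms(2) by blast
  have "poly_eval B p * \<omega> p (\<lambda>i. a * v i + b * u i) = poly_eval B p * (a * \<omega> p v + b * \<omega> p u)"
    unfolding distrib_left mult.left_commute[of _ a] mult.left_commute[of _ b]
      A[OF assms(3)] A[OF assms(4)] A[OF tangent_lincomb[OF assms(3,4)]]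
    by (simp add: sum.distrib sum_distrib_left algebra_simps)
  then show ?thesis using B by simp
qed

context
  fixes n :: nat and Fs :: "'a::field mpoly list"
  assumes hom: "set Fs \<subseteq> (\<Union>d. homogeneous n d)"
begin

lemma proj_zeros_scale:
  assumes "p \<in> proj_zeros n Fs" "c \<noteq> 0"
  shows "(\<lambda>i. c * p i) \<in> proj_zeros n Fs"
proof -
  have "poly_eval F (\<lambda>i. c * p i) = 0" if F: "F \<in> set Fs" for F
  proof -
    obtain d where "F \<in> homogeneous n d" using hom F by blast
    then show ?thesis using poly_eval_scale[of F n d c p] assms F by (simp add: proj_zeros_def)
  qed
  moreover have "(\<lambda>i. c * p i) \<noteq> (\<lambda>_. 0)"
    using assms by (auto simp: proj_zeros_def fun_eq_iff)
  ultimately show ?thesis using assms by (auto simp: proj_zeros_def coord_space_def)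
qed

lemma tangent_scale:
  assumes "v \<in> tangent n Fs p"
  shows "(\<lambda>i. c * v i) \<in> tangent n Fs (\<lambda>i. c * p i)"
proof -
  have "differential n F (\<lambda>i. c * p i) (\<lambda>i. c * v i) = 0" if F: "F \<in> set Fs" for F
  proof -
    obtain d where "F \<in> homogeneous n d" using hom F by blast
    then show ?thesis using differential_scale[of F n d c p v] assms F by (simp add: tangent_def)
  qed
  then show ?thesis using assms by (auto simp: tangent_def coord_space_def)
qed

lemma tangent_self:
  assumes "p \<in> proj_zeros n Fs" shows "p \<in> tangent n Fs p"
proof -
  have "differential n F p p = 0" if F: "F \<in> set Fs" for F
  proof -
    obtain d where "F \<in> homogeneous n d" using hom F by blast
    then show ?thesis using euler_homogeneous[of F n d p] assms F by (simp add: proj_zeros_def)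
  qed
  then show ?thesis using assms by (auto simp: tangent_def proj_zeros_def)
qed

text \<open>By Euler's formula the derivative of a quotient of equal degrees vanishes in the
  direction of \<open>p\<close>, so a form lives on the tangent space modulo the line of
  \<open>p\<close>.\<close>

lemma regular_form_self:
  assumes "\<omega> \<in> regular_forms n Fs" "p \<in> proj_zeros n Fs"
  shows "\<omega> p p = 0"
proof -
  obtain U fgs where U: "p \<in> U"
    "\<forall>(f, g)\<in>set fgs. regular_frac n U f \<and> regular_frac n U g"
    "\<And>q v. q \<in> U \<Longrightarrow> v \<in> tangent n Fs q \<Longrightarrow>
      \<omega> q v = (\<Sum>(f, g)\<leftarrow>fgs. frac_value f q * frac_differential n g q v)"
    using regular_form_local[OF assms(1,2)] by blast
  have "frac_differential n g p p = 0" if reg: "regular_frac n U g" for g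
  proof -
    obtain A B d where g: "g = (A, B)" "A \<in> homogeneous n d" "B \<in> homogeneous n d"
      by (rule regular_frac_cases[OF reg])
    show ?thesis
      by (simp add: g(1) frac_differential_def euler_homogeneous[OF g(2)] euler_homogeneous[OF g(3)])
  qed
  then have "(\<Sum>(f, g)\<leftarrow>fgs. frac_value f p * frac_differential n g p p) = (\<Sum>(f, g)\<leftarrow>fgs. 0)"
    using U(2) by (intro arg_cong[where f = sum_list] map_cong) auto
  also have "\<dots> = 0" by (induction fgs) auto
  finally show ?thesis using U(1,3) tangent_self[OF assms(2)] by simp
qed

lemma regular_form_scale:
  assumes "\<omega> \<in> regular_forms n Fs" "p \<in> proj_zeros n Fs" "v \<in> tangent n Fs p" "c \<noteq> 0"
  shows "\<omega> (\<lambda>i. c * p i) (\<lambda>i. c * v i) = \<omega> p v"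
proof -
  obtain U fgs where U: "zariski_open n Fs U" "p \<in> U"
    "\<forall>(f, g)\<in>set fgs. regular_frac n U f \<and> regular_frac n U g"
    "\<And>q v. q \<in> U \<Longrightarrow> v \<in> tangent n Fs q \<Longrightarrow>
      \<omega> q v = (\<Sum>(f, g)\<leftarrow>fgs. frac_value f q * frac_differential n g q v)"
    using regular_form_local[OF assms(1,2)] by blast
  have cU: "(\<lambda>i. c * p i) \<in> U"
  proof -
    obtain Gs where Gs: "Gs \<subseteq> (\<Union>d. homogeneous n d)"
      "U = {p \<in> proj_zeros n Fs. \<exists>G\<in>Gs. poly_eval G p \<noteq> 0}"
      using U(1) by (auto simp: zariski_open_def)
    obtain G where "G \<in> Gs" "poly_eval G p \<noteq> 0" using Gs(2) U(2) by blast
    moreover then obtain d where "G \<in> homogeneous n d" using Gs(1) by blast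
    ultimately have "poly_eval G (\<lambda>i. c * p i) \<noteq> 0"
      using assms(4) poly_eval_scale[of G n d c p] by simp
    then show ?thesis using Gs(2) proj_zeros_scale[OF assms(2,4)] \<open>G \<in> Gs\<close> by auto
  qed
  have "frac_differential n g (\<lambda>i. c * p i) (\<lambda>i. c * v i) = frac_differential n g p v"
    "frac_value g (\<lambda>i. c * p i) = frac_value g p" if reg: "regular_frac n U g" for g
  proof -
    obtain A B d where g: "g = (A, B)" "A \<in> homogeneous n d" "B \<in> homogeneous n d"
      by (rule regular_frac_cases[OF reg])
    note scale = poly_eval_scale[OF g(2), of c p] poly_eval_scale[OF g(3), of c p]
      differential_scale[OF g(2), of c p v] differential_scale[OF g(3), of c p v]
    show "frac_value g (\<lambda>i. c * p i) = frac_value g p"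
      using assms(4) by (simp add: g(1) frac_value_def scale)
    let ?D = "differential n A p v * poly_eval B p - poly_eval A p * differential n B p v"
    have "frac_differential n g (\<lambda>i. c * p i) (\<lambda>i. c * v i) =
        ((c ^ d)\<^sup>2 * ?D) / ((c ^ d)\<^sup>2 * (poly_eval B p)\<^sup>2)"
      by (simp add: g(1) frac_differential_def scale power2_eq_square algebra_simps)
    then show "frac_differential n g (\<lambda>i. c * p i) (\<lambda>i. c * v i) = frac_differential n g p v"
      using assms(4) by (simp add: g frac_differential_def)
  qed
  then have "(\<Sum>(f, g)\<leftarrow>fgs. frac_value f (\<lambda>i. c * p i) * frac_differential n g (\<lambda>i. c * p i) (\<lambda>i. c * v i))
     = (\<Sum>(f, g)\<leftarrow>fgs. frac_value f p * frac_differential n g p v)"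
    using U(3) by (intro arg_cong[where f = sum_list] map_cong) auto
  then show ?thesis
    by (simp add: U(4)[OF cU tangent_scale[OF assms(3)]] U(4)[OF U(2) assms(3)])
qed

end

subsection \<open>The equations of the curve\<close>

text \<open>The conditions on \<open>r\<close> and \<open>c0\<close> are stated in the field of
  points, where they are used as invertibility.\<close>

locale smooth_superelliptic =
  fixes \<iota> :: "'k::field \<Rightarrow> 'a::alg_closed_field"
    and r s :: nat and c0 c1 c2 :: 'k and c :: "nat \<Rightarrow> nat \<Rightarrow> 'k"
  assumes r2: "r \<ge> 2" and s1: "s \<ge> 1"
    and of_nat_r: "of_nat r \<noteq> (0 :: 'a)"
    and c0: "\<iota> c0 \<noteq> 0"
    and smooth: "smooth_curve (s + 2) (curve_eqs \<iota> r s c0 c1 c2 c)"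
begin

abbreviation "n \<equiv> s + 2"
abbreviation "eqs \<equiv> curve_eqs \<iota> r s c0 c1 c2 c"
abbreviation "Q \<equiv> conic_eq \<iota> s c0 c1 c2"
abbreviation "h \<equiv> h_poly \<iota> r s c"
abbreviation "hz j p \<equiv> poly_eval (partial (s + 2) (h j)) p"
abbreviation "hw j p \<equiv> poly_eval (partial (s + 1) (h j)) p"

text \<open>The derivative of the conic equation with respect to \<open>x\<close>, with opposite
  sign.\<close>

definition qx :: "(nat \<Rightarrow> 'a) \<Rightarrow> 'a" where
  "qx p = 2 * \<iota> c0 * p 0 + \<iota> c1 * p (s + 1)"

text \<open>Up to the factor \<open>r ^ s\<close>, the determinant of the diagonal block of the
  Jacobian matrix belonging to the variables \<open>y_j\<close>; \<open>E j\<close> is the same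
  product without the index \<open>j\<close>.\<close>

definition D :: "(nat \<Rightarrow> 'a) \<Rightarrow> 'a" where
  "D p = (\<Prod>j\<in>{1..s}. p j ^ (r - 1))"

definition E :: "nat \<Rightarrow> (nat \<Rightarrow> 'a) \<Rightarrow> 'a" where
  "E j p = (\<Prod>i\<in>{1..s} - {j}. p i ^ (r - 1))"

definition K :: "nat \<Rightarrow> (nat \<Rightarrow> 'a) \<Rightarrow> 'a" where
  "K j p = hz j p * qx p"

text \<open>The linear form for which the conic reads \<open>w * ell = c_0 x\<^sup>2\<close>, see
  \<open>Q_iff\<close>.\<close>

definition ell :: "(nat \<Rightarrow> 'a) \<Rightarrow> 'a" where
  "ell p = p (s + 2) - \<iota> c1 * p 0 - \<iota> c2 * p (s + 1)"

lemma set_eqs: "set eqs = insert Q ((\<lambda>j. Var j ^ r - h j) ` {1..s})"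
  by (auto simp: curve_eqs_def)

lemma homogeneous_Q: "Q \<in> homogeneous n 2"
proof -
  have v: "Var 0 \<in> homogeneous n 1" "Var (s + 1) \<in> homogeneous n 1" "Var (s + 2) \<in> homogeneous n 1"
    by (rule homogeneous_Var, simp)+
  have "Var (s + 2) * Var (s + 1) \<in> homogeneous n (1 + 1)"
    by (intro homogeneous_mult v)
  moreover have "Const (\<iota> c0) * (Var 0)\<^sup>2 \<in> homogeneous n (0 + 2 * 1)"
    by (intro homogeneous_mult homogeneous_power homogeneous_Const v)
  moreover have "Const (\<iota> c1) * Var 0 * Var (s + 1) \<in> homogeneous n (0 + 1 + 1)"
    by (intro homogeneous_mult homogeneous_Const v)
  moreover have "Const (\<iota> c2) * (Var (s + 1))\<^sup>2 \<in> homogeneous n (0 + 2 * 1)"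
    by (intro homogeneous_mult homogeneous_power homogeneous_Const v)
  ultimately show ?thesis
    unfolding conic_eq_def Let_def by (intro homogeneous_diff homogeneous_add) (simp_all add: numeral_2_eq_2)
qed

lemma homogeneous_h: "h j \<in> homogeneous n r"
proof -
  have v: "Var (s + 1) \<in> homogeneous n 1" "Var (s + 2) \<in> homogeneous n 1"
    by (rule homogeneous_Var, simp)+
  have "Var (s + 2) ^ r \<in> homogeneous n (r * 1)" "Var (s + 1) ^ r \<in> homogeneous n (r * 1)"
    by (intro homogeneous_power v)+
  moreover have "Const (\<iota> (c i j)) * Var (s + 2) ^ (r - i) * Var (s + 1) ^ i \<in> homogeneous n r"
    if "i \<in> {1..r-1}" for i
  proof -
    have "Const (\<iota> (c i j)) * Var (s + 2) ^ (r - i) * Var (s + 1) ^ i \<in> homogeneous n (0 + (r - i) * 1 + i * 1)"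
      by (intro homogeneous_mult homogeneous_power homogeneous_Const v)
    moreover have "0 + (r - i) * 1 + i * 1 = r" using that by auto
    ultimately show ?thesis by (simp only:)
  qed
  ultimately show ?thesis
    unfolding h_poly_def Let_def by (intro homogeneous_add homogeneous_sum) simp_all
qed

lemma homogeneous_eqs: "set eqs \<subseteq> (\<Union>d. homogeneous n d)"
proof -
  have "Var j ^ r - h j \<in> homogeneous n r" if "j \<in> {1..s}" for j
  proof -
    have "Var j ^ r \<in> homogeneous n (r * 1)"
      using that by (intro homogeneous_power homogeneous_Var) simp
    then show ?thesis by (intro homogeneous_diff homogeneous_h) simp
  qed
  then show ?thesis unfolding set_eqs using homogeneous_Q by blast
qed

lemma differential_Q [unfolded add_2_eq_Suc' Suc_eq_plus1[symmetric]]: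
  "differential n Q p v =
     p (s + 1) * v (s + 2) + p (s + 2) * v (s + 1) - qx p * v 0 -
     (\<iota> c1 * p 0 + 2 * \<iota> c2 * p (s + 1)) * v (s + 1)"
  by (simp add: conic_eq_def Let_def qx_def algebra_simps)

lemma partial_h_eq_0:
  assumes "i \<le> s" shows "poly_eval (partial i (h j)) p = 0"
  using assms by (subst poly_eval_partial_unit[where n = n]) (auto simp: h_poly_def Let_def)

lemma differential_h [unfolded add_2_eq_Suc' Suc_eq_plus1[symmetric]]: "differential n (h j) p v = hz j p * v (s + 2) + hw j p * v (s + 1)"
proof -
  have "{..n} = {..s} \<union> {s + 1, s + 2}" by auto
  then show ?thesis
    unfolding differential_def by (simp add: sum.union_disjoint partial_h_eq_0)
qed

lemma h_euler: "hz j p * p (s + 2) + hw j p * p (s + 1) = of_nat r * poly_eval (h j) p"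
  using euler_homogeneous[OF homogeneous_h, of j p] by (simp add: differential_h)

lemma h_at_infinity [unfolded add_2_eq_Suc' Suc_eq_plus1[symmetric]]:
  "p (s + 1) = 0 \<Longrightarrow> poly_eval (h j) p = p (s + 2) ^ r"
  using r2 by (simp add: h_poly_def Let_def zero_power)

lemma proj_zeros_iff [unfolded add_2_eq_Suc' Suc_eq_plus1[symmetric]]:
  "p \<in> proj_zeros n eqs \<longleftrightarrow> p \<in> coord_space n \<and> p \<noteq> (\<lambda>_. 0) \<and> poly_eval Q p = 0 \<and>
     (\<forall>j\<in>{1..s}. p j ^ r = poly_eval (h j) p)"
  by (auto simp: proj_zeros_def set_eqs)

lemma Q_iff [unfolded add_2_eq_Suc' Suc_eq_plus1[symmetric]]: "poly_eval Q p = 0 \<longleftrightarrow> p (s + 1) * ell p = \<iota> c0 * (p 0)\<^sup>2"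
  by (auto simp: conic_eq_def Let_def ell_def power2_eq_square algebra_simps)

lemma tangent_iff [unfolded add_2_eq_Suc' Suc_eq_plus1[symmetric]]:
  "v \<in> tangent n eqs p \<longleftrightarrow> v \<in> coord_space n \<and>
     p (s + 1) * v (s + 2) + p (s + 2) * v (s + 1) =
       qx p * v 0 + (\<iota> c1 * p 0 + 2 * \<iota> c2 * p (s + 1)) * v (s + 1) \<and>
     (\<forall>j\<in>{1..s}. of_nat r * p j ^ (r - 1) * v j = hz j p * v (s + 2) + hw j p * v (s + 1))"
  by (auto simp: tangent_def set_eqs differential_Q differential_h algebra_simps)

subsection \<open>Consequences of smoothness\<close>

text \<open>The shape in which smoothness is applied: the \<open>s + 1\<close> gradients have rank
  \<open>s + 1\<close> at a point of the curve, so \<open>s\<close> vectors cannot span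
  them.\<close>

lemma gradients_not_in_small_span:
  assumes p: "p \<in> proj_zeros n eqs" and S: "finite S" "card S \<le> s"
    and Q: "gradient n Q p \<in> vec.span S"
    and F: "\<And>j. j \<in> {1..s} \<Longrightarrow> gradient n (Var j ^ r - h j) p \<in> vec.span S"
  shows False
proof -
  have "vec.dim {gradient n F p | F. F \<in> set eqs} = length eqs"
    using smooth p unfolding smooth_curve_def jacobian_rank_def by blast
  moreover have "{gradient n F p | F. F \<in> set eqs} \<subseteq> vec.span S"
    using Q F by (auto simp: set_eqs)
  then have "vec.dim {gradient n F p | F. F \<in> set eqs} \<le> card S"
    using S(1) by (rule vec.dim_le_card)
  moreover have "length eqs = s + 1" by (simp add: curve_eqs_def del: upt_Suc)
  ultimately show False using S(2) by linarith
qed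

text \<open>
  Where \<open>y_j\<close> vanishes, the gradient of \<open>y_j^r - h_j\<close> lies in the line spanned by this
  vector, because by Euler's formula it is orthogonal to \<open>(w, z)\<close>.
\<close>

definition normal_dir :: "(nat \<Rightarrow> 'a) \<Rightarrow> nat \<Rightarrow> 'a" where
  "normal_dir p = (\<lambda>i. if i = s + 1 then - p (s + 2) else if i = s + 2 then p (s + 1) else 0)"

lemma gradient_y_eq:
  assumes p: "p \<in> proj_zeros n eqs" and w: "p (s + 1) \<noteq> 0" and j: "j \<in> {1..s}" "p j = 0"
  shows "gradient n (Var j ^ r - h j) p = vec_scale (- hz j p / p (s + 1)) (normal_dir p)"
proof
  fix i
  have "p j ^ r = poly_eval (h j) p" using p j(1) by (simp add: proj_zeros_iff)
  then have "poly_eval (h j) p = 0" using j(2) r2 by (simp add: zero_power)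
  then have hw: "hw j p = - hz j p * p (s + 2) / p (s + 1)"
    using h_euler[of j p] w by (simp add: field_simps eq_neg_iff_add_eq_0)
  have "gradient n (Var j ^ r - h j) p i =
      (if i \<le> n then - differential n (h j) p (\<lambda>k. if k = i then 1 else 0) else 0)"
    using j r2 by (auto simp: gradient_def poly_eval_partial_unit)
  also have "\<dots> = (if i = s + 2 then - hz j p else if i = s + 1 then - hw j p else 0)"
    by (auto simp: differential_h)
  also have "\<dots> = vec_scale (- hz j p / p (s + 1)) (normal_dir p) i"
    using w hw by (auto simp: vec_scale_def normal_dir_def)
  finally show "gradient n (Var j ^ r - h j) p i = vec_scale (- hz j p / p (s + 1)) (normal_dir p) i" .
qed

text \<open>If the \<open>x\<close>-derivative of the conic vanishes, Euler's formula makes its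
  gradient orthogonal to \<open>(w, z)\<close>, just as for a vanishing \<open>y_j\<close>.\<close>

lemma gradient_Q_eq:
  assumes p: "p \<in> proj_zeros n eqs" and w: "p (s + 1) \<noteq> 0" and qx: "qx p = 0"
  shows "gradient n Q p = normal_dir p"
proof
  fix i
  have "differential n Q p p = 0"
    using euler_homogeneous[OF homogeneous_Q, of p] p by (simp add: proj_zeros_iff)
  then have "p (s + 1) * (p (s + 2) + (p (s + 2) - (\<iota> c1 * p 0 + 2 * \<iota> c2 * p (s + 1)))) = 0"
    using qx by (simp add: differential_Q algebra_simps)
  then have *: "p (s + 2) - (\<iota> c1 * p 0 + 2 * \<iota> c2 * p (s + 1)) = - p (s + 2)"
    using w by (simp add: eq_neg_iff_add_eq_0 add.commute)
  have "gradient n Q p i = (if i \<le> n then differential n Q p (\<lambda>k. if k = i then 1 else 0) else 0)"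
    by (simp add: gradient_def poly_eval_partial_unit)
  also have "\<dots> = normal_dir p i"
    using qx * by (auto simp: differential_Q normal_dir_def)
  finally show "gradient n Q p i = normal_dir p i" .
qed

text \<open>Each failure makes the gradients dependent: two vanishing coordinates
  \<open>y_j\<close>, \<open>y_k\<close>, or \<open>y_j\<close> and \<open>qx\<close>, put two
  gradients on the line of \<open>normal_dir\<close>, and a vanishing \<open>hz j p\<close> makes
  one gradient zero.\<close>

lemma
  assumes p: "p \<in> proj_zeros n eqs" and w: "p (s + 1) \<noteq> 0" and j: "j \<in> {1..s}" "p j = 0"
  shows y_zeros_disjoint: "\<And>k. k \<in> {1..s} \<Longrightarrow> k \<noteq> j \<Longrightarrow> p k \<noteq> 0"
    and K_nonzero: "K j p \<noteq> 0"
proof -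
  let ?g = "\<lambda>j. gradient n (Var j ^ r - h j) p"
  show "p k \<noteq> 0" if k: "k \<in> {1..s}" "k \<noteq> j" for k
  proof
    assume "p k = 0"
    \<comment> \<open>The gradients with indices \<open>j\<close> and \<open>k\<close> are replaced
      by one vector, leaving \<open>(s - 2) + 2 = s\<close> generators.\<close>
    let ?S = "insert (gradient n Q p) (insert (normal_dir p) (?g ` ({1..s} - {j, k})))"
    have "card ({1..s} - {j, k}) = s - 2" using j k by (subst card_Diff_subset) auto
    moreover have "s \<ge> 2" using j k by auto
    ultimately have "card ?S \<le> s"
      using card_image_le[of "{1..s} - {j, k}" ?g] by (auto simp: card_insert_if)
    moreover have "?g i \<in> vec.span ?S" if i: "i \<in> {1..s}" for i
    proof (cases "i = j \<or> i = k")
      case True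
      then have "p i = 0" using j k \<open>p k = 0\<close> by auto
      show ?thesis unfolding gradient_y_eq[OF p w i \<open>p i = 0\<close>]
        by (intro vec.span_scale vec.span_base) simp
    next
      case False
      then show ?thesis using i by (intro vec.span_base) simp
    qed
    ultimately show False
      by (intro gradients_not_in_small_span[OF p, of ?S]) (auto intro: vec.span_base)
  qed
  have card: "card (insert v (?g ` ({1..s} - {j}))) \<le> s" for v
  proof -
    have "card ({1..s} - {j}) = s - 1" using j by simp
    then show ?thesis
      using card_image_le[of "{1..s} - {j}" ?g] s1 by (auto simp: card_insert_if)
  qed
  have "hz j p \<noteq> 0"
  proof
    assume "hz j p = 0"
    then have 0: "?g j = vec_scale 0 (gradient n Q p)"
      using gradient_y_eq[OF p w j] by (simp add: vec_scale_def)
    let ?S = "insert (gradient n Q p) (?g ` ({1..s} - {j}))"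
    have "?g i \<in> vec.span ?S" if "i \<in> {1..s}" for i
      using 0 that by (cases "i = j") (auto intro: vec.span_base vec.span_zero)
    then show False
      using card by (intro gradients_not_in_small_span[OF p, of ?S]) (auto intro: vec.span_base)
  qed
  moreover have "qx p \<noteq> 0"
  proof
    assume "qx p = 0"
    then have Q: "gradient n Q p = normal_dir p" by (rule gradient_Q_eq[OF p w])
    let ?S = "insert (normal_dir p) (?g ` ({1..s} - {j}))"
    have "?g i \<in> vec.span ?S" if "i \<in> {1..s}" for i
      using gradient_y_eq[OF p w j] that by (cases "i = j") (auto intro: vec.span_base vec.span_scale vec.span_neg)
    then show False
      using card Q by (intro gradients_not_in_small_span[OF p, of ?S]) (auto intro: vec.span_base)
  qed
  ultimately show "K j p \<noteq> 0" by (simp add: K_def)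
qed

text \<open>For \<open>w = 0\<close> the conic forces \<open>x = 0\<close>, as \<open>c_0\<close> is
  nonzero, and every equation becomes \<open>y_j^r = z^r\<close>; if \<open>z\<close> were 0 too,
  all coordinates would vanish.\<close>

lemma at_infinity:
  assumes p: "p \<in> proj_zeros n eqs" and w: "p (s + 1) = 0"
  shows "p 0 = 0" "p (s + 2) \<noteq> 0" "ell p = p (s + 2)" "\<And>j. j \<in> {1..s} \<Longrightarrow> p j \<noteq> 0" "D p \<noteq> 0"
proof -
  have "\<iota> c0 * (p 0)\<^sup>2 = 0" using p w by (simp add: proj_zeros_iff Q_iff)
  then show x: "p 0 = 0" using c0 by simp
  have y: "p j ^ r = p (s + 2) ^ r" if "j \<in> {1..s}" for j
    using p w that by (simp add: proj_zeros_iff h_at_infinity)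
  show z: "p (s + 2) \<noteq> 0"
  proof
    assume z: "p (s + 2) = 0"
    have "p i = 0" for i
    proof -
      consider "i = 0" | "i \<in> {1..s}" | "i = s + 1" | "i = s + 2" | "i > n" by fastforce
      then show ?thesis
      proof cases
        case 2
        then show ?thesis using y[of i] z r2 by (simp add: zero_power)
      qed (use x w z p in \<open>auto simp: proj_zeros_def coord_space_def\<close>)
    qed
    then show False using p by (auto simp: proj_zeros_def)
  qed
  show "ell p = p (s + 2)" by (simp only: ell_def x w) simp
  show nz: "p j \<noteq> 0" if "j \<in> {1..s}" for j
    using y[OF that] z r2 by (auto simp: zero_power)
  show "D p \<noteq> 0" using nz by (simp add: D_def)
qed

subsection \<open>The canonical linear form on the tangent spaces\<close>

text \<open>
  The Pluecker coordinates of the plane spanned by \<open>p\<close> and a tangent vector are, up to a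
  common factor \<open>b\<close>, the minors of the Jacobian matrix.  Each of the three kinds of minor below
  is needed somewhere on the curve: generically, at zeros of \<open>y_j\<close>, and at \<open>w = 0\<close>.
\<close>

definition is_coeff :: "(nat \<Rightarrow> 'a) \<Rightarrow> (nat \<Rightarrow> 'a) \<Rightarrow> 'a \<Rightarrow> bool" where
  "is_coeff p v b \<longleftrightarrow>
     p (s + 1) * v 0 - p 0 * v (s + 1) = b * (p (s + 1) * D p) \<and>
     (\<forall>j\<in>{1..s}. of_nat r * (p (s + 1) * v j - p j * v (s + 1)) = b * (E j p * K j p)) \<and>
     p 0 * ell v - ell p * v 0 = b * (ell p * D p)"

text \<open>Up to a constant this is the Poincare residue: a generator of the canonical sheaf
  twisted by \<open>O(-N)\<close>. It has degree \<open>-N\<close> by \<open>coeff_of_scale\<close>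
  and vanishes nowhere by \<open>tangent_coeff_0\<close>.\<close>

definition coeff_of :: "(nat \<Rightarrow> 'a) \<Rightarrow> (nat \<Rightarrow> 'a) \<Rightarrow> 'a" where
  "coeff_of p v = (THE b. is_coeff p v b)"

lemma D_split: "j \<in> {1..s} \<Longrightarrow> D p = p j ^ (r - 1) * E j p"
  unfolding D_def E_def by (subst prod.remove[of _ j]) auto

lemma is_coeff_unique:
  assumes p: "p \<in> proj_zeros n eqs" and b: "is_coeff p v b" "is_coeff p v b'"
  shows "b = b'"
proof (cases "p (s + 1) = 0")
  case True
  then show ?thesis using at_infinity[OF p True] b by (simp add: is_coeff_def)
next
  case w: False
  show ?thesis
  proof (cases "D p = 0")
    case False
    then show ?thesis using w b by (simp add: is_coeff_def)
  next
    case True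
    then obtain j where j: "j \<in> {1..s}" "p j = 0" by (auto simp: D_def)
    have "E j p \<noteq> 0" using y_zeros_disjoint[OF p w j] by (auto simp: E_def)
    then show ?thesis using K_nonzero[OF p w j] b j(1) unfolding is_coeff_def
      by (metis mult_cancel_right mult_eq_0_iff)
  qed
qed

text \<open>On the conic \<open>z/w\<close> is the polynomial
  \<open>c_0 T\<^sup>2 + c_1 T + c_2\<close> in \<open>T = x/w\<close>, with derivative
  \<open>qx / w\<close>; this is the relation of differentials with denominators cleared.\<close>

lemma wedge_wz:
  assumes p: "p \<in> proj_zeros n eqs" and v: "v \<in> tangent n eqs p"
  shows "p (s + 1) * (p (s + 1) * v (s + 2) - p (s + 2) * v (s + 1)) =
      qx p * (p (s + 1) * v 0 - p 0 * v (s + 1))"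
proof -
  have Q: "p (s + 1) * ell p = \<iota> c0 * (p 0)\<^sup>2" using p by (simp add: proj_zeros_iff Q_iff)
  have T: "p (s + 1) * v (s + 2) + p (s + 2) * v (s + 1) =
       qx p * v 0 + (\<iota> c1 * p 0 + 2 * \<iota> c2 * p (s + 1)) * v (s + 1)"
    using v by (simp add: tangent_iff)
  show ?thesis using Q T unfolding ell_def qx_def by algebra
qed

text \<open>The derivative of \<open>(y_j/w)^r = h_j(z/w, 1)\<close> with denominators cleared;
  Euler's formula eliminates \<open>hw\<close>.\<close>

lemma wedge_wy:
  assumes p: "p \<in> proj_zeros n eqs" and v: "v \<in> tangent n eqs p" and j: "j \<in> {1..s}"
  shows "p j ^ (r - 1) * (of_nat r * (p (s + 1) * v j - p j * v (s + 1))) =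
      hz j p * (p (s + 1) * v (s + 2) - p (s + 2) * v (s + 1))"
proof -
  have "of_nat r * p j ^ r = hz j p * p (s + 2) + hw j p * p (s + 1)"
    using p j h_euler[of j p] by (simp add: proj_zeros_iff)
  moreover have "p j ^ r = p j ^ (r - 1) * p j"
    using r2 by (metis power_minus_mult pos2 less_le_trans)
  ultimately have 1: "of_nat r * (p j ^ (r - 1) * p j) = hz j p * p (s + 2) + hw j p * p (s + 1)"
    by simp
  have 2: "of_nat r * p j ^ (r - 1) * v j = hz j p * v (s + 2) + hw j p * v (s + 1)"
    using v j by (simp add: tangent_iff)
  obtain Y where Y: "p j ^ (r - 1) = Y" by simp
  show ?thesis using 1 2 unfolding Y by algebra
qed

lemma wedge_wy_K:
  assumes p: "p \<in> proj_zeros n eqs" and v: "v \<in> tangent n eqs p" and j: "j \<in> {1..s}"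
  shows "p (s + 1) * (p j ^ (r - 1) * (of_nat r * (p (s + 1) * v j - p j * v (s + 1)))) =
      K j p * (p (s + 1) * v 0 - p 0 * v (s + 1))"
  unfolding wedge_wy[OF assms] K_def using wedge_wz[OF p v] by algebra

text \<open>On the conic \<open>x / ell\<close> and \<open>c_0 x / w\<close> are inverse to each
  other, which relates their differentials.\<close>

lemma wedge_xl:
  assumes p: "p \<in> proj_zeros n eqs" and v: "v \<in> tangent n eqs p"
  shows "p (s + 1) * (p 0 * ell v - ell p * v 0) = ell p * (p (s + 1) * v 0 - p 0 * v (s + 1))"
proof -
  have Q: "p (s + 1) * ell p = \<iota> c0 * (p 0)\<^sup>2" using p by (simp add: proj_zeros_iff Q_iff)
  have T: "p (s + 1) * v (s + 2) + p (s + 2) * v (s + 1) =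
       qx p * v 0 + (\<iota> c1 * p 0 + 2 * \<iota> c2 * p (s + 1)) * v (s + 1)"
    using v by (simp add: tangent_iff)
  show ?thesis using Q T unfolding ell_def qx_def by algebra
qed

text \<open>The line \<open>w = 0\<close> is tangent to the conic at its point at infinity.\<close>

lemma tangent_at_infinity:
  assumes p: "p \<in> proj_zeros n eqs" and v: "v \<in> tangent n eqs p" and w: "p (s + 1) = 0"
  shows "v (s + 1) = 0"
proof -
  have "p (s + 2) * v (s + 1) = 0"
    using v at_infinity(1)[OF p w] w by (simp add: tangent_iff qx_def)
  then show ?thesis using at_infinity(2)[OF p w] by simp
qed

text \<open>The wedge identities link the minors only after multiplication by \<open>w\<close> and
  \<open>y_j^(r-1)\<close>. So \<open>b\<close> is computed from a minor that is nonzero at the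
  point; the other equations follow by cancelling these factors where they are nonzero, and read
  \<open>0 = 0\<close> otherwise.\<close>

lemma is_coeff_exists:
  assumes p: "p \<in> proj_zeros n eqs" and v: "v \<in> tangent n eqs p"
  shows "\<exists>b. is_coeff p v b"
proof (cases "p (s + 1) = 0")
  case w: True
  note inf = at_infinity[OF p w]
  have "K j p = 0" for j using w inf(1) by (simp add: K_def qx_def)
  then have "is_coeff p v ((p 0 * ell v - ell p * v 0) / (ell p * D p))"
    unfolding is_coeff_def using w inf tangent_at_infinity[OF p v w] by simp
  then show ?thesis by blast
next
  case w: False
  let ?A = "p (s + 1) * v 0 - p 0 * v (s + 1)"
    and ?B = "\<lambda>j. of_nat r * (p (s + 1) * v j - p j * v (s + 1))"
    and ?C = "p 0 * ell v - ell p * v 0"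
  note B = wedge_wy_K[OF p v] and C = wedge_xl[OF p v]
  show ?thesis
  proof (cases "D p = 0")
    case False
    define b where "b = ?A / (p (s + 1) * D p)"
    have b: "?A = b * (p (s + 1) * D p)" using w False by (simp add: b_def)
    have "?B j = b * (E j p * K j p)" if j: "j \<in> {1..s}" for j
    proof -
      have "p j ^ (r - 1) \<noteq> 0" using False j by (auto simp: D_def)
      moreover have "p (s + 1) * p j ^ (r - 1) * ?B j = p (s + 1) * p j ^ (r - 1) * (b * (E j p * K j p))"
      proof -
        obtain Y where Y: "p j ^ (r - 1) = Y" by simp
        show ?thesis using B[OF j] b D_split[OF j, of p] unfolding Y by algebra
      qed
      ultimately show ?thesis using w by (metis mult_left_cancel no_zero_divisors)
    qed
    moreover have "?C = b * (ell p * D p)"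
    proof -
      have "p (s + 1) * ?C = p (s + 1) * (b * (ell p * D p))" using C b by algebra
      then show ?thesis using w by simp
    qed
    ultimately have "is_coeff p v b" using b unfolding is_coeff_def by blast
    then show ?thesis by blast
  next
    case D0: True
    then obtain j where j: "j \<in> {1..s}" "p j = 0" by (auto simp: D_def)
    have E: "E j p \<noteq> 0" using y_zeros_disjoint[OF p w j] by (auto simp: E_def)
    have K: "K j p \<noteq> 0" by (rule K_nonzero[OF p w j])
    have A: "?A = 0" using B[OF j(1)] K j(2) r2 by (simp add: zero_power)
    have C: "?C = 0" using C A w by simp
    have "?B i = (?B j / (E j p * K j p)) * (E i p * K i p)" if i: "i \<in> {1..s}" for i
    proof (cases "i = j")
      case True
      then show ?thesis using E K by simp
    next
      case False
      then have "p i \<noteq> 0" using y_zeros_disjoint[OF p w j i] by simp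
      then have "?B i = 0" using B[OF i] A w by simp
      moreover have "E i p = 0"
        unfolding E_def using False j r2 by (intro prod_zero) (auto intro!: bexI[of _ j] simp: zero_power)
      ultimately show ?thesis by simp
    qed
    then have "is_coeff p v (?B j / (E j p * K j p))"
      unfolding is_coeff_def using A C D0 by simp
    then show ?thesis by blast
  qed
qed

lemma coeff_of_eqI: "p \<in> proj_zeros n eqs \<Longrightarrow> is_coeff p v b \<Longrightarrow> coeff_of p v = b"
  unfolding coeff_of_def by (rule the_equality) (auto intro: is_coeff_unique)

lemma is_coeff_coeff_of:
  "p \<in> proj_zeros n eqs \<Longrightarrow> v \<in> tangent n eqs p \<Longrightarrow> is_coeff p v (coeff_of p v)"
  using is_coeff_exists coeff_of_eqI by metis

lemma is_coeff_lincomb: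
  assumes "is_coeff p v b" "is_coeff p u d"
  shows "is_coeff p (\<lambda>i. \<alpha> * v i + \<beta> * u i) (\<alpha> * b + \<beta> * d)"
  unfolding is_coeff_def
proof (intro conjI ballI)
  show "p (s + 1) * (\<alpha> * v 0 + \<beta> * u 0) - p 0 * (\<alpha> * v (s + 1) + \<beta> * u (s + 1)) =
      (\<alpha> * b + \<beta> * d) * (p (s + 1) * D p)"
    using assms unfolding is_coeff_def by algebra
  show "p 0 * ell (\<lambda>i. \<alpha> * v i + \<beta> * u i) - ell p * (\<alpha> * v 0 + \<beta> * u 0) =
      (\<alpha> * b + \<beta> * d) * (ell p * D p)"
    using assms unfolding is_coeff_def ell_def by algebra
  fix j assume j: "j \<in> {1..s}"
  have "of_nat r * (p (s + 1) * v j - p j * v (s + 1)) = b * (E j p * K j p)"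
    "of_nat r * (p (s + 1) * u j - p j * u (s + 1)) = d * (E j p * K j p)"
    using assms j unfolding is_coeff_def by blast+
  then show "of_nat r * (p (s + 1) * (\<alpha> * v j + \<beta> * u j) - p j * (\<alpha> * v (s + 1) + \<beta> * u (s + 1))) =
      (\<alpha> * b + \<beta> * d) * (E j p * K j p)"
    by algebra
qed

text \<open>Coefficient 0 makes the listed Pluecker coordinates of \<open>p\<close> and
  \<open>v\<close> vanish, and the tangent equations supply the rest. The ratio is that of the
  \<open>w\<close>-coordinates, or of the \<open>z\<close>-coordinates when
  \<open>w = 0\<close>.\<close>

lemma tangent_coeff_0:
  assumes p: "p \<in> proj_zeros n eqs" and v: "v \<in> tangent n eqs p" and 0: "is_coeff p v 0"
  shows "\<exists>\<alpha>. v = (\<lambda>i. \<alpha> * p i)"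
proof -
  have pc: "p \<in> coord_space n" and vc: "v \<in> coord_space n"
    using p v by (auto simp: proj_zeros_def tangent_def)
  have A: "p (s + 1) * v 0 - p 0 * v (s + 1) = 0"
    and B: "\<And>j. j \<in> {1..s} \<Longrightarrow> p (s + 1) * v j - p j * v (s + 1) = 0"
    and C: "p 0 * ell v - ell p * v 0 = 0"
    using 0 of_nat_r by (auto simp: is_coeff_def)
  have ext: "v = (\<lambda>i. \<alpha> * p i)"
    if "v 0 = \<alpha> * p 0" "\<And>j. j \<in> {1..s} \<Longrightarrow> v j = \<alpha> * p j" "v (s + 1) = \<alpha> * p (s + 1)"
      "v (s + 2) = \<alpha> * p (s + 2)" for \<alpha>
  proof
    fix i
    consider "i = 0" | "i \<in> {1..s}" | "i = s + 1" | "i = s + 2" | "i > n" by fastforce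
    then show "v i = \<alpha> * p i"
      by cases (use that pc vc in \<open>auto simp: coord_space_def\<close>)
  qed
  show ?thesis
  proof (cases "p (s + 1) = 0")
    case False
    have "p (s + 1) * (p (s + 1) * v (s + 2) - p (s + 2) * v (s + 1)) = 0"
      unfolding wedge_wz[OF p v] A by simp
    then have "p (s + 1) * v (s + 2) - p (s + 2) * v (s + 1) = 0" using False by simp
    then have "v = (\<lambda>i. v (s + 1) / p (s + 1) * p i)"
      using A B False by (intro ext) (auto simp: field_simps)
    then show ?thesis by blast
  next
    case w: True
    note inf = at_infinity[OF p w]
    have vw: "v (s + 1) = 0" by (rule tangent_at_infinity[OF p v w])
    have vx: "v 0 = 0" using C inf by simp
    have "v j = v (s + 2) / p (s + 2) * p j" if j: "j \<in> {1..s}" for j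
    proof -
      have "of_nat r * p j ^ r = hz j p * p (s + 2)"
        using p j h_euler[of j p] w by (simp add: proj_zeros_iff)
      moreover have "p j ^ r = p j ^ (r - 1) * p j"
        using r2 by (metis power_minus_mult pos2 less_le_trans)
      ultimately have 1: "of_nat r * (p j ^ (r - 1) * p j) = hz j p * p (s + 2)" by simp
      have 2: "of_nat r * p j ^ (r - 1) * v j = hz j p * v (s + 2)"
        using v j vw by (simp add: tangent_iff)
      have "of_nat r * p j ^ (r - 1) * (p (s + 2) * v j) = of_nat r * p j ^ (r - 1) * (v (s + 2) * p j)"
      proof -
        obtain Y where Y: "p j ^ (r - 1) = Y" by simp
        show ?thesis using 1 2 unfolding Y by algebra
      qed
      then have "p (s + 2) * v j = v (s + 2) * p j" using of_nat_r inf(4)[OF j] by simp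
      then show ?thesis using inf(2) by (simp add: field_simps)
    qed
    then have "v = (\<lambda>i. v (s + 2) / p (s + 2) * p i)"
      using vw vx w inf(1,2) by (intro ext) auto
    then show ?thesis by blast
  qed
qed

text \<open>Modulo \<open>p\<close> the tangent space is a line, with \<open>coeff_of p\<close> as coordinate.\<close>

lemma regular_form_proportional:
  assumes \<omega>: "\<omega> \<in> regular_forms n eqs" and p: "p \<in> proj_zeros n eqs"
    and v: "v \<in> tangent n eqs p" and u: "u \<in> tangent n eqs p"
  shows "coeff_of p u * \<omega> p v = coeff_of p v * \<omega> p u"
proof -
  \<comment> \<open>The combination is chosen to have coefficient 0; it is therefore a multiple of
    \<open>p\<close>, on which every form vanishes.\<close>
  define d where "d = (\<lambda>i. coeff_of p u * v i + (- coeff_of p v) * u i)"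
  have "is_coeff p d 0"
    using is_coeff_lincomb[OF is_coeff_coeff_of[OF p v] is_coeff_coeff_of[OF p u], of "coeff_of p u" "- coeff_of p v"]
    by (simp add: d_def mult.commute)
  moreover have "d \<in> tangent n eqs p" unfolding d_def by (rule tangent_lincomb[OF v u])
  ultimately obtain \<alpha> where \<alpha>: "d = (\<lambda>i. \<alpha> * p i)" using tangent_coeff_0[OF p] by blast
  note self = tangent_self[OF homogeneous_eqs p]
  have "\<omega> p d = \<omega> p (\<lambda>i. \<alpha> * p i + 0 * p i)" by (simp add: \<alpha>)
  also have "\<dots> = 0"
    unfolding regular_form_lincomb[OF \<omega> p self self] regular_form_self[OF homogeneous_eqs \<omega> p] by simp
  finally have "\<omega> p d = 0" .
  then show ?thesis unfolding d_def regular_form_lincomb[OF \<omega> p v u] by simp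
qed

subsection \<open>Adjunction: homogeneous polynomials as differential forms\<close>

text \<open>The adjunction degree of a complete intersection: the degrees of the equations add up to
  \<open>2 + s * r\<close>, and \<open>n + 1 = s + 3\<close> is subtracted. No truncation occurs,
  because \<open>s * (r - 1) \<ge> 1\<close>.\<close>

definition N :: nat where "N = s * (r - 1) - 1"

lemma Suc_N: "N + 1 = s * (r - 1)"
  using r2 s1 by (simp add: N_def)

definition form_of :: "'a mpoly \<Rightarrow> (nat \<Rightarrow> 'a) \<Rightarrow> (nat \<Rightarrow> 'a) \<Rightarrow> 'a" where
  "form_of F p v = (if p \<in> proj_zeros n eqs \<and> v \<in> tangent n eqs p then poly_eval F p * coeff_of p v else 0)"

text \<open>A single summand \<open>f dg\<close> is enough near each point, on the neighbourhood
  where \<open>G\<close> is nonzero.\<close>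

lemma form_of_local:
  assumes "p \<in> proj_zeros n eqs" "G \<in> homogeneous n e" "poly_eval G p \<noteq> 0"
    and "A \<in> homogeneous n d" "B \<in> homogeneous n d" "A' \<in> homogeneous n d'" "B' \<in> homogeneous n d'"
    and nz: "\<And>q. q \<in> proj_zeros n eqs \<Longrightarrow> poly_eval G q \<noteq> 0 \<Longrightarrow> poly_eval B q \<noteq> 0 \<and> poly_eval B' q \<noteq> 0"
    and eq: "\<And>q v. q \<in> proj_zeros n eqs \<Longrightarrow> poly_eval G q \<noteq> 0 \<Longrightarrow> v \<in> tangent n eqs q \<Longrightarrow>
      poly_eval F q * coeff_of q v = frac_value (A, B) q * frac_differential n (A', B') q v"
  shows "\<exists>U fgs. zariski_open n eqs U \<and> p \<in> U \<and>
        (\<forall>(f, g)\<in>set fgs. regular_frac n U f \<and> regular_frac n U g) \<and>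
        (\<forall>q\<in>U. \<forall>v\<in>tangent n eqs q.
           form_of F q v = (\<Sum>(f, g)\<leftarrow>fgs. frac_value f q * frac_differential n g q v))"
proof -
  define U where "U = {q \<in> proj_zeros n eqs. \<exists>G'\<in>{G}. poly_eval G' q \<noteq> 0}"
  have "zariski_open n eqs U"
    unfolding zariski_open_def using assms(2) by (intro exI[of _ "{G}"]) (auto simp: U_def)
  moreover have "regular_frac n U (A, B)" "regular_frac n U (A', B')"
    unfolding regular_frac_def using assms(4-7) nz by (auto simp: U_def)
  moreover have "p \<in> U" using assms by (simp add: U_def)
  moreover have "form_of F q v = frac_value (A, B) q * frac_differential n (A', B') q v"
    if "q \<in> U" "v \<in> tangent n eqs q" for q v
    using that eq by (simp add: form_of_def U_def)
  ultimately show ?thesis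
    by (intro exI[of _ U] exI[of _ "[((A, B), (A', B'))]"]) simp
qed

lemma homogeneous_prod_Var:
  assumes "I \<subseteq> {1..s}"
  shows "(\<Prod>j\<in>I. Var j ^ k) \<in> homogeneous n (card I * k)"
proof -
  have "(\<Prod>j\<in>I. Var j ^ k) \<in> homogeneous n (\<Sum>j\<in>I. k * 1)"
    using assms by (intro homogeneous_prod homogeneous_power homogeneous_Var) (auto intro: finite_subset)
  then show ?thesis by simp
qed

text \<open>The three equations of \<open>is_coeff\<close> express the residue through
  \<open>d(x/ell)\<close>, \<open>d(x/w)\<close> and \<open>d(y_j/w)\<close>. The first serves at
  \<open>w = 0\<close>, the second where \<open>w\<close> and all \<open>y_j\<close> are nonzero,
  the third at a zero of \<open>y_j\<close> with \<open>w \<noteq> 0\<close>.\<close>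

lemma form_of_regular:
  assumes F: "F \<in> homogeneous n N"
  shows "form_of F \<in> regular_forms n eqs"
proof -
  define x where "x = (Var 0 :: 'a mpoly)"
  define w where "w = (Var (s + 1) :: 'a mpoly)"
  define l where "l = (Var (s + 2) - Const (\<iota> c1) * Var 0 - Const (\<iota> c2) * Var (s + 1) :: 'a mpoly)"
  define qxp where "qxp = (Const (2 * \<iota> c0) * Var 0 + Const (\<iota> c1) * Var (s + 1) :: 'a mpoly)"
  define Y where "Y I k = (\<Prod>j\<in>I. Var j ^ k :: 'a mpoly)" for I k
  have hx: "x \<in> homogeneous n 1" and hw': "w \<in> homogeneous n 1"
    unfolding x_def w_def by (rule homogeneous_Var, simp)+
  have hl: "l \<in> homogeneous n 1"
    unfolding l_def by (intro homogeneous_diff homogeneous_Var homogeneous_Const_Var) simp_all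
  have hq: "qxp \<in> homogeneous n 1"
    unfolding qxp_def by (intro homogeneous_add homogeneous_Const_Var) simp_all
  have hY: "Y I k \<in> homogeneous n (card I * k)" if "I \<subseteq> {1..s}" for I k
    unfolding Y_def by (rule homogeneous_prod_Var[OF that])
  have ev: "poly_eval x p = p 0" "poly_eval w p = p (s + 1)" "poly_eval l p = ell p"
    "poly_eval qxp p = qx p" "poly_eval (Y {1..s} (r - 1)) p = D p"
    "poly_eval (Y ({1..s} - {j}) (r - 1)) p = E j p" for p j
    by (simp_all add: x_def w_def l_def qxp_def Y_def ell_def qx_def D_def E_def)
  note ev = ev ev[unfolded One_nat_def]
  have evY: "poly_eval (Y I 1) p \<noteq> 0 \<longleftrightarrow> (\<forall>j\<in>I. p j \<noteq> 0)" if "finite I" for I p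
    using that by (simp add: Y_def)
  have df: "differential n x p v = v 0" "differential n w p v = v (s + 1)" "differential n l p v = ell v" for p v
    by (simp_all add: x_def w_def l_def ell_def)
  note df = df df[unfolded add_2_eq_Suc' Suc_eq_plus1[symmetric]]
  have DN: "D p \<noteq> 0 \<longleftrightarrow> (\<forall>j\<in>{1..s}. p j \<noteq> 0)" for p using r2 by (simp add: D_def)
  have EN: "E j p \<noteq> 0 \<longleftrightarrow> (\<forall>i\<in>{1..s}-{j}. p i \<noteq> 0)" for p j using r2 by (simp add: E_def)
  have loc: "\<exists>U fgs. zariski_open n eqs U \<and> p \<in> U \<and>
        (\<forall>(f, g)\<in>set fgs. regular_frac n U f \<and> regular_frac n U g) \<and>
        (\<forall>q\<in>U. \<forall>v\<in>tangent n eqs q.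
           form_of F q v = (\<Sum>(f, g)\<leftarrow>fgs. frac_value f q * frac_differential n g q v))"
    if p: "p \<in> proj_zeros n eqs" for p
  proof (cases "p (s + 1) = 0")
    case w0: True
    note inf = at_infinity[OF p w0]
    show ?thesis
    \<comment> \<open>The sign appears because \<open>is_coeff\<close> uses
      \<open>x d ell - ell dx\<close>, while the numerator of \<open>d(x/ell)\<close> is its
      negative.\<close>
    proof (rule form_of_local[where A' = x and B' = l and d' = 1 and B = "Y {1..s} (r - 1)"
          and A = "- (F * l)" and d = "s * (r - 1)" and G = "l * Y {1..s} 1"])
      show "- (F * l) \<in> homogeneous n (s * (r - 1))"
        unfolding Suc_N[symmetric] by (intro homogeneous_uminus homogeneous_mult F hl)
      show "poly_eval (l * Y {1..s} 1) p \<noteq> 0"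
        using inf evY[of "{1..s}" p] by (simp add: ev)
      show "l * Y {1..s} 1 \<in> homogeneous n (1 + card {1..s} * 1)"
        by (intro homogeneous_mult hl hY) simp
      show "Y {1..s} (r - 1) \<in> homogeneous n (s * (r - 1))" using hY[of "{1..s}" "r - 1"] by simp
      fix q v assume q: "q \<in> proj_zeros n eqs" "poly_eval (l * Y {1..s} 1) q \<noteq> 0"
      then have nz: "ell q \<noteq> 0" "D q \<noteq> 0" using evY[of "{1..s}" q] by (auto simp: ev DN)
      then show "poly_eval (Y {1..s} (r - 1)) q \<noteq> 0 \<and> poly_eval l q \<noteq> 0" by (simp add: ev)
      assume v: "v \<in> tangent n eqs q"
      have *: "q 0 * ell v - ell q * v 0 = coeff_of q v * (ell q * D q)"
        using is_coeff_coeff_of[OF q(1) v] by (simp add: is_coeff_def)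
      have "frac_value (- (F * l), Y {1..s} (r - 1)) q * frac_differential n (x, l) q v =
          poly_eval F q * ell q / D q * ((q 0 * ell v - ell q * v 0) / (ell q)\<^sup>2)"
        using nz by (simp add: frac_value_def frac_differential_def ev df field_simps)
      also have "\<dots> = poly_eval F q * coeff_of q v"
        unfolding * using nz by (simp add: field_simps power2_eq_square)
      finally show "poly_eval F q * coeff_of q v =
          frac_value (- (F * l), Y {1..s} (r - 1)) q * frac_differential n (x, l) q v" by simp
    qed (use p hx hl in auto)
  next
    case w0: False
    show ?thesis
    proof (cases "D p = 0")
      case False
      show ?thesis
      proof (rule form_of_local[where A' = x and B' = w and d' = 1 and B = "Y {1..s} (r - 1)"
            and A = "F * w" and d = "s * (r - 1)" and G = "w * Y {1..s} 1"])
        show "F * w \<in> homogeneous n (s * (r - 1))"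
          unfolding Suc_N[symmetric] by (intro homogeneous_mult F hw')
        show "poly_eval (w * Y {1..s} 1) p \<noteq> 0"
          using w0 False evY[of "{1..s}" p] by (simp add: ev DN)
        show "w * Y {1..s} 1 \<in> homogeneous n (1 + card {1..s} * 1)"
          by (intro homogeneous_mult hw' hY) simp
        show "Y {1..s} (r - 1) \<in> homogeneous n (s * (r - 1))" using hY[of "{1..s}" "r - 1"] by simp
        fix q v assume q: "q \<in> proj_zeros n eqs" "poly_eval (w * Y {1..s} 1) q \<noteq> 0"
        then have nz: "q (s + 1) \<noteq> 0" "D q \<noteq> 0" using evY[of "{1..s}" q] by (auto simp: ev DN)
        then show "poly_eval (Y {1..s} (r - 1)) q \<noteq> 0 \<and> poly_eval w q \<noteq> 0" by (simp add: ev)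
        assume v: "v \<in> tangent n eqs q"
        have *: "q (s + 1) * v 0 - q 0 * v (s + 1) = coeff_of q v * (q (s + 1) * D q)"
          using is_coeff_coeff_of[OF q(1) v] by (simp add: is_coeff_def)
        have "frac_value (F * w, Y {1..s} (r - 1)) q * frac_differential n (x, w) q v =
            poly_eval F q * q (s + 1) / D q * ((q (s + 1) * v 0 - q 0 * v (s + 1)) / (q (s + 1))\<^sup>2)"
          using nz by (simp add: frac_value_def frac_differential_def ev df mult.commute)
        also have "\<dots> = poly_eval F q * coeff_of q v"
          unfolding * using nz by (simp add: field_simps power2_eq_square)
        finally show "poly_eval F q * coeff_of q v =
            frac_value (F * w, Y {1..s} (r - 1)) q * frac_differential n (x, w) q v" by simp
      qed (use p hx hw' in auto)
    next
      case True
      then obtain j where j: "j \<in> {1..s}" "p j = 0" by (auto simp: D_def)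
      define h' where "h' = partial (s + 2) (h j)"
      have hh: "h' \<in> homogeneous n (r - 1)" unfolding h'_def by (intro homogeneous_partial homogeneous_h)
      have evh: "poly_eval h' q = hz j q" for q by (simp add: h'_def)
      let ?I = "{1..s} - {j}"
      have cI: "card ?I = s - 1" using j by simp
      \<comment> \<open>Numerator \<open>r F w\<^sup>2\<close> and denominator
        \<open>E_j hz qx\<close> must have the same degree \<open>N + 2\<close>.\<close>
      have deg: "card ?I * (r - 1) + (r - 1) + 1 = N + 0 + 2 * 1"
      proof -
        have "card ?I * (r - 1) + (r - 1) = s * (r - 1)"
          unfolding cI using s1 by (simp add: diff_mult_distrib)
        then show ?thesis using Suc_N by simp
      qed
      show ?thesis
      proof (rule form_of_local[where A' = "Var j" and B' = w and d' = 1 and B = "Y ?I (r - 1) * h' * qxp"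
            and A = "F * Const (of_nat r) * w ^ 2" and d = "N + 0 + 2 * 1" and G = "w * Y ?I 1 * h' * qxp"])
        show "F * Const (of_nat r) * w ^ 2 \<in> homogeneous n (N + 0 + 2 * 1)"
          by (intro homogeneous_mult homogeneous_power homogeneous_Const F hw')
        show "poly_eval (w * Y ?I 1 * h' * qxp) p \<noteq> 0"
          using w0 y_zeros_disjoint[OF p w0 j] K_nonzero[OF p w0 j] evY[of ?I p] by (auto simp: ev evh K_def)
        show "w * Y ?I 1 * h' * qxp \<in> homogeneous n (1 + card ?I * 1 + (r - 1) + 1)"
          by (intro homogeneous_mult hw' hY hh hq) auto
        show "Y ?I (r - 1) * h' * qxp \<in> homogeneous n (N + 0 + 2 * 1)"
          unfolding deg[symmetric] by (intro homogeneous_mult hY hh hq) auto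
        show "Var j \<in> homogeneous n 1" using j by (intro homogeneous_Var) simp
        fix q v assume q: "q \<in> proj_zeros n eqs" "poly_eval (w * Y ?I 1 * h' * qxp) q \<noteq> 0"
        then have nz: "q (s + 1) \<noteq> 0" "E j q \<noteq> 0" "hz j q \<noteq> 0" "qx q \<noteq> 0"
          using evY[of ?I q] by (auto simp: ev evh EN)
        then show "poly_eval (Y ?I (r - 1) * h' * qxp) q \<noteq> 0 \<and> poly_eval w q \<noteq> 0"
          by (simp add: ev evh)
        assume v: "v \<in> tangent n eqs q"
        have *: "of_nat r * (q (s + 1) * v j - q j * v (s + 1)) = coeff_of q v * (E j q * K j q)"
          using is_coeff_coeff_of[OF q(1) v] j(1) by (simp add: is_coeff_def)
        have "frac_value (F * Const (of_nat r) * w ^ 2, Y ?I (r - 1) * h' * qxp) q *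
              frac_differential n (Var j, w) q v =
            poly_eval F q * (q (s + 1))\<^sup>2 / (E j q * K j q) *
              ((of_nat r * (q (s + 1) * v j - q j * v (s + 1))) / (q (s + 1))\<^sup>2)"
          using j(1) by (simp add: frac_value_def frac_differential_def ev evh df K_def mult_ac)
        also have "\<dots> = poly_eval F q * coeff_of q v"
          unfolding * using nz by (simp add: K_def)
        finally show "poly_eval F q * coeff_of q v =
            frac_value (F * Const (of_nat r) * w ^ 2, Y ?I (r - 1) * h' * qxp) q *
              frac_differential n (Var j, w) q v" by simp
      qed (use p hw' in auto)
    qed
  qed
  then show ?thesis unfolding regular_forms_def by (auto simp: form_of_def)
qed

text \<open>No computation with minors: for a coordinate \<open>X_k\<close> not vanishing at
  \<open>p\<close>, the regular form attached to \<open>Var k ^ N\<close> is invariant under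
  scaling, and the homogeneity of \<open>Var k ^ N\<close> is known.\<close>

lemma coeff_of_scale:
  assumes p: "p \<in> proj_zeros n eqs" and v: "v \<in> tangent n eqs p" and "a \<noteq> 0"
  shows "a ^ N * coeff_of (\<lambda>i. a * p i) (\<lambda>i. a * v i) = coeff_of p v"
proof -
  obtain k where k: "k \<le> n" "p k \<noteq> 0"
    using p by (auto simp: proj_zeros_def coord_space_def fun_eq_iff) (meson not_le)
  have "Var k ^ N \<in> homogeneous n (N * 1)" by (intro homogeneous_power homogeneous_Var k)
  then have reg: "form_of (Var k ^ N) \<in> regular_forms n eqs" by (intro form_of_regular) simp
  have "form_of (Var k ^ N) (\<lambda>i. a * p i) (\<lambda>i. a * v i) = form_of (Var k ^ N) p v"
    by (rule regular_form_scale[OF homogeneous_eqs reg p v \<open>a \<noteq> 0\<close>])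
  then show ?thesis
    using p v k proj_zeros_scale[OF homogeneous_eqs p \<open>a \<noteq> 0\<close>] tangent_scale[OF homogeneous_eqs v, of a]
    by (simp add: form_of_def power_mult_distrib)
qed

end

text \<open>Over all but finitely many \<open>t\<close> the fibre contains a point with all
  \<open>y_j\<close> nonzero, and Fourier extraction on its orbit compares the coefficients;
  polynomials agreeing at infinitely many \<open>t\<close> are equal. The exceptional set
  \<open>T\<close> admits identities known only where both charts apply.\<close>

lemma (in cyclic_cover) normal_form_unique:
  assumes H: "\<And>j. j \<in> {1..s} \<Longrightarrow> H j \<noteq> 0" and T: "finite T"
    and eq: "\<And>t y. t \<notin> T \<Longrightarrow> above t y \<Longrightarrow> normal_form g t y = normal_form g' t y"
    and a: "a \<in> exponents r s"
  shows "g a = g' a"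
proof -
  define T' where "T' = T \<union> (\<Union>j\<in>{1..s}. {t. poly (H j) t = 0})"
  have fin: "finite T'" unfolding T'_def using H T by (auto intro: poly_roots_finite)
  have "poly (g a - g' a) t = 0" if t: "t \<in> - T'" for t
  proof -
    obtain y where y: "above t y" using exists_above by blast
    have "y j \<noteq> 0" if "j \<in> {1..s}" for j
    proof -
      have "poly (H j) t \<noteq> 0" using t that by (auto simp: T'_def)
      then have "y j ^ r \<noteq> 0" using y that by (simp add: above_def)
      then show ?thesis using r_pos by (metis zero_power)
    qed
    moreover have "(\<Sum>a\<in>exponents r s. poly (g a) t * multi_pow s a (\<lambda>j. e j * y j)) =
        (\<Sum>a\<in>exponents r s. poly (g' a) t * multi_pow s a (\<lambda>j. e j * y j))"
      if "e \<in> unit_group r s" for e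
      using eq[of t "\<lambda>j. e j * y j"] above_unit_group[OF y that] t by (simp add: normal_form_def T'_def)
    ultimately have "poly (g a) t = poly (g' a) t"
      by (intro unit_group_unique[OF of_nat_r a, of "\<lambda>a. poly (g a) t" y "\<lambda>a. poly (g' a) t"])
    then show ?thesis by simp
  qed
  moreover have "infinite (- T')"
    using fin infinite_UNIV_alg_closed[where 'a = 'a] by (metis finite_compl)
  ultimately have "g a - g' a = 0" by (intro poly_eq_0_if_infinite_zeros)
  then show ?thesis by simp
qed

text \<open>The function \<open>u^(m - k) g(1/u)\<close> can be a polynomial only if it has no pole
  at 0. After multiplication by \<open>u ^ degree g\<close> the right side is \<open>u^m\<close>
  times the reflected polynomial, whose constant term is the leading coefficient of
  \<open>g\<close>; a left side divisible by a higher power of \<open>u\<close> has no term in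
  \<open>u^m\<close>.\<close>

lemma degree_bound_reflect:
  fixes g g' :: "'a::alg_closed_field poly"
  assumes "finite T" "g \<noteq> 0" "\<kappa> \<noteq> 0"
    and eq: "\<And>u. u \<notin> T \<Longrightarrow> u \<noteq> 0 \<Longrightarrow> poly g' u * u ^ k = \<kappa> * u ^ m * poly g (inverse u)"
  shows "k + degree g \<le> m"
proof (rule ccontr)
  assume *: "\<not> k + degree g \<le> m"
  let ?p = "monom 1 (k + degree g) * g'" and ?q = "monom 1 m * smult \<kappa> (reflect_poly g)"
  have "?p - ?q = 0"
  proof (rule poly_eq_0_if_infinite_zeros)
    show "infinite (- insert 0 T)"
      using assms(1) infinite_UNIV_alg_closed[where 'a = 'a] by (metis finite_compl finite_insert)
    fix u assume u: "u \<in> - insert 0 T"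
    then have "poly (reflect_poly g) u = u ^ degree g * poly g (inverse u)"
      by (intro poly_reflect_poly_nz) auto
    moreover have "poly g' u * u ^ k = \<kappa> * u ^ m * poly g (inverse u)" using eq u by auto
    ultimately show "poly (?p - ?q) u = 0"
      by (simp add: poly_monom power_add mult_ac)
  qed
  then have "coeff ?p m = coeff ?q m" by simp
  then show False using * assms(2,3) by (simp add: coeff_monom_mult)
qed

subsection \<open>Charts\<close>

text \<open>A polynomial parametrisation of the conic. The Wronskian identities are the equations of
  \<open>is_coeff\<close> along it, and \<open>\<epsilon>\<close> is the resulting constant
  coefficient: 1 for \<open>t\<close>, and \<open>-1\<close> for \<open>u = 1/t\<close>, as
  \<open>dt = - du / u\<^sup>2\<close>.\<close>

locale chart = smooth_superelliptic \<iota> r s c0 c1 c2 c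
  for \<iota> :: "'k::field \<Rightarrow> 'a::alg_closed_field" and r s c0 c1 c2 c +
  fixes X W Z :: "'a poly" and \<epsilon> :: 'a
  assumes conic: "poly W t * (poly Z t - \<iota> c1 * poly X t - \<iota> c2 * poly W t) = \<iota> c0 * (poly X t)\<^sup>2"
    and conic_deriv: "poly W t * poly (pderiv Z) t + poly Z t * poly (pderiv W) t =
      (2 * \<iota> c0 * poly X t + \<iota> c1 * poly W t) * poly (pderiv X) t +
      (\<iota> c1 * poly X t + 2 * \<iota> c2 * poly W t) * poly (pderiv W) t"
    and wronskian_x: "poly W t * poly (pderiv X) t - poly X t * poly (pderiv W) t = \<epsilon> * poly W t"
    and wronskian_z: "poly W t * poly (pderiv Z) t - poly Z t * poly (pderiv W) t =
      \<epsilon> * (2 * \<iota> c0 * poly X t + \<iota> c1 * poly W t)"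
    and wronskian_l: "poly X t * (poly (pderiv Z) t - \<iota> c1 * poly (pderiv X) t - \<iota> c2 * poly (pderiv W) t) -
      (poly Z t - \<iota> c1 * poly X t - \<iota> c2 * poly W t) * poly (pderiv X) t =
      \<epsilon> * (poly Z t - \<iota> c1 * poly X t - \<iota> c2 * poly W t)"
    and nonvanishing: "poly W t \<noteq> 0 \<or> poly Z t \<noteq> 0"
begin

definition HH :: "nat \<Rightarrow> 'a poly" where
  "HH j = Z ^ r + (\<Sum>i=1..r-1. [:\<iota> (c i j):] * Z ^ (r - i) * W ^ i) + W ^ r"

sublocale cyclic_cover r s HH
  by unfold_locales (rule of_nat_r)

definition P :: "'a \<Rightarrow> (nat \<Rightarrow> 'a) \<Rightarrow> nat \<Rightarrow> 'a" where
  "P t y i = (if i = 0 then poly X t else if i \<le> s then y i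
     else if i = s + 1 then poly W t else if i = s + 2 then poly Z t else 0)"

text \<open>The velocity of \<open>P\<close> along the cover multiplied by \<open>D\<close>. The
  velocity has \<open>y_j\<close>-component \<open>H_j' / (r y_j^(r-1))\<close>; the factor
  \<open>D\<close> clears this denominator, so \<open>V\<close> is polynomial also at branch
  points.\<close>

definition V :: "'a \<Rightarrow> (nat \<Rightarrow> 'a) \<Rightarrow> nat \<Rightarrow> 'a" where
  "V t y i = (if i = 0 then poly (pderiv X) t * D y
     else if i \<le> s then poly (pderiv (HH i)) t / of_nat r * E i y
     else if i = s + 1 then poly (pderiv W) t * D y
     else if i = s + 2 then poly (pderiv Z) t * D y else 0)"

lemma P_simps [simp]:
  "P t y 0 = poly X t" "j \<in> {1..s} \<Longrightarrow> P t y j = y j"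
  "P t y (s + 1) = poly W t" "P t y (Suc s) = poly W t"
  "P t y (s + 2) = poly Z t" "P t y (Suc (Suc s)) = poly Z t"
  by (auto simp: P_def)

lemma V_simps [simp]:
  "V t y 0 = poly (pderiv X) t * D y"
  "j \<in> {1..s} \<Longrightarrow> V t y j = poly (pderiv (HH j)) t / of_nat r * E j y"
  "V t y (s + 1) = poly (pderiv W) t * D y" "V t y (Suc s) = poly (pderiv W) t * D y"
  "V t y (s + 2) = poly (pderiv Z) t * D y" "V t y (Suc (Suc s)) = poly (pderiv Z) t * D y"
  by (auto simp: V_def)

lemma D_P [simp]: "D (P t y) = D y"
  unfolding D_def by (intro prod.cong) auto

lemma E_P [simp]: "E j (P t y) = E j y"
  unfolding E_def by (intro prod.cong) auto

lemma poly_eval_h_P: "poly_eval (h j) (P t y) = poly (HH j) t"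
  by (simp add: h_poly_def HH_def Let_def poly_sum poly_power mult.assoc)

lemma poly_pderiv_HH:
  "poly (pderiv (HH j)) t = hz j (P t y) * poly (pderiv Z) t + hw j (P t y) * poly (pderiv W) t"
proof -
  define v where "v i = (if i = s + 1 then poly (pderiv W) t else if i = s + 2 then poly (pderiv Z) t else 0)" for i
  have "differential n (h j) (P t y) v = poly (pderiv (HH j)) t"
    by (simp add: h_poly_def HH_def Let_def v_def pderiv_add higher_pderiv_sum[of 1, simplified] pderiv_smult pderiv_mult pderiv_power
        poly_sum poly_power pderiv_pCons ac_simps distrib_left distrib_right)
  then show ?thesis by (simp add: differential_h v_def)
qed

lemma P_in_proj_zeros_iff: "P t y \<in> proj_zeros n eqs \<longleftrightarrow> above t y"
proof -
  have "P t y \<noteq> (\<lambda>_. 0)"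
  proof
    assume "P t y = (\<lambda>_. 0)"
    then have "P t y (s + 1) = 0" "P t y (s + 2) = 0" by simp_all
    then show False using nonvanishing[of t] by simp
  qed
  moreover have "P t y \<in> coord_space n" by (auto simp: coord_space_def P_def)
  moreover have "poly_eval Q (P t y) = 0" using conic[of t] by (simp add: Q_iff ell_def)
  ultimately show ?thesis by (simp add: proj_zeros_iff above_def poly_eval_h_P)
qed

lemma V_tangent:
  assumes "above t y" shows "V t y \<in> tangent n eqs (P t y)"
proof -
  have "V t y \<in> coord_space n" by (auto simp: coord_space_def V_def)
  moreover have "poly W t * (poly (pderiv Z) t * D y) + poly Z t * (poly (pderiv W) t * D y) =
       qx (P t y) * (poly (pderiv X) t * D y) +
       (\<iota> c1 * poly X t + 2 * \<iota> c2 * poly W t) * (poly (pderiv W) t * D y)"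
    using conic_deriv[of t] unfolding qx_def P_simps by algebra
  moreover have "of_nat r * P t y j ^ (r - 1) * V t y j =
       hz j (P t y) * V t y (s + 2) + hw j (P t y) * V t y (s + 1)" if j: "j \<in> {1..s}" for j
  proof -
    have "of_nat r * P t y j ^ (r - 1) * V t y j = poly (pderiv (HH j)) t * D y"
      using j of_nat_r D_split[OF j, of y] by simp
    then show ?thesis by (simp add: poly_pderiv_HH[of _ _ y] algebra_simps)
  qed
  ultimately show ?thesis by (simp add: tangent_iff)
qed

text \<open>In this chart the canonical form is \<open>\<epsilon> dt / D\<close>, and the scaling of
  \<open>V\<close> cancels \<open>D\<close>.\<close>

lemma coeff_of_chart:
  assumes "above t y" shows "coeff_of (P t y) (V t y) = \<epsilon>"
proof (rule coeff_of_eqI)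
  show p: "P t y \<in> proj_zeros n eqs" using assms P_in_proj_zeros_iff by blast
  show "is_coeff (P t y) (V t y) \<epsilon>"
    unfolding is_coeff_def
  proof (intro conjI ballI)
    show "P t y (s + 1) * V t y 0 - P t y 0 * V t y (s + 1) = \<epsilon> * (P t y (s + 1) * D (P t y))"
      unfolding P_simps V_simps D_P using wronskian_x[of t] by algebra
    show "P t y 0 * ell (V t y) - ell (P t y) * V t y 0 = \<epsilon> * (ell (P t y) * D (P t y))"
      unfolding P_simps V_simps D_P ell_def using wronskian_l[of t] by algebra
    fix j assume j: "j \<in> {1..s}"
    have "y j ^ r = poly (HH j) t" using assms j by (simp add: above_def)
    moreover have "y j ^ r = y j * y j ^ (r - 1)" using r_pos by (simp add: power_eq_if)
    moreover have "hz j (P t y) * poly Z t + hw j (P t y) * poly W t = of_nat r * poly (HH j) t"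
      using h_euler[of j "P t y"] by (simp add: poly_eval_h_P)
    ultimately have 1: "of_nat r * (y j * y j ^ (r - 1)) = hz j (P t y) * poly Z t + hw j (P t y) * poly W t"
      by simp
    have 2: "of_nat r * V t y j = (hz j (P t y) * poly (pderiv Z) t + hw j (P t y) * poly (pderiv W) t) * E j y"
      using j of_nat_r by (simp add: poly_pderiv_HH[of _ _ y])
    obtain Y where Y: "y j ^ (r - 1) = Y" by simp
    have 3: "of_nat r * (poly W t * V t y j - y j * (poly (pderiv W) t * D y)) =
        \<epsilon> * (E j y * (hz j (P t y) * (2 * \<iota> c0 * poly X t + \<iota> c1 * poly W t)))"
      using 1 2 wronskian_z[of t] D_split[OF j, of y] unfolding Y by algebra
    show "of_nat r * (P t y (s + 1) * V t y j - P t y j * V t y (s + 1)) = \<epsilon> * (E j (P t y) * K j (P t y))"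
      using 3 j by (simp only: K_def qx_def P_simps E_P V_simps(3))
  qed
qed

lemma polyfun_P: "polyfun (\<lambda>t y. P t y i)"
proof -
  consider "i = 0" | "i \<in> {1..s}" | "i = s + 1" | "i = s + 2" | "i > n" by fastforce
  then show ?thesis
    by cases (use polyfun_poly polyfun_coord polyfun_0 in \<open>auto simp: P_def\<close>)
qed

lemma polyfun_poly_eval: "polyfun (\<lambda>t y. poly_eval F (P t y))"
  unfolding poly_eval_def eval_monom_def
proof (intro polyfun_sum polyfun_mult polyfun_prod polyfun_power polyfun_P)
  fix m show "polyfun (\<lambda>t y. Poly_Mapping.lookup F m)"
    using polyfun_poly[of "[:Poly_Mapping.lookup F m:]"] by simp
qed

lemma polyfun_V: "polyfun (\<lambda>t y. V t y i)"
proof -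
  have D: "polyfun (\<lambda>t y. D y)" unfolding D_def by (intro polyfun_prod polyfun_power polyfun_coord)
  have E: "polyfun (\<lambda>t y. E j y)" for j
    unfolding E_def by (intro polyfun_prod polyfun_power polyfun_coord) auto
  consider "i = 0" | "i \<in> {1..s}" | "i = s + 1" | "i = s + 2" | "i > n" by fastforce
  then show ?thesis
  proof cases
    case 2
    have "polyfun (\<lambda>t y. poly (smult (inverse (of_nat r)) (pderiv (HH i))) t * E i y)"
      by (intro polyfun_mult polyfun_poly E)
    then show ?thesis by (rule polyfun_cong) (use 2 in \<open>simp add: field_simps\<close>)
  next
    case 5
    then have "V t y i = 0" for t y by (simp add: V_def)
    then show ?thesis using polyfun_0 by simp
  qed (use polyfun_mult[OF polyfun_poly D] in simp_all)
qed

text \<open>The identity with cleared denominators holds on all of the curve; pulled back along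
  \<open>P\<close> and \<open>V\<close> it has polynomial functions as numerator and
  denominator.\<close>

lemma regular_form_polyfun:
  assumes \<omega>: "\<omega> \<in> regular_forms n eqs"
  shows "polyfun (\<lambda>t y. \<omega> (P t y) (V t y))"
proof (rule polyfun_if_locally_fraction)
  fix t y assume "above t y"
  then have "P t y \<in> proj_zeros n eqs" using P_in_proj_zeros_iff by blast
  from regular_form_clear_denominators[OF \<omega> this] obtain B A where B: "poly_eval B (P t y) \<noteq> 0"
    and BA: "\<forall>q\<in>proj_zeros n eqs. \<forall>v\<in>tangent n eqs q. poly_eval B q * \<omega> q v = (\<Sum>i\<le>n. poly_eval (A i) q * v i)"
    by blast
  have "polyfun (\<lambda>t y. \<Sum>i\<le>n. poly_eval (A i) (P t y) * V t y i)"
    by (intro polyfun_sum polyfun_mult polyfun_poly_eval polyfun_V)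
  moreover have "\<forall>t' y'. above t' y' \<longrightarrow> poly_eval B (P t' y') * \<omega> (P t' y') (V t' y') =
      (\<Sum>i\<le>n. poly_eval (A i) (P t' y') * V t' y' i)"
    using BA V_tangent P_in_proj_zeros_iff by blast
  ultimately show "\<exists>b a. polyfun b \<and> polyfun a \<and> b t y \<noteq> 0 \<and>
      (\<forall>t' y'. above t' y' \<longrightarrow> b t' y' * \<omega> (P t' y') (V t' y') = a t' y')"
    using B polyfun_poly_eval[of B]
    by (intro exI[of _ "\<lambda>t y. poly_eval B (P t y)"]
        exI[of _ "\<lambda>t y. \<Sum>i\<le>n. poly_eval (A i) (P t y) * V t y i"] conjI)
qed

lemma above_scaled:
  assumes "p \<in> proj_zeros n eqs" "a \<noteq> 0" "p = (\<lambda>i. a * P t y i)"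
  shows "above t y"
proof -
  have "(\<lambda>i. inverse a * p i) \<in> proj_zeros n eqs"
    using assms by (intro proj_zeros_scale[OF homogeneous_eqs]) auto
  moreover have "(\<lambda>i. inverse a * p i) = P t y" using assms by (simp add: fun_eq_iff)
  ultimately show ?thesis using P_in_proj_zeros_iff by metis
qed

text \<open>Scaling by \<open>a\<close> moves \<open>V\<close> into the tangent space at
  \<open>p\<close>, which is a line modulo \<open>p\<close>, so proportionality applies;
  \<open>a ^ N\<close> reflects the degree \<open>-N\<close> of \<open>coeff_of\<close>.\<close>

lemma regular_form_determined:
  assumes \<omega>: "\<omega> \<in> regular_forms n eqs" and p: "p \<in> proj_zeros n eqs" and v: "v \<in> tangent n eqs p"
    and a: "a \<noteq> 0" and pa: "p = (\<lambda>i. a * P t y i)"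
  shows "\<epsilon> * \<omega> p v = a ^ N * coeff_of p v * \<omega> (P t y) (V t y)"
proof -
  have ab: "above t y" by (rule above_scaled[OF p a pa])
  have P: "P t y \<in> proj_zeros n eqs" using ab P_in_proj_zeros_iff by blast
  note V = V_tangent[OF ab]
  define u where "u = (\<lambda>i. a * V t y i)"
  have u: "u \<in> tangent n eqs p" unfolding u_def pa by (rule tangent_scale[OF homogeneous_eqs V])
  have 1: "a ^ N * coeff_of p u = \<epsilon>"
    using coeff_of_scale[OF P V a] coeff_of_chart[OF ab] by (simp add: pa u_def)
  have 2: "\<omega> p u = \<omega> (P t y) (V t y)"
    unfolding u_def pa by (rule regular_form_scale[OF homogeneous_eqs \<omega> P V a])
  have 3: "coeff_of p u * \<omega> p v = coeff_of p v * \<omega> p u"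
    by (rule regular_form_proportional[OF \<omega> p v u])
  have "\<epsilon> * \<omega> p v = a ^ N * (coeff_of p u * \<omega> p v)" by (simp add: 1[symmetric])
  then show ?thesis unfolding 3 2 by simp
qed

end

subsection \<open>Counting exponents\<close>

lemma finite_exponent_pairs:
  "finite (Sigma (exponents r s) (\<lambda>a. {i. 2 * (\<Sum>j\<in>{1..s}. a j) + i \<le> (M::nat)}))"
proof (rule finite_SigmaI)
  fix a :: "nat \<Rightarrow> nat"
  show "finite {i. 2 * (\<Sum>j\<in>{1..s}. a j) + i \<le> M}"
    by (rule finite_subset[of _ "{..M}"]) auto
qed simp

lemma card_exponent_pairs:
  assumes "r \<ge> 2" "s \<ge> 1"
  shows "int (card (Sigma (exponents r s)
      (\<lambda>a. {i. 2 * (\<Sum>j\<in>{1..s}. a j) + i \<le> 2 * (s * (r - 1) - 1)})))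
    = 1 + int r ^ s * (int s * (int r - 1) - 1)"
proof -
  define M where "M = s * (r - 1)"
  define wt :: "(nat \<Rightarrow> nat) \<Rightarrow> nat" where "wt a = (\<Sum>j\<in>{1..s}. a j)" for a
  define compl where "compl a = restrict (\<lambda>j. r - 1 - a j) {1..s}" for a
  define top' where "top' = restrict (\<lambda>_. r - 1) {1..s}"
  have M: "M \<ge> 1" using assms by (simp add: M_def)
  have compl: "compl a \<in> exponents r s" for a
    using assms by (auto simp: compl_def exponents_def)
  have compl_compl: "compl (compl a) = a" if "a \<in> exponents r s" for a
  proof
    fix j show "compl (compl a) j = a j"
    proof (cases "j \<in> {1..s}")
      case True
      then have "a j < r" using that by (auto simp: exponents_def)
      then show ?thesis using True by (simp add: compl_def)
    next
      case False
      then show ?thesis using that by (auto simp: compl_def exponents_def PiE_iff extensional_def)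
    qed
  qed
  have wt_compl: "wt a + wt (compl a) = M" if "a \<in> exponents r s" for a
  proof -
    have "wt a + wt (compl a) = (\<Sum>j\<in>{1..s}. a j + compl a j)" by (simp add: wt_def sum.distrib)
    also have "\<dots> = (\<Sum>j\<in>{1..s}. r - 1)"
    proof (intro sum.cong refl)
      fix j assume j: "j \<in> {1..s}"
      then have "a j < r" using that by (auto simp: exponents_def)
      then show "a j + compl a j = r - 1" using j by (simp add: compl_def)
    qed
    finally show ?thesis by (simp add: M_def)
  qed
  have top': "top' \<in> exponents r s" using assms by (auto simp: top'_def exponents_def)
  have top_iff: "wt a = M \<longleftrightarrow> a = top'" if a: "a \<in> exponents r s" for a
  proof
    assume "wt a = M"
    then have "wt (compl a) = 0" using wt_compl[OF a] by simp
    then have 0: "compl a j = 0" if "j \<in> {1..s}" for j using that by (simp add: wt_def)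
    show "a = top'"
    proof
      fix j show "a j = top' j"
      proof (cases "j \<in> {1..s}")
        case True
        then have "a j < r" "r - 1 - a j = 0" using a 0[of j] by (auto simp: exponents_def compl_def)
        then show ?thesis using True by (simp add: top'_def)
      next
        case False
        then show ?thesis using a by (auto simp: top'_def exponents_def PiE_iff extensional_def)
      qed
    qed
  qed (simp add: wt_def top'_def M_def)
  \<comment> \<open>For \<open>a = top'\<close> the weight is \<open>M\<close>, so no
    \<open>i\<close> is admissible, while the general count \<open>2 M - 1 - 2 |a|\<close> would be
    \<open>-1\<close>. This single correction is the summand 1 in the genus formula.\<close>
  have card_i: "int (card {i. 2 * wt a + i \<le> 2 * (M - 1)}) =
      2 * int M - 1 - 2 * int (wt a) + (if a = top' then 1 else 0)" if a: "a \<in> exponents r s" for a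
  proof (cases "a = top'")
    case True
    then have "wt a = M" using top_iff[OF a] by simp
    moreover then have "{i. 2 * wt a + i \<le> 2 * (M - 1)} = {}" using M by auto
    ultimately show ?thesis using True by simp
  next
    case False
    then have lt: "wt a < M" using top_iff[OF a] wt_compl[OF a] by linarith
    then have "{i. 2 * wt a + i \<le> 2 * (M - 1)} = {..2 * (M - 1) - 2 * wt a}" by auto
    then have "card {i. 2 * wt a + i \<le> 2 * (M - 1)} = Suc (2 * (M - 1) - 2 * wt a)" by simp
    then show ?thesis using lt False by auto
  qed
  have card_exp: "card (exponents r s) = r ^ s"
    by (simp add: exponents_def card_PiE)
  \<comment> \<open>The involution \<open>compl\<close> shows that the average weight is
    \<open>M / 2\<close>.\<close>
  have "(\<Sum>a\<in>exponents r s. wt a) = (\<Sum>a\<in>exponents r s. wt (compl a))"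
    by (rule sum.reindex_bij_witness[of _ compl compl]) (auto simp: compl compl_compl)
  then have "2 * (\<Sum>a\<in>exponents r s. wt a) = (\<Sum>a\<in>exponents r s. wt a + wt (compl a))"
    by (simp add: sum.distrib)
  also have "\<dots> = (\<Sum>a\<in>exponents r s. M)" using wt_compl by simp
  finally have "2 * (\<Sum>a\<in>exponents r s. wt a) = r ^ s * M" using card_exp by simp
  then have total: "2 * (\<Sum>a\<in>exponents r s. int (wt a)) = int r ^ s * int M"
    by (metis (no_types, lifting) of_nat_mult of_nat_numeral of_nat_power of_nat_sum sum.cong)
  have "int (card (Sigma (exponents r s) (\<lambda>a. {i. 2 * wt a + i \<le> 2 * (M - 1)})))
      = (\<Sum>a\<in>exponents r s. int (card {i. 2 * wt a + i \<le> 2 * (M - 1)}))"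
    by (subst card_SigmaI) (auto intro: finite_subset[of _ "{..2 * (M - 1)}"])
  also have "\<dots> = (\<Sum>a\<in>exponents r s. 2 * int M - 1 - 2 * int (wt a) + (if a = top' then 1 else 0))"
    by (intro sum.cong refl card_i)
  also have "\<dots> = int r ^ s * (2 * int M - 1) - 2 * (\<Sum>a\<in>exponents r s. int (wt a)) + 1"
    using top' by (simp add: sum.distrib sum_subtractf sum_distrib_left card_exp)
  also have "\<dots> = 1 + int r ^ s * (int M - 1)" unfolding total by (simp add: algebra_simps)
  also have "int M = int s * (int r - 1)" using assms by (simp add: M_def of_nat_diff)
  finally show ?thesis unfolding wt_def M_def .
qed

subsection \<open>The space of regular forms\<close>

context smooth_superelliptic
begin

lemma chart_finite: "chart \<iota> r s c0 c1 c2 c [:0, 1:] 1 [:\<iota> c2, \<iota> c1, \<iota> c0:] 1"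
  by unfold_locales (simp_all add: pderiv_pCons algebra_simps power2_eq_square)

text \<open>The first chart at \<open>t = 1/u\<close>, multiplied by \<open>u\<^sup>2\<close>. At
  \<open>u = 0\<close> it reaches the point of the conic with \<open>w = 0\<close>, where
  \<open>Z\<close> has the nonzero value \<open>c_0\<close>.\<close>

lemma chart_infinite: "chart \<iota> r s c0 c1 c2 c [:0, 1:] [:0, 0, 1:] [:\<iota> c0, \<iota> c1, \<iota> c2:] (- 1)"
proof unfold_locales
  fix t show "poly [:0, 0, 1:] t \<noteq> 0 \<or> poly [:\<iota> c0, \<iota> c1, \<iota> c2:] t \<noteq> 0"
    using c0 by (cases "t = 0") auto
qed (simp_all add: pderiv_pCons algebra_simps power2_eq_square)

interpretation C1: chart \<iota> r s c0 c1 c2 c "[:0, 1:]" 1 "[:\<iota> c2, \<iota> c1, \<iota> c0:]" 1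
  by (rule chart_finite)

interpretation C2: chart \<iota> r s c0 c1 c2 c "[:0, 1:]" "[:0, 0, 1:]" "[:\<iota> c0, \<iota> c1, \<iota> c2:]" "- 1"
  by (rule chart_infinite)

section \<open>Covering the curve by the two charts\<close>

lemma point_finite:
  assumes p: "p \<in> proj_zeros n eqs" and w: "p (s + 1) \<noteq> 0"
  shows "p = (\<lambda>i. p (s + 1) * C1.P (p 0 / p (s + 1)) (\<lambda>j. p j / p (s + 1)) i)"
proof
  fix i
  have "p (s + 1) * ell p = \<iota> c0 * (p 0)\<^sup>2" using p by (simp add: proj_zeros_iff Q_iff)
  then have z: "p (s + 2) = \<iota> c0 * (p 0)\<^sup>2 / p (s + 1) + \<iota> c1 * p 0 + \<iota> c2 * p (s + 1)"
    using w by (simp add: ell_def field_simps)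
  have pc: "i > n \<Longrightarrow> p i = 0" using p by (simp add: proj_zeros_def coord_space_def)
  consider "i = 0" | "i \<in> {1..s}" | "i = s + 1" | "i = s + 2" | "i > n" by fastforce
  then show "p i = p (s + 1) * C1.P (p 0 / p (s + 1)) (\<lambda>j. p j / p (s + 1)) i"
  proof cases
    case 4
    then show ?thesis using w z by (simp add: field_simps power2_eq_square)
  qed (use w pc in \<open>auto simp: C1.P_def\<close>)
qed

text \<open>The factor \<open>p (s + 2) / \<iota> c0\<close> compensates the value
  \<open>\<iota> c0\<close> of \<open>Z\<close> at 0; the \<open>y\<close>-coordinates are divided
  by it in return.\<close>

lemma point_infinite:
  assumes p: "p \<in> proj_zeros n eqs" and w: "p (s + 1) = 0"
  shows "p = (\<lambda>i. p (s + 2) / \<iota> c0 * C2.P 0 (\<lambda>j. \<iota> c0 * p j / p (s + 2)) i)"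
proof
  fix i
  note inf = at_infinity[OF p w]
  have pc: "i > n \<Longrightarrow> p i = 0" using p by (simp add: proj_zeros_def coord_space_def)
  consider "i = 0" | "i \<in> {1..s}" | "i = s + 1" | "i = s + 2" | "i > n" by fastforce
  then show "p i = p (s + 2) / \<iota> c0 * C2.P 0 (\<lambda>j. \<iota> c0 * p j / p (s + 2)) i"
    by cases (use inf(1,2) w pc c0 in \<open>auto simp: C2.P_def\<close>)
qed

text \<open>The common factor is the \<open>w\<close>-coordinate \<open>u\<^sup>2\<close> of the
  second chart; dividing every \<open>y_j\<close> by it gives each \<open>y_j\<close> weight
  2.\<close>

lemma chart_change:
  assumes u: "u \<noteq> 0"
  shows "C2.P u y = (\<lambda>i. u\<^sup>2 * C1.P (inverse u) (\<lambda>j. y j / u\<^sup>2) i)"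
proof
  fix i
  consider "i = 0" | "i \<in> {1..s}" | "i = s + 1" | "i = s + 2" | "i > n" by fastforce
  then show "C2.P u y i = u\<^sup>2 * C1.P (inverse u) (\<lambda>j. y j / u\<^sup>2) i"
    by cases (use u in \<open>auto simp: C1.P_def C2.P_def field_simps power2_eq_square\<close>)
qed

lemma above_change:
  assumes "u \<noteq> 0" "C2.above u y"
  shows "C1.above (inverse u) (\<lambda>j. y j / u\<^sup>2)"
proof -
  have p: "C2.P u y \<in> proj_zeros n eqs" using assms(2) C2.P_in_proj_zeros_iff by blast
  show ?thesis by (rule C1.above_scaled[OF p _ chart_change[OF assms(1)]]) (use assms(1) in simp)
qed

text \<open>The scaling factor \<open>u\<^sup>2\<close> enters with exponent \<open>N\<close>, and
  the sign is the constant coefficient \<open>-1\<close> of the second chart.\<close>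

lemma regular_form_change:
  assumes \<omega>: "\<omega> \<in> regular_forms n eqs" and u: "u \<noteq> 0" and y: "C2.above u y"
  shows "\<omega> (C2.P u y) (C2.V u y) =
    - (u ^ (2 * N)) * \<omega> (C1.P (inverse u) (\<lambda>j. y j / u\<^sup>2)) (C1.V (inverse u) (\<lambda>j. y j / u\<^sup>2))"
proof -
  have p: "C2.P u y \<in> proj_zeros n eqs" using y C2.P_in_proj_zeros_iff by blast
  have "1 * \<omega> (C2.P u y) (C2.V u y) = (u\<^sup>2) ^ N * coeff_of (C2.P u y) (C2.V u y) *
      \<omega> (C1.P (inverse u) (\<lambda>j. y j / u\<^sup>2)) (C1.V (inverse u) (\<lambda>j. y j / u\<^sup>2))"
    using u by (intro C1.regular_form_determined[OF \<omega> p C2.V_tangent[OF y]] chart_change) simp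
  then show ?thesis by (simp add: C2.coeff_of_chart[OF y] power_mult)
qed

text \<open>In the second chart the value at 0 is \<open>c_0^r\<close>. If the polynomial of the
  first chart were 0, the change of charts would make that of the second vanish at every
  \<open>u \<noteq> 0\<close>.\<close>

lemma HH_nonzero:
  assumes j: "j \<in> {1..s}" shows "C1.HH j \<noteq> 0" "C2.HH j \<noteq> 0"
proof -
  show 2: "C2.HH j \<noteq> 0"
  proof
    assume "C2.HH j = 0"
    moreover have "poly (C2.HH j) 0 = \<iota> c0 ^ r"
      using C2.poly_eval_h_P[of j 0 "\<lambda>_. 0"] by (simp add: h_at_infinity)
    ultimately show False using c0 by simp
  qed
  show "C1.HH j \<noteq> 0"
  proof
    assume 0: "C1.HH j = 0"
    have "poly (C2.HH j) u = 0" if "u \<in> - {0}" for u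
    proof -
      obtain y where y: "C2.above u y" using C2.exists_above by blast
      then have "C1.above (inverse u) (\<lambda>j. y j / u\<^sup>2)" using that above_change by simp
      then have "(y j / u\<^sup>2) ^ r = 0" using 0 j by (simp add: C1.above_def)
      then have "y j ^ r = 0" using that by (simp add: power_divide)
      moreover have "poly (C2.HH j) u = y j ^ r" using y j by (simp add: C2.above_def)
      ultimately show ?thesis by simp
    qed
    moreover have "infinite (- {0 :: 'a})"
      using infinite_UNIV_alg_closed[where 'a = 'a] by (metis finite_compl finite.emptyI finite.insertI)
    ultimately have "C2.HH j = 0" by (intro poly_eq_0_if_infinite_zeros)
    then show False using 2 by simp
  qed
qed

text \<open>The first chart covers the points with \<open>w \<noteq> 0\<close>. In the second chart
  the two normal forms agree for \<open>u \<noteq> 0\<close>, hence everywhere by uniqueness, which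
  settles the points with \<open>w = 0\<close>.\<close>

lemma regular_form_eqI:
  assumes \<omega>: "\<omega> \<in> regular_forms n eqs" "\<omega>' \<in> regular_forms n eqs"
    and eq: "\<And>t y. C1.above t y \<Longrightarrow> \<omega> (C1.P t y) (C1.V t y) = \<omega>' (C1.P t y) (C1.V t y)"
  shows "\<omega> = \<omega>'"
proof (intro ext)
  fix p v
  obtain g where g: "\<forall>t y. C2.above t y \<longrightarrow> \<omega> (C2.P t y) (C2.V t y) = C2.normal_form g t y"
    using C2.regular_form_polyfun[OF \<omega>(1)] unfolding C2.polyfun_def by blast
  obtain g' where g': "\<forall>t y. C2.above t y \<longrightarrow> \<omega>' (C2.P t y) (C2.V t y) = C2.normal_form g' t y"
    using C2.regular_form_polyfun[OF \<omega>(2)] unfolding C2.polyfun_def by blast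
  have "g a = g' a" if "a \<in> exponents r s" for a
  proof (rule C2.normal_form_unique[OF _ _ _ that])
    fix t y assume t: "t \<notin> {0}" and y: "C2.above t y"
    then have t0: "t \<noteq> 0" by simp
    have "\<omega> (C2.P t y) (C2.V t y) = \<omega>' (C2.P t y) (C2.V t y)"
      unfolding regular_form_change[OF \<omega>(1) t0 y] regular_form_change[OF \<omega>(2) t0 y]
      using eq[OF above_change[OF t0 y]] by simp
    then show "C2.normal_form g t y = C2.normal_form g' t y" using g g' y by simp
  qed (auto simp: HH_nonzero)
  then have eq2: "\<omega> (C2.P t y) (C2.V t y) = \<omega>' (C2.P t y) (C2.V t y)" if "C2.above t y" for t y
    using g g' that by (simp add: C2.normal_form_def)
  show "\<omega> p v = \<omega>' p v"
  proof (cases "p \<in> proj_zeros n eqs \<and> v \<in> tangent n eqs p")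
    case False
    then show ?thesis using \<omega> unfolding regular_forms_def by auto
  next
    case True
    then have p: "p \<in> proj_zeros n eqs" and v: "v \<in> tangent n eqs p" by auto
    show ?thesis
    proof (cases "p (s + 1) = 0")
      case False
      note pe = point_finite[OF p False]
      note det = C1.regular_form_determined[OF _ p v False pe]
      show ?thesis using det[OF \<omega>(1)] det[OF \<omega>(2)] eq[OF C1.above_scaled[OF p False pe]] by simp
    next
      case w: True
      have a: "p (s + 2) / \<iota> c0 \<noteq> 0" using at_infinity(2)[OF p w] c0 by simp
      note pe = point_infinite[OF p w]
      note det = C2.regular_form_determined[OF _ p v a pe]
      have "- 1 * \<omega> p v = - 1 * \<omega>' p v"
        unfolding det[OF \<omega>(1)] det[OF \<omega>(2)] eq2[OF C2.above_scaled[OF p a pe]] ..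
      then show ?thesis by simp
    qed
  qed
qed

text \<open>Comparing the charts term by term gives
  \<open>g'_a(u) = - u^(2N - 2|a|) g_a(1/u)\<close> away from branch points, and \<open>g'_a\<close>
  is a polynomial, so the right side has no pole at \<open>u = 0\<close>.\<close>

lemma regular_form_degree_bound:
  assumes \<omega>: "\<omega> \<in> regular_forms n eqs"
    and g: "\<forall>t y. C1.above t y \<longrightarrow> \<omega> (C1.P t y) (C1.V t y) = C1.normal_form g t y"
    and a: "a \<in> exponents r s" and nz: "g a \<noteq> 0"
  shows "2 * (\<Sum>j\<in>{1..s}. a j) + degree (g a) \<le> 2 * N"
proof -
  let ?wt = "\<lambda>a :: nat \<Rightarrow> nat. 2 * (\<Sum>j\<in>{1..s}. a j)"
  obtain g' where g': "\<forall>t y. C2.above t y \<longrightarrow> \<omega> (C2.P t y) (C2.V t y) = C2.normal_form g' t y"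
    using C2.regular_form_polyfun[OF \<omega>] unfolding C2.polyfun_def by blast
  define T where "T = (\<Union>j\<in>{1..s}. {t. poly (C2.HH j) t = 0})"
  have "finite T" unfolding T_def using HH_nonzero by (auto intro: poly_roots_finite)
  then show ?thesis
  proof (rule degree_bound_reflect[OF _ nz])
    show "- 1 \<noteq> (0::'a)" by simp
    fix u assume uT: "u \<notin> T" and u: "u \<noteq> 0"
    obtain y where y: "C2.above u y" using C2.exists_above by blast
    have "y j \<noteq> 0" if "j \<in> {1..s}" for j
    proof -
      have "poly (C2.HH j) u \<noteq> 0" using uT that by (auto simp: T_def)
      then have "y j ^ r \<noteq> 0" using y that by (simp add: C2.above_def)
      then show ?thesis using C2.r_pos by (metis zero_power)
    qed
    moreover have "(\<Sum>a\<in>exponents r s. poly (g' a) u * multi_pow s a (\<lambda>j. e j * y j)) =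
        (\<Sum>a\<in>exponents r s. (- (u ^ (2 * N)) * poly (g a) (inverse u) / u ^ ?wt a) *
           multi_pow s a (\<lambda>j. e j * y j))" if e: "e \<in> unit_group r s" for e
    proof -
      let ?y = "\<lambda>j. e j * y j"
      have ey: "C2.above u ?y" by (rule C2.above_unit_group[OF y e])
      have mp: "multi_pow s a (\<lambda>j. ?y j / u\<^sup>2) = multi_pow s a ?y / u ^ ?wt a" for a
        by (simp add: multi_pow_def power_divide prod_dividef power_sum power_mult[symmetric] sum_distrib_left)
      have "C2.normal_form g' u ?y = - (u ^ (2 * N)) * C1.normal_form g (inverse u) (\<lambda>j. ?y j / u\<^sup>2)"
        using regular_form_change[OF \<omega> u ey] g g' ey above_change[OF u ey] by simp
      then show ?thesis
        unfolding C1.normal_form_def C2.normal_form_def mp by (simp add: sum_distrib_left mult_ac)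
    qed
    ultimately have "poly (g' a) u = - (u ^ (2 * N)) * poly (g a) (inverse u) / u ^ ?wt a"
      by (intro unit_group_unique[OF of_nat_r a, of "\<lambda>a. poly (g' a) u" y
            "\<lambda>a. - (u ^ (2 * N)) * poly (g a) (inverse u) / u ^ ?wt a"])
    then show "poly (g' a) u * u ^ ?wt a = - 1 * u ^ (2 * N) * poly (g a) (inverse u)"
      using u by simp
  qed
qed

text \<open>
  On the conic \<open>w \<ell> = c_0 x\<^sup>2\<close>, with \<open>\<ell>\<close> the form \<open>ell\<close>, the polynomial below equals
  \<open>t\<^sup>i y\<^sup>a\<close> where \<open>w = 1\<close> and \<open>x = t\<close>.
\<close>

definition basis_poly :: "(nat \<Rightarrow> nat) \<Rightarrow> nat \<Rightarrow> 'a mpoly" where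
  "basis_poly a i = (let m = N - (\<Sum>j\<in>{1..s}. a j) in
     (\<Prod>j\<in>{1..s}. Var j ^ a j) *
     (if i \<le> m then Var 0 ^ i * Var (s + 1) ^ (m - i)
      else Const (inverse (\<iota> c0 ^ (i - m))) * Var 0 ^ (2 * m - i) *
        (Var (s + 2) - Const (\<iota> c1) * Var 0 - Const (\<iota> c2) * Var (s + 1)) ^ (i - m)))"

lemma homogeneous_basis_poly:
  assumes "2 * (\<Sum>j\<in>{1..s}. a j) + i \<le> 2 * N"
  shows "basis_poly a i \<in> homogeneous n N"
proof -
  define wt where "wt = (\<Sum>j\<in>{1..s}. a j)"
  define m where "m = N - wt"
  define l where "l = (Var (s + 2) - Const (\<iota> c1) * Var 0 - Const (\<iota> c2) * Var (s + 1) :: 'a mpoly)"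
  have m: "wt + m = N" "i \<le> 2 * m" using assms by (auto simp: m_def wt_def)
  have v: "Var k \<in> homogeneous n 1" if "k \<le> n" for k by (rule homogeneous_Var[OF that])
  have y: "(\<Prod>j\<in>{1..s}. Var j ^ a j) \<in> homogeneous n wt"
  proof -
    have "(\<Prod>j\<in>{1..s}. Var j ^ a j) \<in> homogeneous n (\<Sum>j\<in>{1..s}. a j * 1)"
      by (intro homogeneous_prod homogeneous_power homogeneous_Var) auto
    then show ?thesis by (simp add: wt_def)
  qed
  have l: "l \<in> homogeneous n 1"
    unfolding l_def by (intro homogeneous_diff homogeneous_Var homogeneous_Const_Var) simp_all
  have "(if i \<le> m then Var 0 ^ i * Var (s + 1) ^ (m - i)
      else Const (inverse (\<iota> c0 ^ (i - m))) * Var 0 ^ (2 * m - i) * l ^ (i - m)) \<in> homogeneous n m"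
  proof (cases "i \<le> m")
    case True
    have "Var 0 ^ i * Var (s + 1) ^ (m - i) \<in> homogeneous n (i * 1 + (m - i) * 1)"
      by (intro homogeneous_mult homogeneous_power v) auto
    then show ?thesis using True by simp
  next
    case False
    have "Const (inverse (\<iota> c0 ^ (i - m))) * Var 0 ^ (2 * m - i) * l ^ (i - m)
        \<in> homogeneous n (0 + (2 * m - i) * 1 + (i - m) * 1)"
      by (intro homogeneous_mult homogeneous_power homogeneous_Const v l) auto
    moreover have "0 + (2 * m - i) * 1 + (i - m) * 1 = m" using m(2) False by simp
    ultimately show ?thesis using False by (simp only: if_False)
  qed
  from homogeneous_mult[OF y this] show ?thesis
    unfolding basis_poly_def Let_def l_def[symmetric] wt_def[symmetric] m_def[symmetric] m(1) .
qed

lemma poly_eval_basis_poly: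
  assumes "2 * (\<Sum>j\<in>{1..s}. a j) + i \<le> 2 * N"
  shows "poly_eval (basis_poly a i) (C1.P t y) = t ^ i * multi_pow s a y"
proof -
  define m where "m = N - (\<Sum>j\<in>{1..s}. a j)"
  have im: "i \<le> 2 * m" using assms by (simp add: m_def)
  have y: "(\<Prod>j\<in>{1..s}. C1.P t y j ^ a j) = multi_pow s a y"
    unfolding multi_pow_def by (intro prod.cong) auto
  show ?thesis
  proof (cases "i \<le> m")
    case True
    then show ?thesis
      unfolding basis_poly_def Let_def m_def[symmetric] by (simp add: y[simplified])
  next
    case False
    have "(\<iota> c0 * t\<^sup>2) ^ (i - m) = \<iota> c0 ^ (i - m) * t ^ (2 * (i - m))"
      by (simp add: power_mult_distrib power_mult)
    moreover have "t ^ (2 * m - i) * t ^ (2 * (i - m)) = t ^ i"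
      unfolding power_add[symmetric] using False im by (intro arg_cong[where f = "power t"]) simp
    ultimately have "inverse (\<iota> c0 ^ (i - m)) * t ^ (2 * m - i) * (\<iota> c0 * t\<^sup>2) ^ (i - m) = t ^ i"
      using c0 by (simp add: mult_ac)
    moreover have "\<iota> c2 + t * (\<iota> c1 + t * \<iota> c0) - \<iota> c1 * t - \<iota> c2 = \<iota> c0 * t\<^sup>2"
      by (simp add: algebra_simps power2_eq_square)
    ultimately show ?thesis
      using False unfolding basis_poly_def Let_def m_def[symmetric] by (simp add: y[simplified])
  qed
qed

section \<open>The basis of the space of regular forms\<close>

definition index_set :: "((nat \<Rightarrow> nat) \<times> nat) set" where
  "index_set = Sigma (exponents r s) (\<lambda>a. {i. 2 * (\<Sum>j\<in>{1..s}. a j) + i \<le> 2 * N})"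

definition basis_form :: "(nat \<Rightarrow> nat) \<times> nat \<Rightarrow> (nat \<Rightarrow> 'a) \<Rightarrow> (nat \<Rightarrow> 'a) \<Rightarrow> 'a" where
  "basis_form x = form_of (basis_poly (fst x) (snd x))"

lemma finite_index_set: "finite index_set"
  unfolding index_set_def by (rule finite_exponent_pairs)

lemma basis_form_regular: "x \<in> index_set \<Longrightarrow> basis_form x \<in> regular_forms n eqs"
  unfolding basis_form_def index_set_def by (intro form_of_regular homogeneous_basis_poly) auto

lemma form_of_chart:
  assumes "C1.above t y" shows "form_of F (C1.P t y) (C1.V t y) = poly_eval F (C1.P t y)"
proof -
  have "C1.P t y \<in> proj_zeros n eqs" using assms C1.P_in_proj_zeros_iff by blast
  then show ?thesis
    using C1.V_tangent[OF assms] C1.coeff_of_chart[OF assms] unfolding form_of_def by simp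
qed

lemma basis_form_chart:
  assumes "C1.above t y" "x \<in> index_set"
  shows "basis_form x (C1.P t y) (C1.V t y) = t ^ snd x * multi_pow s (fst x) y"
  using assms unfolding basis_form_def
  by (auto simp: form_of_chart index_set_def poly_eval_basis_poly)

lemma sum_index_set:
  "(\<Sum>x\<in>index_set. f (fst x) (snd x)) =
     (\<Sum>a\<in>exponents r s. \<Sum>i | 2 * (\<Sum>j\<in>{1..s}. a j) + i \<le> 2 * N. f a i)"
  unfolding index_set_def
  by (subst sum.Sigma) (auto simp: case_prod_beta intro: finite_subset[of _ "{..2 * N}"])

text \<open>Grouping the terms by \<open>a\<close> turns the sum into a normal form that vanishes on
  the whole cover; uniqueness gives \<open>g a = 0\<close>, and \<open>k (a, i)\<close> is a
  coefficient of \<open>g a\<close>.\<close>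

lemma chart_independent:
  assumes 0: "\<And>t y. C1.above t y \<Longrightarrow>
      (\<Sum>x\<in>index_set. k x * (t ^ snd x * multi_pow s (fst x) y)) = 0"
    and x: "x \<in> index_set"
  shows "k x = (0::'a)"
proof -
  let ?I = "\<lambda>a. {i. 2 * (\<Sum>j\<in>{1..s}. a j) + i \<le> 2 * N}"
  have finI: "finite (?I a)" for a by (rule finite_subset[of _ "{..2 * N}"]) auto
  define g where "g a = (\<Sum>i\<in>?I a. monom (k (a, i)) i)" for a
  have "C1.normal_form g t y = C1.normal_form (\<lambda>_. 0) t y" if "C1.above t y" for t y
  proof -
    have "C1.normal_form g t y = (\<Sum>a\<in>exponents r s. \<Sum>i\<in>?I a. k (a, i) * (t ^ i * multi_pow s a y))"
      by (simp add: C1.normal_form_def g_def poly_sum poly_monom sum_distrib_left sum_distrib_right mult_ac)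
    also have "\<dots> = (\<Sum>x\<in>index_set. k (fst x, snd x) * (t ^ snd x * multi_pow s (fst x) y))"
      by (rule sum_index_set[symmetric])
    also have "\<dots> = 0" using 0[OF that] by simp
    finally show ?thesis by (simp add: C1.normal_form_def)
  qed
  moreover have fx: "fst x \<in> exponents r s" "snd x \<in> ?I (fst x)" using x by (auto simp: index_set_def)
  ultimately have "g (fst x) = 0"
    using C1.normal_form_unique[of "{}" g "\<lambda>_. 0" "fst x"] HH_nonzero by simp
  then have "coeff (g (fst x)) (snd x) = 0" by simp
  then have "(\<Sum>i\<in>?I (fst x). if i = snd x then k (fst x, i) else 0) = 0"
    by (simp add: g_def coeff_sum)
  then show ?thesis using fx(2) finI[of "fst x"] by simp
qed

lemma sum_form_apply: "(\<Sum>x\<in>I. f x) p v = (\<Sum>x\<in>I. f x p v)"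
  for f :: "_ \<Rightarrow> (nat \<Rightarrow> 'a) \<Rightarrow> (nat \<Rightarrow> 'a) \<Rightarrow> 'a"
  by (induction I rule: infinite_finite_induct) auto

text \<open>Independence and dimension are stated for the set of forms, so coincidences in the
  family must be excluded before counting indices. The coefficients 1 at \<open>x\<close> and -1 at
  \<open>x'\<close> would give a relation.\<close>

lemma inj_basis_form: "inj_on basis_form index_set"
proof (rule inj_onI, rule ccontr)
  fix x x' assume x: "x \<in> index_set" "x' \<in> index_set" and eq: "basis_form x = basis_form x'" and ne: "x \<noteq> x'"
  define k where "k z = (if z = x then 1 else 0) - (if z = x' then 1 else (0::'a))" for z
  have "k x = 0"
  proof (rule chart_independent[OF _ x(1)])
    fix t y assume ab: "C1.above t y"
    let ?m = "\<lambda>z. t ^ snd z * multi_pow s (fst z) y"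
    have "(\<Sum>z\<in>index_set. k z * ?m z) =
        (\<Sum>z\<in>index_set. (if z = x then ?m z else 0) - (if z = x' then ?m z else 0))"
      by (intro sum.cong) (auto simp: k_def)
    also have "\<dots> = ?m x - ?m x'"
      unfolding sum_subtractf using x finite_index_set by simp
    finally have "(\<Sum>z\<in>index_set. k z * ?m z) = ?m x - ?m x'" .
    then show "(\<Sum>z\<in>index_set. k z * (t ^ snd z * multi_pow s (fst z) y)) = 0"
      using eq basis_form_chart[OF ab x(1)] basis_form_chart[OF ab x(2)] by simp
  qed
  then show False using ne by (simp add: k_def)
qed

lemma independent_basis_forms: "form.independent (basis_form ` index_set)"
proof
  assume "form.dependent (basis_form ` index_set)"
  then obtain f \<eta> where \<eta>: "\<eta> \<in> basis_form ` index_set" "f \<eta> \<noteq> 0"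
    and 0: "(\<Sum>b\<in>basis_form ` index_set. form_scale (f b) b) = 0"
    unfolding form.dependent_finite[OF finite_imageI[OF finite_index_set]] by blast
  from \<eta>(1) obtain x where x: "x \<in> index_set" "\<eta> = basis_form x" by (rule imageE)
  have sum0: "(\<Sum>x\<in>index_set. form_scale (f (basis_form x)) (basis_form x)) = 0"
    using 0 unfolding sum.reindex[OF inj_basis_form] o_def .
  have "f (basis_form x) = 0"
  proof (rule chart_independent[where k = "\<lambda>x. f (basis_form x)"])
    fix t y assume ab: "C1.above t y"
    have "(\<Sum>x\<in>index_set. f (basis_form x) * (t ^ snd x * multi_pow s (fst x) y)) =
        (\<Sum>x\<in>index_set. form_scale (f (basis_form x)) (basis_form x)) (C1.P t y) (C1.V t y)"
      unfolding sum_form_apply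
      by (intro sum.cong refl) (simp add: form_scale_def basis_form_chart[OF ab])
    also have "\<dots> = 0" unfolding sum0 by simp
    finally show "(\<Sum>x\<in>index_set. f (basis_form x) * (t ^ snd x * multi_pow s (fst x) y)) = 0" .
  qed (rule x(1))
  then show False using x \<eta>(2) by simp
qed

text \<open>The degree bound places every monomial of the normal form in \<open>index_set\<close>,
  so the polynomial \<open>F\<close> with these coefficients yields a form with the same values on
  the first chart, and those values determine the form.\<close>

lemma regular_forms_subset_span: "regular_forms n eqs \<subseteq> form.span (basis_form ` index_set)"
proof
  fix \<omega> assume \<omega>: "\<omega> \<in> regular_forms n eqs"
  obtain g where g: "\<forall>t y. C1.above t y \<longrightarrow> \<omega> (C1.P t y) (C1.V t y) = C1.normal_form g t y"
    using C1.regular_form_polyfun[OF \<omega>] unfolding C1.polyfun_def by blast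
  let ?I = "\<lambda>a. {i. 2 * (\<Sum>j\<in>{1..s}. a j) + i \<le> 2 * N}"
  define k where "k x = coeff (g (fst x)) (snd x)" for x
  have poly_g: "poly (g a) t = (\<Sum>i\<in>?I a. coeff (g a) i * t ^ i)" if a: "a \<in> exponents r s" for a t
  proof (cases "g a = 0")
    case False
    have "{..degree (g a)} \<subseteq> ?I a"
      using regular_form_degree_bound[OF \<omega> g a False] by auto
    moreover have "finite (?I a)" by (rule finite_subset[of _ "{..2 * N}"]) auto
    ultimately show ?thesis
      unfolding poly_altdef by (intro sum.mono_neutral_left) (auto simp: coeff_eq_0)
  qed simp
  define F where "F = (\<Sum>x\<in>index_set. Const (k x) * basis_poly (fst x) (snd x))"
  have "F \<in> homogeneous n N" unfolding F_def
  proof (intro homogeneous_sum)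
    fix x assume "x \<in> index_set"
    then have "Const (k x) * basis_poly (fst x) (snd x) \<in> homogeneous n (0 + N)"
      by (intro homogeneous_mult homogeneous_Const homogeneous_basis_poly) (auto simp: index_set_def)
    then show "Const (k x) * basis_poly (fst x) (snd x) \<in> homogeneous n N" by simp
  qed
  then have F: "form_of F \<in> regular_forms n eqs" by (rule form_of_regular)
  have sum_F: "form_of F = (\<Sum>x\<in>index_set. form_scale (k x) (basis_form x))"
  proof (intro ext)
    fix p v
    show "form_of F p v = (\<Sum>x\<in>index_set. form_scale (k x) (basis_form x)) p v"
      unfolding sum_form_apply
    proof (cases "p \<in> proj_zeros n eqs \<and> v \<in> tangent n eqs p")
      case True
      then show "form_of F p v = (\<Sum>x\<in>index_set. form_scale (k x) (basis_form x) p v)"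
        by (simp add: form_of_def F_def form_scale_def basis_form_def sum_distrib_right mult.assoc)
    next
      case False
      then have "form_of G p v = 0" for G unfolding form_of_def by (rule if_not_P)
      then show "form_of F p v = (\<Sum>x\<in>index_set. form_scale (k x) (basis_form x) p v)"
        by (simp add: form_scale_def basis_form_def)
    qed
  qed
  have "\<omega> = form_of F"
  proof (rule regular_form_eqI[OF \<omega> F])
    fix t y assume ab: "C1.above t y"
    have "form_of F (C1.P t y) (C1.V t y) = (\<Sum>x\<in>index_set. k x * (t ^ snd x * multi_pow s (fst x) y))"
      unfolding sum_F sum_form_apply
      by (intro sum.cong refl) (simp add: form_scale_def basis_form_chart[OF ab])
    also have "\<dots> = (\<Sum>a\<in>exponents r s. \<Sum>i\<in>?I a. coeff (g a) i * (t ^ i * multi_pow s a y))"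
      unfolding k_def by (rule sum_index_set)
    also have "\<dots> = C1.normal_form g t y"
      unfolding C1.normal_form_def
      by (intro sum.cong refl) (simp add: poly_g sum_distrib_right mult.assoc)
    finally show "\<omega> (C1.P t y) (C1.V t y) = form_of F (C1.P t y) (C1.V t y)" using g ab by simp
  qed
  also have "\<dots> \<in> form.span (basis_form ` index_set)"
    unfolding sum_F by (intro form.span_sum form.span_scale form.span_base) simp
  finally show "\<omega> \<in> form.span (basis_form ` index_set)" .
qed

lemma genus_eq: "int (genus n eqs) = 1 + int r ^ s * (int s * (int r - 1) - 1)"
proof -
  have "form.dim (regular_forms n eqs) = card (basis_form ` index_set)"
    using basis_form_regular regular_forms_subset_span independent_basis_forms
    by (intro form.dim_unique[of "basis_form ` index_set"]) auto
  also have "\<dots> = card index_set" by (rule card_image[OF inj_basis_form])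
  finally show ?thesis
    unfolding genus_def index_set_def N_def using card_exponent_pairs[OF r2 s1] by simp
qed

end

theorem theorem1p1:
  fixes \<iota> :: "'k::field \<Rightarrow> 'a::alg_closed_field"
    and r s :: nat
    and c0 c1 c2 :: 'k
    and c :: "nat \<Rightarrow> nat \<Rightarrow> 'k"
  assumes "r \<ge> 2" and "s \<ge> 1"
    and "\<not> CHAR('k) dvd 2 * r"
    and "field_embedding \<iota>"
    and "smooth_curve (s + 2) (curve_eqs \<iota> r s c0 c1 c2 c)"
    and "c0 \<noteq> 0"
  shows "int (genus (s + 2) (curve_eqs \<iota> r s c0 c1 c2 c))
       = 1 + int r ^ s * (int s * (int r - 1) - 1)"
proof -
  have one: "\<iota> 1 = 1" and add: "\<And>a b. \<iota> (a + b) = \<iota> a + \<iota> b" and mult: "\<And>a b. \<iota> (a * b) = \<iota> a * \<iota> b"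
    using assms(4) by (auto simp: field_embedding_def)
  have "\<iota> 0 + \<iota> 0 = \<iota> 0 + 0" using add[of 0 0] by (simp only: add_0_right)
  then have zero: "\<iota> 0 = 0" by (rule add_left_imp_eq)
  have nz: "\<iota> a \<noteq> 0" if "a \<noteq> 0" for a
    using mult[of a "inverse a"] that one by auto
  have of_nat: "\<iota> (of_nat m) = of_nat m" for m
    by (induction m) (simp_all add: zero one add)
  \<comment> \<open>A characteristic dividing \<open>r\<close> would divide \<open>2 * r\<close>;
    the embedding then carries the nonvanishing to the field of points.\<close>
  have "of_nat r \<noteq> (0 :: 'k)"
    using assms(3) by (auto simp: of_nat_eq_0_iff_char_dvd)
  then have "of_nat r \<noteq> (0 :: 'a)" using nz of_nat by metis
  then interpret smooth_superelliptic \<iota> r s c0 c1 c2 c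
    using assms nz by unfold_locales auto
  show ?thesis by (rule genus_eq)
qed

end
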